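(* There is a universal constant $C>0$ such that the following holds. Let $\mathbf{A}\in\mathbb{R}^{d\times d}$ be symmetric positive definite with eigenvalues $\lambda_1\ge\cdots\ge\lambda_d$, let $\mathbf{b}\in\mathbb{R}^d$ be nonzero, let $\mathbf{\Omega}\in\mathbb{R}^{d\times\ell}$ be a Gaussian matrix, and let $r\ge0$ and $\delta\in(0,1)$. Then, for some $$s\le C\left(\frac{r}{\ell}\log\left(\frac1\Delta\right)+\log\left(\frac d\delta\right)\right),\qquad \Delta:=\min_{i=1,\dots,\ell\lceil r/\ell\rceil-1}\frac{\lambda_i-\lambda_{i+1}}{\lambda_1},$$ the block-CG iterate $\mathrm{bcg}_t^{(1)}(\mu)$ with starting block $\mathbf{B}=[\mathbf{b}~\mathbf{\Omega}]$ satisfies, with probability at least $1-\delta$, $$\left\{\forall\mu\ge0:\ \frac{\|\mathbf{A}_\mu^{-1}\mathbf{b}-\mathrm{bcg}_t^{(1)}(\mu)\|_{\mathbf{A}_\mu}}{\|\mathbf{A}_\mu^{-1}\mathbf{b}\|_{\mathbf{A}_\mu}}\le2\exp\left(-\frac{t-s}{3\sqrt{\kappa_{r+1}(\mu)}}\right)\right\}.$$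
   Context: $\mathbf{A}_\mu=\mathbf{A}+\mu\mathbf{I}$; $\kappa_{r+1}(\mu)=(\lambda_{r+1}+\mu)/(\lambda_d+\mu)$; $\|\mathbf{x}\|_{\mathbf{M}}=\sqrt{\mathbf{x}^{\mathsf T}\mathbf{M}\mathbf{x}}$. The quantities $r,\ell,s,t$ are integers, $\ell\ge1$, $t\ge 0$, and all eigenvalue indices that appear are understood to lie in $\{1,\dots,d\}$. The term $\frac r\ell\log(1/\Delta)$ is read as $0$ if the minimum defining $\Delta$ is over an empty set, and as $+\infty$ if $\Delta=0$. A Gaussian matrix has independent standard normal entries. Krylov subspaces: $\mathcal{K}_t(\mathbf{M},\mathbf{v})=\operatorname{span}\{\mathbf{v},\mathbf{M}\mathbf{v},\dots,\mathbf{M}^{t-1}\mathbf{v}\}$, and for a matrix $\mathbf{V}$ with columns $\mathbf{v}^{(1)},\dots,\mathbf{v}^{(k)}$, $\mathcal{K}_t(\mathbf{M},\mathbf{V})=\mathcal{K}_t(\mathbf{M},\mathbf{v}^{(1)})+\cdots+\mathcal{K}_t(\mathbf{M},\mathbf{v}^{(k)})$. Block-CG: for $\mathbf{B}$ with columns $\mathbf{b}^{(1)},\mathbf{b}^{(2)},\dots$, $\mathrm{bcg}_t^{(i)}(\mu)=\operatorname{argmin}\{\|\mathbf{A}_\mu^{-1}\mathbf{b}^{(i)}-\mathbf{x}\|_{\mathbf{A}_\mu}:\mathbf{x}\in\mathcal{K}_t(\mathbf{A}_\mu,\mathbf{B})\}$ (so for $\mathbf{B}=[\mathbf{b}~\mathbf{\Omega}]$,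 $\mathbf{b}^{(1)}=\mathbf{b}$). *)

theory Defs
  imports
    "HOL-Probability.Probability"
    "Jordan_Normal_Form.Char_Poly"
    "Jordan_Normal_Form.Gauss_Jordan_Elimination"
    "Jordan_Normal_Form.VS_Connect"
begin

hide_type (open) Finite_Cartesian_Product.vec
hide_const (open) Finite_Cartesian_Product.mat Finite_Cartesian_Product.vec

(* The constant of the theorem is uniform in the dimension d, so d has to be a term variable;
   hence the matrices and vectors of Jordan_Normal_Form rather than real ^ 'n. *)

definition sym_pos_def :: "nat \<Rightarrow> real mat \<Rightarrow> bool" where
  "sym_pos_def d A \<longleftrightarrow> A \<in> carrier_mat d d \<and> transpose_mat A = A \<and>
     (\<forall>x \<in> carrier_vec d. x \<noteq> 0\<^sub>v d \<longrightarrow> scalar_prod x (A *\<^sub>v x) > 0)"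

(* lam 1 \<ge> ... \<ge> lam d are the eigenvalues of A with (algebraic) multiplicity; the values of lam
   outside {1..d} are irrelevant. *)
definition eigenvalues_decreasing :: "nat \<Rightarrow> real mat \<Rightarrow> (nat \<Rightarrow> real) \<Rightarrow> bool" where
  "eigenvalues_decreasing d A lam \<longleftrightarrow>
     char_poly A = (\<Prod>i = 1..d. [:- lam i, 1:]) \<and>
     (\<forall>i j. 1 \<le> i \<and> i \<le> j \<and> j \<le> d \<longrightarrow> lam j \<le> lam i)"

definition shifted :: "real mat \<Rightarrow> real \<Rightarrow> real mat" where
  "shifted A \<mu> = A + \<mu> \<cdot>\<^sub>m 1\<^sub>m (dim_row A)"

(* Only meaningful for invertible M; here M is always positive definite. *)
definition inv_mat :: "real mat \<Rightarrow> real mat" where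
  "inv_mat M = the (mat_inverse M)"

definition norm_wrt :: "real mat \<Rightarrow> real vec \<Rightarrow> real" where
  "norm_wrt M x = sqrt (scalar_prod x (M *\<^sub>v x))"

definition krylov :: "nat \<Rightarrow> real mat \<Rightarrow> real vec \<Rightarrow> real vec set" where
  "krylov t M v =
     LinearCombinations.module.span class_ring (module_vec TYPE(real) (dim_row M))
       {(M ^\<^sub>m i) *\<^sub>v v | i. i < t}"

definition block_krylov :: "nat \<Rightarrow> real mat \<Rightarrow> real mat \<Rightarrow> real vec set" where
  "block_krylov t M V =
     {finsum_vec TYPE(real) (dim_row M) w {..<dim_col V} | w.
        \<forall>j < dim_col V. w j \<in> krylov t M (col V j)}"

(* Columns are indexed from 0, so bcg with i = 0 is the iterate for the first column of B. *)
definition bcg :: "real mat \<Rightarrow> real mat \<Rightarrow> nat \<Rightarrow> nat \<Rightarrow> real \<Rightarrow> real vec" where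
  "bcg A B i t \<mu> =
     arg_min (\<lambda>x. norm_wrt (shifted A \<mu>) (inv_mat (shifted A \<mu>) *\<^sub>v col B i - x))
             (\<lambda>x. x \<in> block_krylov t (shifted A \<mu>) B)"

definition \<kappa> :: "nat \<Rightarrow> (nat \<Rightarrow> real) \<Rightarrow> nat \<Rightarrow> real \<Rightarrow> real" where
  "\<kappa> d lam k \<mu> = (lam k + \<mu>) / (lam d + \<mu>)"

definition rounded :: "nat \<Rightarrow> nat \<Rightarrow> nat" where
  "rounded r l = l * nat \<lceil>real r / real l\<rceil>"

(* For r = 0 the subtraction is truncated to 0; the index range {1..0} is empty, as intended. *)
definition gap_indices :: "nat \<Rightarrow> nat \<Rightarrow> nat set" where
  "gap_indices r l = {1..rounded r l - 1}"

definition min_gap :: "(nat \<Rightarrow> real) \<Rightarrow> nat \<Rightarrow> nat \<Rightarrow> real" where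
  "min_gap lam r l = Min ((\<lambda>i. (lam i - lam (i + 1)) / lam 1) ` gap_indices r l)"

(* (r/l) log(1/Delta), with the conventions for an empty minimum and for Delta = 0. *)
definition gap_term :: "(nat \<Rightarrow> real) \<Rightarrow> nat \<Rightarrow> nat \<Rightarrow> ereal" where
  "gap_term lam r l =
     (if gap_indices r l = {} then 0
      else if min_gap lam r l = 0 then \<infinity>
      else ereal (real r / real l * ln (1 / min_gap lam r l)))"

(* The law of the array of entries of a d x l Gaussian matrix: independent standard normals. *)
definition gaussian_entries :: "nat \<Rightarrow> nat \<Rightarrow> (nat \<times> nat \<Rightarrow> real) measure" where
  "gaussian_entries d l =
     (\<Pi>\<^sub>M ij \<in> {..<d} \<times> {..<l}. density lborel (\<lambda>x. ennreal (std_normal_density x)))"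

definition starting_block :: "real vec \<Rightarrow> real mat \<Rightarrow> real mat" where
  "starting_block b \<Omega> = mat_of_cols (dim_vec b) (b # cols \<Omega>)"

end

(* Let V be the block Krylov space of Omega alone after s steps. Work in eigencoordinates of A, so that the shift only
   changes the weights lambda_i + mu. If every z orthogonal to V has ||z||^2 <= (9/4) (lambda_(r+1) + mu) z^T A_mu^(-1) z,
   then Nesterov's method on the problem deflated by V has condition number (9/4) kappa_(r+1)(mu), stays inside the block
   Krylov space of [b Omega], and its Lyapunov function gives the stated rate, uniformly in mu.

   The condition follows once z is small on the eigenvectors with lambda_i > 2 lambda_(r+1). Orthogonality to V says that
   the rows x_i^a g_i (a < n = ceiling (r/l), x_i = lambda_i/lambda_1, g_i the rows of the rotated Gaussian block),
   weighted by z_i x_i^m, sum to zero. Since (x_i/x_(r+1))^m >= 2^m, it suffices to bound the inverse of the random block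
   Vandermonde matrix by a power of (d/delta) Delta^(-n). Removing l rows at a time, the distance of a row to the span of
   the others is a standard Gaussian times a quantity controlled by the smaller matrix. Thresholding at every step
   would lose delta^(-n), so the recursion is run on the mean of a small power, with a single application of Markov's
   inequality at the end. *)

theory Submission
  imports Defs "Jordan_Normal_Form.Schur_Decomposition"
begin

section \<open>Deflated accelerated gradient descent in coordinates\<close>

text \<open>The deflated operator is a compression of A_\<mu>, not a polynomial in it, so a
  polynomial argument does not apply directly. An iteration does: the projections needed for
  deflation only add elements of V, which the block space already contains. The 3 in the rate: one
  step contracts the energy by \<open>1 - q\<close> with \<open>q = 2 / (3 * sqrt \<kappa>)\<close>,
  and the theorem bounds a norm, the square root of an energy. The 9/4 is 2 * 9/8: eigenvalues up to
  twice the reference one are left alone, which gives the powers of 2 something to act on, and 1/8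
  is the leakage tolerated from the deflated directions. In the recursion for the random matrix the
  same Gaussian row occurs in a numerator and in a denominator. A fourth root makes the recursion
  subadditive and leaves room to separate the two before taking means. The random event involves
  only the eigenvalues and the Gaussian entries, hence one event serves all shifts. Its probability
  makes sense only after the choice hidden in \<open>arg_min\<close> and the uncountable range of
  \<mu> are replaced by countably many conditions.\<close>

definition comb :: "('k \<Rightarrow> nat \<Rightarrow> real) \<Rightarrow> 'k set \<Rightarrow> (nat \<Rightarrow> real) set" where
  "comb F I = range (\<lambda>c i. \<Sum>k\<in>I. c k * F k i)"

lemma combI: "(\<lambda>i. \<Sum>k\<in>I. c k * F k i) \<in> comb F I"
  by (auto simp: comb_def)

lemma combE:
  assumes "f \<in> comb F I"
  obtains c where "f = (\<lambda>i. \<Sum>k\<in>I. c k * F k i)"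
  using assms by (auto simp: comb_def)

lemma comb_zero: "(\<lambda>i. 0) \<in> comb F I"
  using combI[of "\<lambda>_. 0" F I] by simp

lemma comb_lin:
  assumes "f \<in> comb F I" "g \<in> comb F I"
  shows "(\<lambda>i. a * f i + b * g i) \<in> comb F I"
proof -
  obtain c e where "f = (\<lambda>i. \<Sum>k\<in>I. c k * F k i)" "g = (\<lambda>i. \<Sum>k\<in>I. e k * F k i)"
    using assms by (auto simp: comb_def)
  then have eq: "(\<lambda>i. a * f i + b * g i) = (\<lambda>i. \<Sum>k\<in>I. (a * c k + b * e k) * F k i)"
    by (auto simp: sum_distrib_left sum.distrib algebra_simps)
  show ?thesis unfolding eq by (rule combI)
qed

lemma comb_add: "f \<in> comb F I \<Longrightarrow> g \<in> comb F I \<Longrightarrow> (\<lambda>i. f i + g i) \<in> comb F I"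
  using comb_lin[of f F I g 1 1] by simp

lemma comb_scale: "f \<in> comb F I \<Longrightarrow> (\<lambda>i. a * f i) \<in> comb F I"
  using comb_lin[of f F I f a 0] by simp

lemma comb_gen:
  assumes "finite I" "k \<in> I"
  shows "F k \<in> comb F I"
proof -
  have eq: "F k = (\<lambda>i. \<Sum>j\<in>I. (if j = k then 1 else 0) * F j i)"
  proof
    fix i
    have "(\<Sum>j\<in>I. (if j = k then 1 else 0) * F j i) = (\<Sum>j\<in>I. if j = k then F j i else 0)"
      by (rule sum.cong) auto
    also have "\<dots> = F k i" using assms by (simp add: sum.delta)
    finally show "F k i = (\<Sum>j\<in>I. (if j = k then 1 else 0) * F j i)" by simp
  qed
  show ?thesis by (subst eq) (rule combI)
qed

lemma comb_sum:
  assumes "finite J" "\<And>k. k \<in> J \<Longrightarrow> f k \<in> comb F I"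
  shows "(\<lambda>i. \<Sum>k\<in>J. c k * f k i) \<in> comb F I"
  using assms
proof (induction J rule: finite_induct)
  case empty
  then show ?case by (simp add: comb_zero)
next
  case (insert k J)
  then have "(\<lambda>i. c k * f k i) \<in> comb F I" "(\<lambda>i. \<Sum>k\<in>J. c k * f k i) \<in> comb F I"
    by (auto intro: comb_scale)
  from comb_add[OF this] insert show ?case by simp
qed

lemma comb_subset:
  assumes "finite I" "\<And>k. k \<in> I \<Longrightarrow> F k \<in> comb G J"
  shows "comb F I \<subseteq> comb G J"
proof
  fix f assume "f \<in> comb F I"
  then obtain c where f: "f = (\<lambda>i. \<Sum>k\<in>I. c k * F k i)" by (rule combE)
  show "f \<in> comb G J" unfolding f using assms by (rule comb_sum)
qed

lemma comb_mono:
  assumes "finite J" "I \<subseteq> J" shows "comb F I \<subseteq> comb F J"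
proof (rule comb_subset)
  show "finite I" using assms finite_subset by blast
  show "F k \<in> comb F J" if "k \<in> I" for k using comb_gen[of J k F] that assms by blast
qed

section \<open>Weighted inner products and projections\<close>

definition wip :: "nat \<Rightarrow> (nat \<Rightarrow> real) \<Rightarrow> (nat \<Rightarrow> real) \<Rightarrow> (nat \<Rightarrow> real) \<Rightarrow> real" where
  "wip d w f g = (\<Sum>i<d. w i * f i * g i)"

lemma wip_commute: "wip d w f g = wip d w g f"
  by (simp add: wip_def mult_ac)

lemma wip_lin_left: "wip d w (\<lambda>i. a * f i + b * g i) h = a * wip d w f h + b * wip d w g h"
  by (simp add: wip_def sum_distrib_left sum.distrib algebra_simps)

lemma wip_lin_right: "wip d w h (\<lambda>i. a * f i + b * g i) = a * wip d w h f + b * wip d w h g"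
  by (simp add: wip_def sum_distrib_left sum.distrib algebra_simps)

lemma wip_diff_left: "wip d w (\<lambda>i. f i - g i) h = wip d w f h - wip d w g h"
  using wip_lin_left[of d w 1 f "-1" g h] by simp

lemma wip_sum_right: "wip d w f (\<lambda>i. \<Sum>k\<in>I. c k * F k i) = (\<Sum>k\<in>I. c k * wip d w f (F k))"
  by (simp add: wip_def sum_distrib_left mult_ac) (subst sum.swap, simp)

lemma wip_sq_nonneg: "(\<And>i. i < d \<Longrightarrow> 0 < w i) \<Longrightarrow> 0 \<le> wip d w f f"
  unfolding wip_def mult.assoc
  by (intro sum_nonneg mult_nonneg_nonneg[OF less_imp_le zero_le_square]) auto

lemma wip_sq_zero:
  assumes "\<And>i. i < d \<Longrightarrow> 0 < w i" "wip d w f f = 0" "i < d"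
  shows "f i = 0"
proof -
  have "\<forall>i\<in>{..<d}. w i * f i * f i = 0"
    using assms(1,2) unfolding wip_def
    unfolding mult.assoc
    by (subst sum_nonneg_eq_0_iff[symmetric])
       (auto intro!: mult_nonneg_nonneg[OF less_imp_le zero_le_square])
  then have "w i * f i * f i = 0" using assms(3) by blast
  moreover have "w i \<noteq> 0" using assms(1,3) by fastforce
  ultimately show ?thesis by simp
qed

lemma wip_orth_comb:
  assumes "\<And>k. k \<in> I \<Longrightarrow> wip d w f (F k) = 0" "u \<in> comb F I"
  shows "wip d w f u = 0"
  using assms by (auto simp: comb_def wip_sum_right)

text \<open>Gram-Schmidt, one generator at a time: both \<open>x\<close> and the new generator are
  projected onto the old span, then \<open>x\<close> is corrected along the new direction. Dependent
  generators are allowed, since Krylov vectors may be dependent.\<close>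

lemma projection_exists:
  assumes "finite I" and w: "\<And>i. i < d \<Longrightarrow> 0 < w i"
  shows "\<exists>v \<in> comb F I. \<forall>u \<in> comb F I. wip d w (\<lambda>i. x i - v i) u = 0"
  using assms(1)
proof (induction I arbitrary: x rule: finite_induct)
  case empty
  show ?case by (intro bexI[OF _ comb_zero]) (auto simp: comb_def wip_def)
next
  case (insert k I)
  have sub: "comb F I \<subseteq> comb F (insert k I)"
    using insert by (intro comb_mono) auto
  obtain v where v: "v \<in> comb F I" "\<And>u. u \<in> comb F I \<Longrightarrow> wip d w (\<lambda>i. x i - v i) u = 0"
    using insert.IH[of x] by blast
  obtain p where p: "p \<in> comb F I" "\<And>u. u \<in> comb F I \<Longrightarrow> wip d w (\<lambda>i. F k i - p i) u = 0"
    using insert.IH[of "F k"] by blast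
  define f where "f = (\<lambda>i. F k i - p i)"
  have f_in: "f \<in> comb F (insert k I)"
    using comb_lin[of "F k" F "insert k I" p 1 "-1"] comb_gen[of "insert k I" k F] sub p(1) insert(1)
    by (auto simp: f_def)
  \<comment> \<open>A direction of norm zero vanishes on all coordinates below \<open>d\<close>,
    hence is orthogonal to everything, and the coefficient 0 will do.\<close>
  define a where "a = (if wip d w f f = 0 then 0 else wip d w (\<lambda>i. x i - v i) f / wip d w f f)"
  define v' where "v' = (\<lambda>i. 1 * v i + a * f i)"
  have v': "v' \<in> comb F (insert k I)"
    unfolding v'_def using comb_lin f_in sub v(1) by blast
  have e: "(\<lambda>i. x i - v' i) = (\<lambda>i. 1 * (x i - v i) + (-a) * f i)"
    by (auto simp: v'_def)
  have f0: "wip d w g f = 0" if "wip d w f f = 0" for g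
    using wip_sq_zero[OF w that] by (auto simp: wip_def intro!: sum.neutral)
  have of: "wip d w (\<lambda>i. x i - v' i) f = 0"
    unfolding e wip_lin_left using f0 by (auto simp: a_def)
  have oI: "wip d w (\<lambda>i. x i - v' i) u = 0" if "u \<in> comb F I" for u
    unfolding e wip_lin_left using v(2)[OF that] p(2)[OF that] by (simp add: f_def)
  have "wip d w (\<lambda>i. x i - v' i) (F k) = wip d w (\<lambda>i. x i - v' i) (\<lambda>i. 1 * f i + 1 * p i)"
    by (simp add: f_def)
  also have "\<dots> = 0" unfolding wip_lin_right using of oI[OF p(1)] by simp
  finally have "wip d w (\<lambda>i. x i - v' i) (F j) = 0" if "j \<in> insert k I" for j
    using that oI[OF comb_gen[of I j F]] insert(1) by auto
  then have "\<forall>u\<in>comb F (insert k I). wip d w (\<lambda>i. x i - v' i) u = 0"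
    using wip_orth_comb[of "insert k I" d w _ F] by blast
  then show ?case using v' by blast
qed

lemma projection_minimal:
  assumes w: "\<And>i. i < d \<Longrightarrow> 0 < w i"
    and "v \<in> comb F I" "\<And>u. u \<in> comb F I \<Longrightarrow> wip d w (\<lambda>i. x i - v i) u = 0" "y \<in> comb F I"
  shows "wip d w (\<lambda>i. x i - v i) (\<lambda>i. x i - v i) \<le> wip d w (\<lambda>i. x i - y i) (\<lambda>i. x i - y i)"
proof -
  define u where "u = (\<lambda>i. v i - y i)"
  have "u \<in> comb F I" using comb_lin[OF assms(2,4), of 1 "-1"] by (simp add: u_def)
  then have o: "wip d w (\<lambda>i. x i - v i) u = 0" by (rule assms(3))
  have "(\<lambda>i. x i - y i) = (\<lambda>i. 1 * (x i - v i) + 1 * u i)" by (auto simp: u_def)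
  then have "wip d w (\<lambda>i. x i - y i) (\<lambda>i. x i - y i) =
      wip d w (\<lambda>i. 1 * (x i - v i) + 1 * u i) (\<lambda>i. 1 * (x i - v i) + 1 * u i)"
    by simp
  also have "\<dots> = wip d w (\<lambda>i. x i - v i) (\<lambda>i. x i - v i) + wip d w u u"
    unfolding wip_lin_left wip_lin_right using o wip_commute[of d w u "\<lambda>i. x i - v i"] by simp
  finally show ?thesis using wip_sq_nonneg[of d w u, OF w] by simp
qed

text \<open>One step of Nesterov's accelerated gradient method, with the inner products as numbers:
  \<open>Y\<close>, \<open>VY\<close>, \<open>VV\<close> are energies, \<open>yy\<close>, \<open>vy\<close>, \<open>vv\<close> Euclidean products, \<open>gg\<close> is the squared
  gradient norm, and \<open>E\<close> is the energy after the gradient step.\<close>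

lemma nesterov_step_arith:
  fixes q m L :: real
  assumes q: "0 \<le> q" "q \<le> 1" and m: "0 < m" and L: "0 < L" "q\<^sup>2 * L = m"
    and sc: "m * yy \<le> Y" and cauchy: "0 \<le> VV - 2 * VY + Y" and sq: "0 \<le> vv - 2 * vy + yy"
    and hh: "hh \<le> L * gg"
    and x: "X = (1 + q)\<^sup>2 * Y - 2 * q * (1 + q) * VY + q\<^sup>2 * VV"
    and E: "E = Y - 2 / L * gg + hh / L\<^sup>2"
    and V': "V' = (1 - q)\<^sup>2 * vv + 2 * q * (1 - q) * vy + q\<^sup>2 * yy
               - 2 * (q / m) * ((1 - q) * VY + q * Y) + (q / m)\<^sup>2 * gg"
  shows "E + m * V' \<le> (1 - q) * (X + m * vv)"
proof -
  have "hh / L\<^sup>2 \<le> L * gg / L\<^sup>2" using hh by (rule divide_right_mono) simp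
  also have "\<dots> = gg / L" using L(1) by (simp add: power2_eq_square)
  finally have "hh / L\<^sup>2 \<le> gg / L" .
  then have E': "E \<le> Y - gg / L" unfolding E using times_divide_eq_left[of 2 L gg] by linarith
  \<comment> \<open>The two step lengths, \<open>1 / L\<close> for the gradient step and
    \<open>q / m\<close> for the second point, are matched through \<open>q\<^sup>2 * L = m\<close>:
    the squared gradients in \<open>E\<close> and in \<open>m * V'\<close> cancel.\<close>
  have "m * (q / m)\<^sup>2 = q\<^sup>2 / m" using m by (simp add: power2_eq_square)
  also have "\<dots> = q\<^sup>2 / (q\<^sup>2 * L)" using L(2) by simp
  also have "\<dots> = 1 / L" using L m by (intro nonzero_divide_mult_cancel_left) auto
  finally have q2: "m * (q / m)\<^sup>2 = 1 / L" .
  have "m * V' = m * ((1 - q)\<^sup>2 * vv + 2 * q * (1 - q) * vy + q\<^sup>2 * yy)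
      - 2 * q * ((1 - q) * VY + q * Y) + gg / L"
  proof -
    define c where "c = q / m"
    have "m * V' = m * ((1 - q)\<^sup>2 * vv + 2 * q * (1 - q) * vy + q\<^sup>2 * yy)
      - 2 * (m * c) * ((1 - q) * VY + q * Y) + m * c\<^sup>2 * gg"
      unfolding V' c_def[symmetric] by (simp add: algebra_simps)
    moreover have "m * c = q" using m by (simp add: c_def)
    moreover have "m * c\<^sup>2 * gg = gg / L" using q2 by (simp add: c_def)
    ultimately show ?thesis by metis
  qed
  also have "m * ((1 - q)\<^sup>2 * vv + 2 * q * (1 - q) * vy + q\<^sup>2 * yy)
     = (1 - q) * (m * vv) + q * (m * yy) - q * (1 - q) * m * (vv - 2 * vy + yy)"
    by (simp add: algebra_simps power2_eq_square)
  finally have "E + m * V' \<le> Y + (1 - q) * (m * vv) + q * (m * yy)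
      - q * (1 - q) * m * (vv - 2 * vy + yy) - 2 * q * ((1 - q) * VY + q * Y)"
    using E' by linarith
  moreover have "q * (m * yy) \<le> q * Y" using mult_left_mono[OF sc q(1)] .
  moreover have "0 \<le> q * (1 - q) * m * (vv - 2 * vy + yy)" using q m sq by simp
  moreover have "0 \<le> q\<^sup>2 * (1 - q) * (VV - 2 * VY + Y)" using q cauchy by simp
  \<comment> \<open>The square \<open>VV - 2 * VY + Y\<close> is added with weight
    \<open>q\<^sup>2 * (1 - q)\<close> because this completes the right-hand side to an exact
    multiple of the old Lyapunov value.\<close>
  moreover have "Y + (1 - q) * (m * vv) + q * Y - 2 * q * ((1 - q) * VY + q * Y)
      + q\<^sup>2 * (1 - q) * (VV - 2 * VY + Y) = (1 - q) * (X + m * vv)"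
    unfolding x by (simp add: algebra_simps power2_eq_square)
  ultimately show ?thesis by linarith
qed


text \<open>Deflated accelerated gradient descent: errors \<open>e\<close> whose residual \<open>w e\<close> is orthogonal to \<open>V\<close> are
  paired with their Euclidean projections \<open>a\<close> onto the orthogonal complement of \<open>V\<close>. On that complement
  the map from \<open>a\<close> to the residual is self-adjoint with spectrum in \<open>[m, L]\<close>.\<close>

lemma deflated_nesterov:
  fixes w \<beta> :: "nat \<Rightarrow> real" and F :: "'k \<Rightarrow> nat \<Rightarrow> real" and K :: "nat \<Rightarrow> (nat \<Rightarrow> real) set"
  assumes I: "finite I" and m: "0 < m" and mw: "\<And>i. i < d \<Longrightarrow> m \<le> w i"
    and L: "0 < L" "q\<^sup>2 * L = m" and q: "0 \<le> q" "q \<le> 1"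
    and smooth: "\<And>z. (\<And>u. u \<in> comb F I \<Longrightarrow> (\<Sum>i<d. z i * u i) = 0) \<Longrightarrow>
        (\<Sum>i<d. (z i)\<^sup>2) \<le> L * (\<Sum>i<d. (z i)\<^sup>2 / w i)"
    and K_lin: "\<And>n f g a b. f \<in> K n \<Longrightarrow> g \<in> K n \<Longrightarrow> (\<lambda>i. a * f i + b * g i) \<in> K n"
    and K_mono: "\<And>n. K n \<subseteq> K (Suc n)" and VK: "comb F I \<subseteq> K 0"
    and K_res: "\<And>n f. f \<in> K n \<Longrightarrow> (\<lambda>i. w i * f i - \<beta> i) \<in> K (Suc n)"
  defines "xs \<equiv> (\<lambda>i. \<beta> i / w i)"
  shows "\<exists>X \<in> K n. wip d w (\<lambda>i. X i - xs i) (\<lambda>i. X i - xs i) \<le> 2 * (1 - q) ^ n * wip d w xs xs"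
proof -
  define V where "V = comb F I"
  have w: "0 < w i" if "i < d" for i using m mw[OF that] by simp
  let ?E = "wip d w" and ?D = "wip d (\<lambda>i. 1)"
  define R where "R e a \<longleftrightarrow> (\<lambda>i. e i - a i) \<in> V \<and> (\<forall>u\<in>V. ?E e u = 0) \<and> (\<forall>u\<in>V. ?D a u = 0)" for e a
  have R_lin: "R (\<lambda>i. s * e i + t * e' i) (\<lambda>i. s * a i + t * a' i)" if "R e a" "R e' a'" for s t e a e' a'
  proof -
    have "(\<lambda>i. s * (e i - a i) + t * (e' i - a' i)) \<in> V"
      using that unfolding R_def V_def by (intro comb_lin) auto
    moreover have "(\<lambda>i. s * (e i - a i) + t * (e' i - a' i)) = (\<lambda>i. (s * e i + t * e' i) - (s * a i + t * a' i))"
      by (auto simp: algebra_simps)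
    ultimately show ?thesis using that by (simp add: R_def wip_lin_left)
  qed
  have Res: "?E e e' = ?D (\<lambda>i. w i * e i) a'" if "R e a" "R e' a'" for e a e' a'
  proof -
    have "?E e (\<lambda>i. e' i - a' i) = 0" using that by (auto simp: R_def)
    then have "?E e e' = ?E e a'"
      using wip_lin_right[of d w e 1 e' "-1" a'] by simp
    then show ?thesis by (simp add: wip_def)
  qed
  have Eu: "?E e u = ?D (\<lambda>i. w i * e i) u" for e u by (simp add: wip_def)
  have strong: "m * ?D a a \<le> ?E e e" if "R e a" for e a
  proof -
    define u where "u = (\<lambda>i. e i - a i)"
    have "?D a u = 0" using that by (auto simp: R_def u_def)
    moreover have "e = (\<lambda>i. 1 * a i + 1 * u i)" by (auto simp: u_def)
    then have "?D e e = ?D (\<lambda>i. 1 * a i + 1 * u i) (\<lambda>i. 1 * a i + 1 * u i)" by simp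
    ultimately have "?D e e = ?D a a + ?D u u"
      unfolding wip_lin_left wip_lin_right using wip_commute[of d "\<lambda>i. 1" a u] by simp
    then have "?D a a \<le> ?D e e" using wip_sq_nonneg[of d "\<lambda>i. 1" u] by simp
    then have "m * ?D a a \<le> m * ?D e e" using m by simp
    also have "\<dots> \<le> ?E e e"
      unfolding wip_def sum_distrib_left using mw by (intro sum_mono) (auto intro: mult_right_mono simp: mult.assoc)
    finally show ?thesis .
  qed
  \<comment> \<open>For the residual \<open>z\<close> of \<open>e\<close>, the hypothesis
    \<open>smooth\<close> reads \<open>?D z z \<le> L * ?D z a\<close>, which is cocoercivity.
    Combined with the nonnegative square of \<open>z - L a\<close> it bounds the energy by
    \<open>L * ?D a a\<close>.\<close>
  have smoothR: "?E e e \<le> L * ?D a a" if "R e a" for e a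
  proof -
    define z where "z = (\<lambda>i. w i * e i)"
    have "(\<Sum>i<d. (z i)\<^sup>2) \<le> L * (\<Sum>i<d. (z i)\<^sup>2 / w i)"
      using that by (intro smooth) (auto simp: R_def V_def wip_def z_def)
    also have "(\<Sum>i<d. (z i)\<^sup>2 / w i) = ?E e e"
      using w by (auto simp: wip_def z_def power2_eq_square intro!: sum.cong)
    finally have zz: "?D z z \<le> L * ?E e e" by (simp add: wip_def power2_eq_square)
    have "?E e e = ?D z a" using Res[OF that that] by (simp add: z_def)
    then have "?D z z \<le> L * ?D z a" using zz by simp
    moreover have "0 \<le> ?D (\<lambda>i. 1 * z i + (-L) * a i) (\<lambda>i. 1 * z i + (-L) * a i)"
      by (rule wip_sq_nonneg) simp
    then have "0 \<le> ?D z z - 2 * L * ?D z a + L * (L * ?D a a)"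
      unfolding wip_lin_left wip_lin_right using wip_commute[of d "\<lambda>i. 1" z a] by (simp add: algebra_simps)
    ultimately have "L * ?D z a \<le> L * (L * ?D a a)" by linarith
    then show ?thesis using L(1) \<open>?E e e = ?D z a\<close> by simp
  qed
  define st where "st n X Y a b \<longleftrightarrow> X \<in> K n \<and> Y \<in> K n \<and> R (\<lambda>i. X i - xs i) a \<and> R (\<lambda>i. Y i - xs i) b"
    for n X Y and a b :: "nat \<Rightarrow> real"
  define lyap where "lyap X b = ?E (\<lambda>i. X i - xs i) (\<lambda>i. X i - xs i) + m * ?D b b"
    for X b :: "nat \<Rightarrow> real"
  have "\<exists>X Y a b. st n X Y a b \<and> lyap X b \<le> 2 * (1 - q) ^ n * ?E xs xs" for n
  proof (induction n)
    case 0
    \<comment> \<open>The start is the energy projection of the solution onto V, so the residual is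
      orthogonal to V. The factor 2 of the invariant originates here: the energy of the error and
      \<open>m\<close> times the squared norm of its partner are each at most the energy of the
      solution.\<close>
    obtain X where X: "X \<in> V" "\<And>u. u \<in> V \<Longrightarrow> ?E (\<lambda>i. xs i - X i) u = 0"
      using projection_exists[of I d w F xs] I w unfolding V_def by blast
    define e where "e = (\<lambda>i. X i - xs i)"
    have eo: "?E e u = 0" if "u \<in> V" for u
      using X(2)[OF that] by (simp add: e_def wip_diff_left)
    obtain v where v: "v \<in> V" "\<And>u. u \<in> V \<Longrightarrow> ?D (\<lambda>i. e i - v i) u = 0"
      using projection_exists[of I d "\<lambda>i. 1" F e] I unfolding V_def by auto
    have r: "R e (\<lambda>i. e i - v i)" using eo v by (auto simp: R_def)
    have "?E (\<lambda>i. xs i - X i) (\<lambda>i. xs i - X i) \<le> ?E (\<lambda>i. xs i - (\<lambda>i. 0) i) (\<lambda>i. xs i - (\<lambda>i. 0) i)"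
      using X comb_zero[of F I] unfolding V_def by (intro projection_minimal[of d w X F I xs] w) auto
    then have "?E e e \<le> ?E xs xs" by (simp add: e_def wip_def algebra_simps)
    moreover have "m * ?D (\<lambda>i. e i - v i) (\<lambda>i. e i - v i) \<le> ?E e e" by (rule strong[OF r])
    ultimately have "lyap X (\<lambda>i. e i - v i) \<le> 2 * ?E xs xs" by (simp add: lyap_def e_def)
    moreover have "st 0 X X (\<lambda>i. e i - v i) (\<lambda>i. e i - v i)"
      using r X(1) VK unfolding st_def e_def[symmetric] V_def by auto
    ultimately show ?case by (metis mult_1_right power_0)
  next
    case (Suc n)
    then obtain X Y a b where s: "st n X Y a b" and ly: "lyap X b \<le> 2 * (1 - q) ^ n * ?E xs xs" by blast
    define p r where "p = 1 / (1 + q)" and "r = q / (1 + q)"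
    have pr: "p + r = 1" "p * (1 + q) = 1" "r = q * p" using q by (auto simp: p_def r_def field_simps)
    define Z where "Z = (\<lambda>i. p * X i + r * Y i)"
    define ex ev ez az where "ex = (\<lambda>i. X i - xs i)" and "ev = (\<lambda>i. Y i - xs i)"
      and "ez = (\<lambda>i. p * ex i + r * ev i)" and "az = (\<lambda>i. p * a i + r * b i)"
    have Zez: "Z i - xs i = ez i" for i
      using arg_cong[OF pr(1), of "\<lambda>c. c * xs i"] by (simp add: Z_def ez_def ex_def ev_def algebra_simps)
    have Rx: "R ex a" and Rv: "R ev b" and KX: "X \<in> K n" and KY: "Y \<in> K n"
      using s by (auto simp: st_def ex_def ev_def)
    have Rz: "R ez az" unfolding ez_def az_def by (rule R_lin[OF Rx Rv])
    have KZ: "Z \<in> K n" unfolding Z_def by (rule K_lin[OF KX KY])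
    define g where "g = (\<lambda>i. w i * Z i - \<beta> i)"
    have g: "g i = w i * ez i" if "i < d" for i
      using w[OF that] Zez[of i] by (simp add: g_def xs_def field_simps)
    have Dg: "?D g u = ?E ez u" for u using g by (auto simp: wip_def)
    \<comment> \<open>Removing the energy projection of the gradient onto V gives an error
      \<open>eh\<close> whose partner is the gradient itself. On partners the update is therefore
      plain gradient descent, while the iterate moves by the gradient and an element of V.\<close>
    obtain v where v: "v \<in> V" "\<And>u. u \<in> V \<Longrightarrow> ?E (\<lambda>i. g i - v i) u = 0"
      using projection_exists[of I d w F g] I w unfolding V_def by blast
    define eh where "eh = (\<lambda>i. g i - v i)"
    have Rh: "R eh g"
    proof -
      have "(\<lambda>i. (-1) * v i) \<in> V" using v(1) unfolding V_def by (rule comb_scale)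
      then show ?thesis using v Rz Dg by (auto simp: R_def eh_def)
    qed
    have Kg: "g \<in> K (Suc n)" unfolding g_def by (rule K_res[OF KZ])
    have VKn: "V \<subseteq> K k" for k using VK K_mono by (induction k) (auto simp: V_def)
    have Keh: "eh \<in> K (Suc n)"
      using K_lin[OF Kg, of v 1 "-1"] v(1) VKn by (auto simp: eh_def)
    have inK: "X \<in> K (Suc n)" "Y \<in> K (Suc n)" "Z \<in> K (Suc n)" using KX KY KZ K_mono by auto
    define X' where "X' = (\<lambda>i. 1 * Z i + (- 1 / L) * eh i)"
    define Y0 where "Y0 = (\<lambda>i. (1 - q) * Y i + q * Z i)"
    define Y' where "Y' = (\<lambda>i. 1 * Y0 i + (- (q / m)) * eh i)"
    define b0 where "b0 = (\<lambda>i. (1 - q) * b i + q * az i)"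
    define a' where "a' = (\<lambda>i. 1 * az i + (- 1 / L) * g i)"
    define b' where "b' = (\<lambda>i. 1 * b0 i + (- (q / m)) * g i)"
    have X'e: "(\<lambda>i. X' i - xs i) = (\<lambda>i. 1 * ez i + (- 1 / L) * eh i)"
      by (auto simp: X'_def Zez[symmetric])
    have Y'e: "(\<lambda>i. Y' i - xs i) = (\<lambda>i. 1 * ((1 - q) * ev i + q * ez i) + (- (q / m)) * eh i)"
      by (auto simp: Y'_def Y0_def Zez[symmetric] ev_def algebra_simps)
    have RX': "R (\<lambda>i. X' i - xs i) a'" unfolding X'e a'_def by (rule R_lin[OF Rz Rh])
    have RY': "R (\<lambda>i. Y' i - xs i) b'" unfolding Y'e b'_def b0_def
      by (rule R_lin[OF R_lin[OF Rv Rz] Rh])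
    have "X' \<in> K (Suc n)" unfolding X'_def by (rule K_lin[OF inK(3) Keh])
    moreover have "Y' \<in> K (Suc n)" unfolding Y'_def Y0_def
      by (rule K_lin[OF K_lin[OF inK(2,3)] Keh])
    ultimately have st': "st (Suc n) X' Y' a' b'" using RX' RY' by (simp add: st_def)
    have ezh: "?E ez eh = ?D g g"
      using Res[OF Rz Rh] Dg g by (simp add: wip_def)
    have evg: "?D b g = ?E ev ez"
      using Res[OF Rz Rv] g wip_commute[of d w ev ez] wip_commute[of d "\<lambda>i. 1" b g] by (simp add: wip_def)
    have ezg: "?D az g = ?E ez ez"
      using Res[OF Rz Rz] g wip_commute[of d "\<lambda>i. 1" az g] by (simp add: wip_def)
    have exE: "ex = (\<lambda>i. (1 + q) * ez i + (- q) * ev i)"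
    proof
      fix i
      have "(1 + q) * ez i = (p * (1 + q)) * ex i + (r * (1 + q)) * ev i" by (simp add: ez_def algebra_simps)
      moreover have "r * (1 + q) = q" using pr(2,3) by (simp add: mult.assoc)
      ultimately show "ex i = (1 + q) * ez i + (- q) * ev i" using pr(2) by simp
    qed
    have "lyap X' b' \<le> (1 - q) * (?E ex ex + m * ?D b b)"
      unfolding lyap_def
    proof (rule nesterov_step_arith[OF q m L, where yy = "?D az az" and Y = "?E ez ez"
          and VV = "?E ev ev" and VY = "?E ev ez" and vv = "?D b b" and vy = "?D b az" and hh = "?E eh eh" and gg = "?D g g"])
      show "m * ?D az az \<le> ?E ez ez" by (rule strong[OF Rz])
      have "0 \<le> ?E (\<lambda>i. 1 * ev i + (-1) * ez i) (\<lambda>i. 1 * ev i + (-1) * ez i)" by (rule wip_sq_nonneg[OF w])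
      then show "0 \<le> ?E ev ev - 2 * ?E ev ez + ?E ez ez"
        unfolding wip_lin_left wip_lin_right using wip_commute[of d w ev ez] by simp
      have "0 \<le> ?D (\<lambda>i. 1 * b i + (-1) * az i) (\<lambda>i. 1 * b i + (-1) * az i)" by (rule wip_sq_nonneg) simp
      then show "0 \<le> ?D b b - 2 * ?D b az + ?D az az"
        unfolding wip_lin_left wip_lin_right using wip_commute[of d "\<lambda>i. 1" b az] by simp
      show "?E eh eh \<le> L * ?D g g" by (rule smoothR[OF Rh])
      have "?E ex ex = ?E (\<lambda>i. (1 + q) * ez i + (- q) * ev i) (\<lambda>i. (1 + q) * ez i + (- q) * ev i)"
        using exE by simp
      also have "\<dots> = (1 + q)\<^sup>2 * ?E ez ez - 2 * q * (1 + q) * ?E ev ez + q\<^sup>2 * ?E ev ev"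
        unfolding wip_lin_left wip_lin_right wip_commute[of d w ez ev] by (simp add: algebra_simps power2_eq_square)
      finally show "?E ex ex = (1 + q)\<^sup>2 * ?E ez ez - 2 * q * (1 + q) * ?E ev ez + q\<^sup>2 * ?E ev ev" .
      show "?E (\<lambda>i. X' i - xs i) (\<lambda>i. X' i - xs i) = ?E ez ez - 2 / L * ?D g g + ?E eh eh / L\<^sup>2"
        unfolding X'e wip_lin_left wip_lin_right wip_commute[of d w eh ez] ezh
        by (simp add: power2_eq_square diff_divide_distrib right_diff_distrib)
      have "?D b0 g = (1 - q) * ?E ev ez + q * ?E ez ez"
        unfolding b0_def wip_lin_left evg ezg by simp
      moreover have "?D b0 b0 = (1 - q)\<^sup>2 * ?D b b + 2 * q * (1 - q) * ?D b az + q\<^sup>2 * ?D az az"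
        unfolding b0_def wip_lin_left wip_lin_right wip_commute[of d "\<lambda>i. 1" az b]
        by (simp add: algebra_simps power2_eq_square)
      moreover have "?D b' b' = ?D b0 b0 - 2 * (q / m) * ?D b0 g + (q / m)\<^sup>2 * ?D g g"
        unfolding b'_def wip_lin_left wip_lin_right wip_commute[of d "\<lambda>i. 1" g b0]
        by (simp add: power2_eq_square diff_divide_distrib right_diff_distrib)
      ultimately show "?D b' b' = (1 - q)\<^sup>2 * ?D b b + 2 * q * (1 - q) * ?D b az + q\<^sup>2 * ?D az az
               - 2 * (q / m) * ((1 - q) * ?E ev ez + q * ?E ez ez) + (q / m)\<^sup>2 * ?D g g" by simp
    qed
    also have "\<dots> \<le> (1 - q) * (2 * (1 - q) ^ n * ?E xs xs)"
      using ly q by (intro mult_left_mono) (auto simp: lyap_def ex_def)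
    finally show ?case using st' by (intro exI conjI) (auto simp: mult_ac)
  qed
  then obtain X Y a b where "st n X Y a b" "lyap X b \<le> 2 * (1 - q) ^ n * ?E xs xs" by blast
  moreover have "0 \<le> m * ?D b b" using m wip_sq_nonneg[of d "\<lambda>i. 1" b] by simp
  ultimately show ?thesis by (intro bexI[of _ X]) (auto simp: st_def lyap_def)
qed

section \<open>Krylov generators in eigencoordinates, where \<open>A\<close> multiplies coordinate
  \<open>i\<close> by \<open>x i\<close>\<close>

definition kgen :: "(nat \<Rightarrow> real) \<Rightarrow> (nat \<Rightarrow> nat \<Rightarrow> real) \<Rightarrow> nat \<times> nat \<Rightarrow> nat \<Rightarrow> real" where
  "kgen x B k i = x i ^ snd k * B (fst k) i"

definition block_cols :: "(nat \<Rightarrow> real) \<Rightarrow> (nat \<times> nat \<Rightarrow> real) \<Rightarrow> nat \<Rightarrow> nat \<Rightarrow> real" where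
  "block_cols \<beta> g j i = (case j of 0 \<Rightarrow> \<beta> i | Suc j' \<Rightarrow> g (i, j'))"

lemma block_cols_simps [simp]: "block_cols \<beta> g 0 = \<beta>" "block_cols \<beta> g (Suc j) = (\<lambda>i. g (i, j))"
  by (auto simp: block_cols_def)

lemma comb_kgen_shift:
  assumes "finite I" "f \<in> comb (kgen x B) I"
    and "\<And>j a. (j, a) \<in> I \<Longrightarrow> (j, Suc a) \<in> J" "finite J"
  shows "(\<lambda>i. x i * f i) \<in> comb (kgen x B) J"
proof -
  obtain c where f: "f = (\<lambda>i. \<Sum>k\<in>I. c k * kgen x B k i)" using assms(2) by (rule combE)
  have "(\<lambda>i. x i * f i) = (\<lambda>i. \<Sum>k\<in>I. c k * (x i * kgen x B k i))"
    by (auto simp: f sum_distrib_left mult_ac)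
  moreover have "(\<lambda>i. \<Sum>k\<in>I. c k * (x i * kgen x B k i)) \<in> comb (kgen x B) J"
  proof (rule comb_sum[OF assms(1)])
    fix k assume k: "k \<in> I"
    have "(\<lambda>i. x i * kgen x B k i) = kgen x B (fst k, Suc (snd k))"
      by (auto simp: kgen_def)
    then show "(\<lambda>i. x i * kgen x B k i) \<in> comb (kgen x B) J"
      using comb_gen[of J "(fst k, Suc (snd k))" "kgen x B"] assms(3)[of "fst k" "snd k"] assms(4) k by simp
  qed
  ultimately show ?thesis by simp
qed

text \<open>The first \<open>s\<close> block steps are spent on V, the other \<open>t - s\<close> on
  accelerated steps, each of which multiplies by A_\<mu> once. With \<open>L = 9 / 4 * w r\<close>
  the contraction parameter is 2/3 of the inverse root of the condition number; it contracts the
  square of the norm, which halves it in the exponent.\<close>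

lemma deflated_krylov_error:
  fixes lm \<beta> :: "nat \<Rightarrow> real" and g :: "nat \<times> nat \<Rightarrow> real"
  assumes pos: "\<And>i. i < d \<Longrightarrow> 0 < lm i" and dec: "\<And>i j. i \<le> j \<Longrightarrow> j < d \<Longrightarrow> lm j \<le> lm i"
    and r: "r < d" and \<mu>: "0 \<le> \<mu>" and st: "s \<le> t"
    and smooth: "\<And>z. (\<And>j a. j < l \<Longrightarrow> a < s \<Longrightarrow> (\<Sum>i<d. z i * (lm i ^ a * g (i, j))) = 0) \<Longrightarrow>
        (\<Sum>i<d. (z i)\<^sup>2) \<le> 9 / 4 * (lm r + \<mu>) * (\<Sum>i<d. (z i)\<^sup>2 / (lm i + \<mu>))"
  shows "\<exists>x \<in> comb (kgen lm (block_cols \<beta> g)) ({..l} \<times> {..<t}).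
     (\<Sum>i<d. (lm i + \<mu>) * (x i - \<beta> i / (lm i + \<mu>))\<^sup>2)
     \<le> (2 * exp (- (real (t - s) / (3 * sqrt ((lm r + \<mu>) / (lm (d - 1) + \<mu>))))))\<^sup>2
        * (\<Sum>i<d. (\<beta> i)\<^sup>2 / (lm i + \<mu>))"
proof -
  define B where "B = block_cols \<beta> g"
  define w where "w i = lm i + \<mu>" for i
  define I where "I = {1..l} \<times> {..<s}"
  \<comment> \<open>Column 0 holds \<open>b\<close> and starts without any power, because V is built
    from the random columns alone; these start with \<open>s\<close> powers. After
    \<open>t - s\<close> steps every column stays below \<open>t\<close> powers.\<close>
  define K where "K n = comb (kgen lm B) ({0} \<times> {..<n} \<union> {1..l} \<times> {..<s + n})" for n
  define m L where "m = w (d - 1)" and "L = 9 / 4 * w r"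
  define q where "q = sqrt (m / L)"
  have w0: "0 < w i" if "i < d" for i using pos[OF that] \<mu> by (simp add: w_def)
  have m: "0 < m" and L: "0 < L" using w0[of "d - 1"] w0[OF r] r by (auto simp: m_def L_def)
  have mr: "m \<le> w r" using dec[of r "d - 1"] r by (simp add: m_def w_def)
  have q2: "q\<^sup>2 * L = m" using m L by (simp add: q_def)
  have "m / L \<le> 1" using mr m L by (simp add: L_def field_simps)
  then have q: "0 \<le> q" "q \<le> 1" using m L by (auto simp: q_def)
  have "\<exists>X\<in>K (t - s). wip d w (\<lambda>i. X i - \<beta> i / w i) (\<lambda>i. X i - \<beta> i / w i)
      \<le> 2 * (1 - q) ^ (t - s) * wip d w (\<lambda>i. \<beta> i / w i) (\<lambda>i. \<beta> i / w i)"
  proof (rule deflated_nesterov[where F = "kgen lm B" and I = I and m = m and L = L, OF _ m _ L q2 q])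
    show "finite I" by (simp add: I_def)
    show "m \<le> w i" if "i < d" for i using dec[of i "d - 1"] that by (simp add: m_def w_def)
    show "(\<Sum>i<d. (z i)\<^sup>2) \<le> L * (\<Sum>i<d. (z i)\<^sup>2 / w i)"
      if z: "\<And>u. u \<in> comb (kgen lm B) I \<Longrightarrow> (\<Sum>i<d. z i * u i) = 0" for z
    proof -
      have "(\<Sum>i<d. z i * (lm i ^ a * g (i, j))) = 0" if "j < l" "a < s" for j a
        using z[OF comb_gen[of I "(Suc j, a)" "kgen lm B"]] that
        by (auto simp: kgen_def B_def I_def)
      from smooth[OF this] show ?thesis by (simp add: L_def w_def)
    qed
    show "(\<lambda>i. a * f i + b * h i) \<in> K n" if "f \<in> K n" "h \<in> K n" for n f h a b
      using that unfolding K_def by (rule comb_lin)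
    show "K n \<subseteq> K (Suc n)" for n unfolding K_def by (rule comb_mono) auto
    show "comb (kgen lm B) I \<subseteq> K 0" unfolding K_def I_def by (rule comb_mono) auto
    show "(\<lambda>i. w i * f i - \<beta> i) \<in> K (Suc n)" if f: "f \<in> K n" for n f
    proof -
      have 1: "(\<lambda>i. lm i * f i) \<in> K (Suc n)"
        using f unfolding K_def by (rule comb_kgen_shift[rotated]) auto
      have "K n \<subseteq> K (Suc n)" unfolding K_def by (rule comb_mono) auto
      then have 2: "f \<in> K (Suc n)" using f by blast
      have "kgen lm B (0, 0) \<in> K (Suc n)" unfolding K_def by (rule comb_gen) auto
      moreover have "kgen lm B (0, 0) = \<beta>" by (auto simp: kgen_def B_def)
      ultimately have 3: "\<beta> \<in> K (Suc n)" by simp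
      have "(\<lambda>i. 1 * (1 * (lm i * f i) + \<mu> * f i) + (-1) * \<beta> i) \<in> K (Suc n)"
        using 1 2 3 unfolding K_def by (intro comb_lin)
      then show ?thesis by (simp add: w_def algebra_simps)
    qed
  qed
  then obtain X where X: "X \<in> K (t - s)" and le: "wip d w (\<lambda>i. X i - \<beta> i / w i) (\<lambda>i. X i - \<beta> i / w i)
      \<le> 2 * (1 - q) ^ (t - s) * wip d w (\<lambda>i. \<beta> i / w i) (\<lambda>i. \<beta> i / w i)" by blast
  have "K (t - s) \<subseteq> comb (kgen lm B) ({..l} \<times> {..<t})"
    unfolding K_def using st by (intro comb_mono) auto
  then have XK: "X \<in> comb (kgen lm B) ({..l} \<times> {..<t})" using X by blast
  have xs: "wip d w (\<lambda>i. \<beta> i / w i) (\<lambda>i. \<beta> i / w i) = (\<Sum>i<d. (\<beta> i)\<^sup>2 / w i)"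
    unfolding wip_def by (rule sum.cong) (use w0 in \<open>auto simp: power2_eq_square\<close>)
  have Nn: "0 \<le> (\<Sum>i<d. (\<beta> i)\<^sup>2 / w i)" by (intro sum_nonneg divide_nonneg_nonneg) (use w0 less_imp_le in auto)
  have "q = 2 / 3 * sqrt (m / w r)"
  proof -
    have "m / L = (2 / 3)\<^sup>2 * (m / w r)" by (simp add: L_def power2_eq_square)
    then have "q = sqrt ((2 / 3)\<^sup>2) * sqrt (m / w r)" by (simp only: q_def real_sqrt_mult)
    then show ?thesis by simp
  qed
  also have "sqrt (m / w r) = 1 / sqrt (w r / m)" by (simp add: real_sqrt_divide)
  finally have qk: "q = 2 * (1 / (3 * sqrt (w r / m)))" by simp
  have "(1 - q) ^ (t - s) \<le> exp (- q) ^ (t - s)"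
    using q exp_ge_add_one_self[of "- q"] by (intro power_mono) auto
  also have "\<dots> = (exp (- (real (t - s) / (3 * sqrt (w r / m)))))\<^sup>2"
    by (simp add: qk exp_of_nat_mult[symmetric] exp_double[symmetric] mult_ac)
  finally have e: "(1 - q) ^ (t - s) \<le> (exp (- (real (t - s) / (3 * sqrt (w r / m)))))\<^sup>2" .
  \<comment> \<open>The factor 2 of the rate becomes 4 when squared, which covers the 2 of the
    Lyapunov bound.\<close>
  have "2 * (1 - q) ^ (t - s) \<le> (2 * exp (- (real (t - s) / (3 * sqrt (w r / m)))))\<^sup>2"
  proof -
    define h where "h = exp (- (real (t - s) / (3 * sqrt (w r / m))))"
    have "(2 * h)\<^sup>2 = 4 * h\<^sup>2" by simp
    moreover have "0 \<le> h\<^sup>2" by simp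
    ultimately show ?thesis using e unfolding h_def[symmetric] by linarith
  qed
  from mult_right_mono[OF this Nn] le
  have "wip d w (\<lambda>i. X i - \<beta> i / w i) (\<lambda>i. X i - \<beta> i / w i)
      \<le> (2 * exp (- (real (t - s) / (3 * sqrt (w r / m)))))\<^sup>2 * (\<Sum>i<d. (\<beta> i)\<^sup>2 / w i)"
    unfolding xs by linarith
  then show ?thesis using XK
    by (intro bexI[of _ X]) (auto simp: wip_def power2_eq_square w_def m_def B_def mult.assoc)
qed

text \<open>Eigenvalues up to \<open>2 \<lambda>\<^sub>r\<^sub>+\<^sub>1\<close> cost only a factor 2, so only the larger ones have to be deflated.\<close>

lemma smooth_of_top_small:
  fixes lm z :: "nat \<Rightarrow> real"
  assumes pos: "\<And>i. i < d \<Longrightarrow> 0 < lm i" and r: "r < d" and \<mu>: "0 \<le> \<mu>"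
    and top: "(\<Sum>i\<in>{i. i < d \<and> 2 * lm r < lm i}. (z i)\<^sup>2) \<le> 1 / 8 * (\<Sum>i\<in>{i. i < d \<and> lm i \<le> 2 * lm r}. (z i)\<^sup>2)"
  shows "(\<Sum>i<d. (z i)\<^sup>2) \<le> 9 / 4 * (lm r + \<mu>) * (\<Sum>i<d. (z i)\<^sup>2 / (lm i + \<mu>))"
proof -
  let ?T = "{i. i < d \<and> 2 * lm r < lm i}" and ?S = "{i. i < d \<and> lm i \<le> 2 * lm r}"
  have split: "{..<d} = ?T \<union> ?S" "?T \<inter> ?S = {}" by auto
  have "(\<Sum>i<d. (z i)\<^sup>2) = (\<Sum>i\<in>?T. (z i)\<^sup>2) + (\<Sum>i\<in>?S. (z i)\<^sup>2)"
    unfolding split(1) by (rule sum.union_disjoint) (use split in auto)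
  \<comment> \<open>The price of the top part is 9/8; the factor 2 of the next step makes it
    9/4.\<close>
  also have "\<dots> \<le> 9 / 8 * (\<Sum>i\<in>?S. (z i)\<^sup>2)" using top by simp
  also have "(\<Sum>i\<in>?S. (z i)\<^sup>2) \<le> (\<Sum>i\<in>?S. 2 * (lm r + \<mu>) * ((z i)\<^sup>2 / (lm i + \<mu>)))"
  proof (rule sum_mono)
    fix i assume i: "i \<in> ?S"
    then have p: "0 < lm i + \<mu>" using pos[of i] \<mu> by auto
    have "lm i + \<mu> \<le> 2 * (lm r + \<mu>)" using i \<mu> by auto
    then have "(lm i + \<mu>) * ((z i)\<^sup>2 / (lm i + \<mu>)) \<le> 2 * (lm r + \<mu>) * ((z i)\<^sup>2 / (lm i + \<mu>))"
      using p by (intro mult_right_mono) auto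
    then show "(z i)\<^sup>2 \<le> 2 * (lm r + \<mu>) * ((z i)\<^sup>2 / (lm i + \<mu>))" using p by simp
  qed
  also have "\<dots> \<le> (\<Sum>i<d. 2 * (lm r + \<mu>) * ((z i)\<^sup>2 / (lm i + \<mu>)))"
  proof (rule sum_mono2)
    fix i assume "i \<in> {..<d} - ?S"
    then have "0 < lm i + \<mu>" using pos[of i] \<mu> by auto
    moreover have "0 < lm r + \<mu>" using pos[OF r] \<mu> by simp
    ultimately show "0 \<le> 2 * (lm r + \<mu>) * ((z i)\<^sup>2 / (lm i + \<mu>))" by simp
  qed auto
  also have "9 / 8 * \<dots> = 9 / 4 * (lm r + \<mu>) * (\<Sum>i<d. (z i)\<^sup>2 / (lm i + \<mu>))"
    unfolding sum_distrib_left[symmetric] by simp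
  finally show ?thesis by simp
qed

section \<open>Exact solution after \<open>d\<close> steps, for the case \<Delta> = 0\<close>

lemma interpolating_poly_exists:
  fixes Y :: "real set"
  assumes "finite Y" "0 \<notin> Y"
  shows "\<exists>p. (\<forall>a\<ge>card Y. coeff p a = 0) \<and> (\<forall>y\<in>Y. y * poly p y = 1)"
  using assms
proof (induction Y rule: finite_induct)
  case empty
  show ?case by (intro exI[of _ 0]) auto
next
  case (insert \<rho> Y)
  then obtain p where p: "\<And>a. card Y \<le> a \<Longrightarrow> coeff p a = 0" "\<And>y. y \<in> Y \<Longrightarrow> y * poly p y = 1"
    by auto
  \<comment> \<open>The correction \<open>1 - pCons 0 p\<close> vanishes at the old nodes and
    repairs the new one. The degree is bounded through coefficients because
    \<open>degree p < card Y\<close> fails for empty \<open>Y\<close>.\<close>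
  define p' where "p' = p + Polynomial.smult (1 / \<rho>) (1 - pCons 0 p)"
  have "coeff p' a = 0" if "card (insert \<rho> Y) \<le> a" for a
    using p(1)[of a] p(1)[of "a - 1"] that insert(1,2) by (cases a) (auto simp: p'_def coeff_pCons)
  moreover have "y * poly p' y = 1" if "y \<in> insert \<rho> Y" for y
    using p(2)[of y] that insert(4) by (auto simp: p'_def field_simps)
  ultimately show ?case by blast
qed

text \<open>The inverse of A_\<mu> agrees with a polynomial of degree below \<open>d\<close> in
  \<open>A\<close>, so powers applied to \<open>b\<close> alone reach the solution.\<close>

lemma krylov_exact:
  fixes lm \<beta> :: "nat \<Rightarrow> real"
  assumes pos: "\<And>i. i < d \<Longrightarrow> 0 < lm i" and \<mu>: "0 \<le> \<mu>" and t: "d \<le> t"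
  shows "\<exists>x \<in> comb (kgen lm (block_cols \<beta> g)) ({..l} \<times> {..<t}). \<forall>i<d. x i = \<beta> i / (lm i + \<mu>)"
proof -
  define Y where "Y = lm ` {..<d}"
  have zero_notin: "0 \<notin> (\<lambda>y. y + \<mu>) ` Y"
  proof
    assume "0 \<in> (\<lambda>y. y + \<mu>) ` Y"
    then obtain i where "i < d" "lm i + \<mu> = 0" by (auto simp: Y_def)
    then show False using pos[of i] \<mu> by simp
  qed
  obtain p where p: "\<And>a. card ((\<lambda>y. y + \<mu>) ` Y) \<le> a \<Longrightarrow> coeff p a = 0" "\<And>y. y \<in> (\<lambda>y. y + \<mu>) ` Y \<Longrightarrow> y * poly p y = 1"
    using interpolating_poly_exists[of "(\<lambda>y. y + \<mu>) ` Y"] zero_notin by (auto simp: Y_def)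
  have cd: "card ((\<lambda>y. y + \<mu>) ` Y) \<le> d"
    using card_image_le[of "{..<d}" "\<lambda>i. lm i + \<mu>"] by (simp add: Y_def image_image)
  \<comment> \<open>The generators are powers of the unshifted eigenvalues, so the polynomial is
    rewritten in the unshifted variable.\<close>
  define p' where "p' = pcompose p [:\<mu>, 1:]"
  have c': "coeff p' a = 0" if "d \<le> a" for a
  proof (cases "p = 0")
    case False
    have "degree p < d"
      using p(1)[of "degree p"] cd False by (metis leading_coeff_0_iff not_le order_trans)
    moreover have "degree p' \<le> degree p" using degree_pcompose_le[of p "[:\<mu>, 1:]"] by (simp add: p'_def)
    ultimately show ?thesis using that by (intro coeff_eq_0) auto
  qed (simp add: p'_def)
  have px: "poly p' x = (\<Sum>a<t. coeff p' a * x ^ a)" for x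
  proof -
    have "poly p' x = (\<Sum>a\<le>degree p'. coeff p' a * x ^ a)" by (rule poly_altdef)
    also have "\<dots> = (\<Sum>a<max t (Suc (degree p')). coeff p' a * x ^ a)"
      by (rule sum.mono_neutral_left) (auto simp: coeff_eq_0)
    also have "\<dots> = (\<Sum>a<t. coeff p' a * x ^ a)"
      using c' t by (intro sum.mono_neutral_right) auto
    finally show ?thesis .
  qed
  define x where "x = (\<lambda>i. \<Sum>a<t. coeff p' a * kgen lm (block_cols \<beta> g) (0, a) i)"
  have "x \<in> comb (kgen lm (block_cols \<beta> g)) ({..l} \<times> {..<t})"
    unfolding x_def by (rule comb_sum) (auto intro!: comb_gen)
  moreover have "x i = \<beta> i / (lm i + \<mu>)" if i: "i < d" for i
  proof -
    have "x i = poly p' (lm i) * \<beta> i" by (simp add: x_def kgen_def px sum_distrib_left mult_ac)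
    also have "poly p' (lm i) = poly p (lm i + \<mu>)" by (simp add: p'_def poly_pcompose add.commute)
    also have "\<dots> = 1 / (lm i + \<mu>)"
      using p(2)[of "lm i + \<mu>"] i pos[OF i] \<mu> by (auto simp: Y_def field_simps)
    finally show ?thesis by simp
  qed
  ultimately show ?thesis by blast
qed

section \<open>Random block Vandermonde matrices\<close>

text \<open>Gaussian elimination, one equation and one pivot at a time. The index types are
  arbitrary because the unknowns below are indexed by option and sum types.\<close>

lemma underdetermined_solution:
  fixes M :: "'e \<Rightarrow> 'x \<Rightarrow> real"
  assumes "finite E" "finite X" "card E < card X"
  shows "\<exists>q. (\<exists>x\<in>X. q x \<noteq> 0) \<and> (\<forall>e\<in>E. (\<Sum>x\<in>X. M e x * q x) = 0)"
  using assms
proof (induction E arbitrary: X M rule: finite_induct)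
  case empty
  then obtain x where "x \<in> X" by fastforce
  then show ?case by (intro exI[of _ "\<lambda>_. 1"]) auto
next
  case (insert e E)
  show ?case
  proof (cases "\<exists>x\<in>X. M e x \<noteq> 0")
    case False
    from insert.prems insert.hyps have "card E < card X" by simp
    from insert.IH[OF insert.prems(1) this, of M] obtain q where
      "\<exists>x\<in>X. q x \<noteq> 0" "\<forall>e\<in>E. (\<Sum>x\<in>X. M e x * q x) = 0" by blast
    moreover have "(\<Sum>x\<in>X. M e x * q x) = 0" using False by simp
    ultimately show ?thesis by blast
  next
    case True
    then obtain p where p: "p \<in> X" "M e p \<noteq> 0" by blast
    define M' where "M' e' x = M e' x - M e' p * M e x / M e p" for e' x
    have "card E < card (X - {p})" using insert p by simp
    from insert.IH[OF _ this, of M'] finite_Diff[OF insert.prems(1)]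
    obtain q where q: "\<exists>x\<in>X - {p}. q x \<noteq> 0" "\<And>e'. e' \<in> E \<Longrightarrow> (\<Sum>x\<in>X - {p}. M' e' x * q x) = 0"
      by blast
    define s where "s = (\<Sum>x\<in>X - {p}. M e x * q x)"
    define q' where "q' x = (if x = p then - s / M e p else q x)" for x
    have sum: "(\<Sum>x\<in>X. M e' x * q' x) = M e' p * (- s / M e p) + (\<Sum>x\<in>X - {p}. M e' x * q x)" for e'
    proof -
      have "(\<Sum>x\<in>X. M e' x * q' x) = M e' p * q' p + (\<Sum>x\<in>X - {p}. M e' x * q' x)"
        using insert.prems(1) p(1) by (rule sum.remove)
      moreover have "(\<Sum>x\<in>X - {p}. M e' x * q' x) = (\<Sum>x\<in>X - {p}. M e' x * q x)"
        by (rule sum.cong) (auto simp: q'_def)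
      ultimately show ?thesis by (simp add: q'_def)
    qed
    have "(\<Sum>x\<in>X. M e x * q' x) = 0" unfolding sum using p by (simp add: s_def)
    moreover have "(\<Sum>x\<in>X. M e' x * q' x) = 0" if "e' \<in> E" for e'
    proof -
      have "(\<Sum>x\<in>X - {p}. M' e' x * q x) = (\<Sum>x\<in>X - {p}. M e' x * q x) - M e' p / M e p * s"
        unfolding s_def sum_distrib_left sum_subtractf[symmetric]
        by (rule sum.cong) (auto simp: M'_def left_diff_distrib)
      then show ?thesis unfolding sum using q(2)[OF that] by simp
    qed
    moreover have "\<exists>x\<in>X. q' x \<noteq> 0" using q(1) by (auto simp: q'_def)
    ultimately show ?thesis by blast
  qed
qed

section \<open>Deterministic inverse bounds for block Vandermonde matrices\<close>

definition bidx :: "nat \<Rightarrow> nat \<Rightarrow> (nat \<times> nat) set" where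
  "bidx n l = {..<n} \<times> {..<l}"

lemma finite_bidx [simp, intro]: "finite (bidx n l)" and card_bidx: "card (bidx n l) = n * l"
  by (auto simp: bidx_def)

text \<open>Entry \<open>(a, j)\<close> of the linear combination with weights \<open>y\<close> of the rows \<open>(x\<^sub>i\<^sup>a g\<^sub>i\<^sub>j)\<close>, \<open>i \<in> S\<close>,
  of the block Vandermonde matrix.\<close>
definition rowcomb :: "(nat \<Rightarrow> real) \<Rightarrow> (nat \<times> nat \<Rightarrow> real) \<Rightarrow> nat set \<Rightarrow> (nat \<Rightarrow> real) \<Rightarrow> nat \<times> nat \<Rightarrow> real" where
  "rowcomb x g S y e = (\<Sum>i\<in>S. y i * (x i ^ fst e * g (i, snd e)))"

definition rownorm :: "nat \<Rightarrow> nat \<Rightarrow> (nat \<Rightarrow> real) \<Rightarrow> (nat \<times> nat \<Rightarrow> real) \<Rightarrow> nat set \<Rightarrow> (nat \<Rightarrow> real) \<Rightarrow> real" where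
  "rownorm n l x g S y = (\<Sum>e\<in>bidx n l. \<bar>rowcomb x g S y e\<bar>)"

lemma rownorm_nonneg [simp]: "0 \<le> rownorm n l x g S y"
  by (simp add: rownorm_def sum_nonneg)

text \<open>The weight of a row in the inverse bound. It dominates the pairing of the row with any
  vector whose entries are at most 1 in modulus, so the size of a row cancels against its weight in
  the recursion. The summand 1 keeps it away from zero.\<close>

definition gsize :: "nat \<Rightarrow> (nat \<times> nat \<Rightarrow> real) \<Rightarrow> nat \<Rightarrow> real" where
  "gsize l g i = 1 + (\<Sum>j<l. \<bar>g (i, j)\<bar>)"

lemma gsize_ge_1: "1 \<le> gsize l g i" by (simp add: gsize_def sum_nonneg)

lemma gsize_pos [simp]: "0 < gsize l g i" using gsize_ge_1[of l g i] by linarith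

lemma gsize_nonzero [simp]: "gsize l g i \<noteq> 0" and gsize_nonneg [simp]: "0 \<le> gsize l g i"
  using gsize_pos[of l g i] by linarith+

text \<open>Some combination of the rows is a multiple of the unit vector \<open>e\<close>, by counting dimensions, and \<open>R\<close> shows
  that the multiple is nonzero; pairing it with \<open>p\<close> isolates \<open>p e\<close>.\<close>

lemma coordinate_bound:
  assumes S: "finite S" "card S = n * l"
    and R: "\<And>k y. k \<in> S \<Longrightarrow> \<bar>y k\<bar> * gsize l g k \<le> R k * rownorm n l x g S y"
    and e: "e \<in> bidx n l"
  shows "\<bar>p e\<bar> \<le> (\<Sum>k\<in>S. R k / gsize l g k * \<bar>\<Sum>e\<in>bidx n l. p e * (x k ^ fst e * g (k, snd e))\<bar>)"
proof -
  \<comment> \<open>\<open>None\<close> stands for the unknown multiple of the unit vector at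
    \<open>e\<close>; it makes one more unknown than there are equations.\<close>
  define M where "M = (\<lambda>e' v. case v of None \<Rightarrow> (if e' = e then - 1 else 0) | Some i \<Rightarrow> x i ^ fst e' * g (i, snd e'))"
  have "card (bidx n l) < card (insert None (Some ` S))"
    using S by (simp add: card_bidx card_image)
  from underdetermined_solution[OF _ _ this, of M] S(1) obtain q where
    q: "\<exists>v\<in>insert None (Some ` S). q v \<noteq> 0"
    "\<And>e'. e' \<in> bidx n l \<Longrightarrow> (\<Sum>v\<in>insert None (Some ` S). M e' v * q v) = 0" by auto
  define y where "y i = q (Some i)" for i
  have row: "rowcomb x g S y e' = (if e' = e then q None else 0)" if "e' \<in> bidx n l" for e'
  proof -
    have "0 = M e' None * q None + (\<Sum>v\<in>Some ` S. M e' v * q v)"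
      using q(2)[OF that] S(1) by (subst (asm) sum.insert) auto
    also have "(\<Sum>v\<in>Some ` S. M e' v * q v) = (\<Sum>i\<in>S. M e' (Some i) * q (Some i))"
      by (subst sum.reindex) auto
    finally show ?thesis by (auto simp: M_def rowcomb_def y_def mult_ac)
  qed
  have rn: "rownorm n l x g S y = \<bar>q None\<bar>"
  proof -
    have "rownorm n l x g S y = (\<Sum>e'\<in>bidx n l. if e' = e then \<bar>q None\<bar> else 0)"
      unfolding rownorm_def by (rule sum.cong) (auto simp: row)
    then show ?thesis using e by simp
  qed
  have q0: "q None \<noteq> 0"
  proof
    assume z: "q None = 0"
    then obtain i where i: "i \<in> S" "q (Some i) \<noteq> 0" using q(1) by auto
    then have "\<bar>y i\<bar> * gsize l g i \<le> 0" using R[OF i(1), of y] rn z by simp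
    moreover have "0 < \<bar>y i\<bar> * gsize l g i" using i(2) by (simp add: y_def)
    ultimately show False by simp
  qed
  have yb: "\<bar>y k\<bar> \<le> R k / gsize l g k * \<bar>q None\<bar>" if "k \<in> S" for k
    using R[OF that, of y] by (simp add: rn field_simps)
  have "p e * q None = (\<Sum>e'\<in>bidx n l. p e' * rowcomb x g S y e')"
  proof -
    have "(\<Sum>e'\<in>bidx n l. p e' * rowcomb x g S y e') = (\<Sum>e'\<in>bidx n l. if e' = e then p e * q None else 0)"
      by (rule sum.cong) (auto simp: row)
    then show ?thesis using e by simp
  qed
  also have "\<dots> = (\<Sum>k\<in>S. y k * (\<Sum>e\<in>bidx n l. p e * (x k ^ fst e * g (k, snd e))))"
    unfolding rowcomb_def sum_distrib_left by (subst sum.swap) (simp add: mult_ac)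
  finally have "\<bar>p e\<bar> * \<bar>q None\<bar> = \<bar>\<Sum>k\<in>S. y k * (\<Sum>e\<in>bidx n l. p e * (x k ^ fst e * g (k, snd e)))\<bar>"
    by (simp add: abs_mult[symmetric])
  also have "\<dots> \<le> (\<Sum>k\<in>S. \<bar>y k * (\<Sum>e\<in>bidx n l. p e * (x k ^ fst e * g (k, snd e)))\<bar>)"
    by (rule sum_abs)
  also have "\<dots> \<le> (\<Sum>k\<in>S. R k / gsize l g k * \<bar>q None\<bar> * \<bar>\<Sum>e\<in>bidx n l. p e * (x k ^ fst e * g (k, snd e))\<bar>)"
    unfolding abs_mult using yb by (intro sum_mono mult_right_mono) auto
  also have "\<dots> = (\<Sum>k\<in>S. R k / gsize l g k * \<bar>\<Sum>e\<in>bidx n l. p e * (x k ^ fst e * g (k, snd e))\<bar>) * \<bar>q None\<bar>"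
    unfolding sum_distrib_right by (rule sum.cong) (auto simp: mult_ac)
  finally show ?thesis using q0 by simp
qed

text \<open>A vector polynomial \<open>h + (t - x\<^sub>i) p(t)\<close> vanishing on all rows but the \<open>i\<close>-th exists by counting unknowns, and
  \<open>h \<noteq> 0\<close> because the smaller system \<open>S'\<close> is nonsingular. It tests \<open>y\<close> against the \<open>i\<close>-th row, through \<open>h\<close> alone.\<close>

lemma block_vandermonde_step:
  assumes S: "finite S" "card S = Suc n * l" and i: "i \<in> S" and S': "S' \<subseteq> S - {i}" "card S' = n * l"
    and l: "0 < l"
    and x: "\<And>k. k \<in> S \<Longrightarrow> 0 \<le> x k \<and> x k \<le> 1"
    and gap: "0 < D" "\<And>k. k \<in> S - {i} \<Longrightarrow> D \<le> \<bar>x k - x i\<bar>"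
    and R: "\<And>k y. k \<in> S' \<Longrightarrow> \<bar>y k\<bar> * gsize l g k \<le> R k * rownorm n l x g S' y"
    and R0: "\<And>k. k \<in> S' \<Longrightarrow> 0 \<le> R k"
  shows "\<exists>h. (\<forall>j<l. \<bar>h j\<bar> \<le> 1) \<and> (\<exists>j<l. \<bar>h j\<bar> = 1) \<and>
    (\<forall>y g'. (\<forall>k\<in>S - {i}. \<forall>j<l. g' (k, j) = g (k, j)) \<longrightarrow>
      \<bar>y i\<bar> * \<bar>\<Sum>j<l. h j * g' (i, j)\<bar> \<le> (1 + 2 / D * (\<Sum>k\<in>S'. R k)) * rownorm (Suc n) l x g' S y)"
proof -
  \<comment> \<open>\<open>Inl j\<close> are the entries of \<open>h\<close> and
    \<open>Inr e\<close> the coefficients of \<open>p\<close>: together \<open>Suc n * l\<close>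
    unknowns, against one equation for each of the \<open>Suc n * l - 1\<close> rows other than
    \<open>i\<close>.\<close>
  define X where "X = Inl ` {..<l} \<union> Inr ` bidx n l"
  define M where "M k v = (case v of Inl j \<Rightarrow> g (k, j) | Inr e \<Rightarrow> (x k - x i) * (x k ^ fst e * g (k, snd e)))" for k v
  have disj: "Inl ` {..<l} \<inter> Inr ` bidx n l = {}" by auto
  have cX: "card X = l + n * l" unfolding X_def
    by (subst card_Un_disjoint) (auto simp: card_image card_bidx)
  have finX: "finite X" by (simp add: X_def)
  have "card (S - {i}) < card X" using S i l by (simp add: cX)
  from underdetermined_solution[OF _ _ this, of M] finite_Diff[OF S(1)] obtain q0 where
    q0: "\<exists>v\<in>X. q0 v \<noteq> 0" "\<And>k. k \<in> S - {i} \<Longrightarrow> (\<Sum>v\<in>X. M k v * q0 v) = 0"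
    using finX by blast
  define T where "T u p k = (\<Sum>j<l. u j * g (k, j)) + (x k - x i) * (\<Sum>e\<in>bidx n l. p e * (x k ^ fst e * g (k, snd e)))"
    for u p k
  have T: "T (q0 \<circ> Inl) (q0 \<circ> Inr) k = 0" if "k \<in> S - {i}" for k
  proof -
    have "(\<Sum>v\<in>X. M k v * q0 v) = (\<Sum>v\<in>Inl ` {..<l}. M k v * q0 v) + (\<Sum>v\<in>Inr ` bidx n l. M k v * q0 v)"
      unfolding X_def by (rule sum.union_disjoint) auto
    also have "(\<Sum>v\<in>Inl ` {..<l}. M k v * q0 v) = (\<Sum>j<l. M k (Inl j) * q0 (Inl j))"
      by (subst sum.reindex) auto
    also have "(\<Sum>v\<in>Inr ` bidx n l. M k v * q0 v) = (\<Sum>e\<in>bidx n l. M k (Inr e) * q0 (Inr e))"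
      by (subst sum.reindex) auto
    finally show ?thesis using q0(2)[OF that] by (simp add: T_def M_def sum_distrib_left mult_ac)
  qed
  \<comment> \<open>Vanishing at row \<open>k\<close> expresses the value of \<open>p\<close> there
    through \<open>u\<close>, divided by a gap of at least \<open>D\<close>;
    \<open>coordinate_bound\<close> passes from values on \<open>S'\<close> to coefficients. It is
    used with \<open>c = 0\<close> to see that \<open>h\<close> is nonzero and with
    \<open>c = 1\<close> to bound the normalized \<open>p\<close>.\<close>
  have pb: "\<bar>p e\<bar> \<le> 1 / D * (\<Sum>k\<in>S'. R k) * c"
    if "\<And>k. k \<in> S - {i} \<Longrightarrow> T u p k = 0" "\<And>j. j < l \<Longrightarrow> \<bar>u j\<bar> \<le> c" "0 \<le> c" "e \<in> bidx n l" for u p c e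
  proof -
    have "\<bar>p e\<bar> \<le> (\<Sum>k\<in>S'. R k / gsize l g k * \<bar>\<Sum>e\<in>bidx n l. p e * (x k ^ fst e * g (k, snd e))\<bar>)"
      using S' S(1) that(4) R by (intro coordinate_bound) (auto intro: finite_subset)
    also have "\<dots> \<le> (\<Sum>k\<in>S'. R k / gsize l g k * (c * gsize l g k / D))"
    proof (rule sum_mono, rule mult_left_mono)
      fix k assume k: "k \<in> S'"
      then have kS: "k \<in> S - {i}" using S' by auto
      let ?v = "\<Sum>e\<in>bidx n l. p e * (x k ^ fst e * g (k, snd e))"
      have "D * \<bar>?v\<bar> \<le> \<bar>x k - x i\<bar> * \<bar>?v\<bar>" using gap(2)[OF kS] by (rule mult_right_mono) simp
      also have "\<dots> = \<bar>\<Sum>j<l. u j * g (k, j)\<bar>"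
      proof -
        have "(x k - x i) * ?v = - (\<Sum>j<l. u j * g (k, j))" using that(1)[OF kS] unfolding T_def by linarith
        then show ?thesis unfolding abs_mult[symmetric] by simp
      qed
      also have "\<dots> \<le> (\<Sum>j<l. \<bar>u j * g (k, j)\<bar>)" by (rule sum_abs)
      also have "\<dots> \<le> (\<Sum>j<l. c * \<bar>g (k, j)\<bar>)"
        unfolding abs_mult using that(2) by (intro sum_mono mult_right_mono) auto
      also have "\<dots> \<le> c * gsize l g k"
        using that(3) by (simp add: gsize_def sum_distrib_left[symmetric] mult_left_mono)
      finally show "\<bar>?v\<bar> \<le> c * gsize l g k / D" using gap(1) by (simp add: field_simps)
      show "0 \<le> R k / gsize l g k" using R0[OF k] by (intro divide_nonneg_pos) auto
    qed
    also have "\<dots> = (\<Sum>k\<in>S'. R k * (c / D))"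
    proof (rule sum.cong[OF refl])
      fix k show "R k / gsize l g k * (c * gsize l g k / D) = R k * (c / D)"
        using gsize_pos[of l g k] by (simp add: less_imp_neq[THEN not_sym])
    qed
    finally show ?thesis unfolding sum_distrib_right[symmetric] by (simp add: mult_ac)
  qed
  \<comment> \<open>Normalizing the largest entry of \<open>h\<close> to modulus 1 guarantees that
    the pairing with a Gaussian row contains one standard Gaussian with coefficient 1 or -1.\<close>
  define c where "c = Max ((\<lambda>j. \<bar>q0 (Inl j)\<bar>) ` {..<l})"
  have cin: "c \<in> (\<lambda>j. \<bar>q0 (Inl j)\<bar>) ` {..<l}" unfolding c_def using l by (intro Max_in) auto
  have cle: "\<bar>q0 (Inl j)\<bar> \<le> c" if "j < l" for j unfolding c_def using that by (intro Max_ge) auto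
  have c0: "c \<noteq> 0"
  proof
    assume "c = 0"
    then have z: "q0 (Inl j) = 0" if "j < l" for j using cle[OF that] by simp
    have "q0 (Inr e) = 0" if "e \<in> bidx n l" for e
      using pb[of "q0 \<circ> Inl" "q0 \<circ> Inr" 0 e] T that z by simp
    then show False using q0(1) z by (auto simp: X_def)
  qed
  then have cpos: "0 < c" using cin by auto
  define h where "h j = q0 (Inl j) / c" for j
  define p where "p e = q0 (Inr e) / c" for e
  have h1: "\<bar>h j\<bar> \<le> 1" if "j < l" for j using cle[OF that] cpos by (simp add: h_def)
  have h2: "\<exists>j<l. \<bar>h j\<bar> = 1" using cin cpos by (auto simp: h_def)
  have Tc: "T h p k = 0" if "k \<in> S - {i}" for k
  proof -
    have "T h p k = T (q0 \<circ> Inl) (q0 \<circ> Inr) k / c"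
      by (simp add: T_def h_def p_def sum_divide_distrib[symmetric] add_divide_distrib)
    then show ?thesis using T[OF that] by simp
  qed
  define P where "P = 1 / D * (\<Sum>k\<in>S'. R k)"
  have P0: "0 \<le> P" using gap(1) R0 unfolding P_def by (intro mult_nonneg_nonneg sum_nonneg) auto
  have pP: "\<bar>p e\<bar> \<le> P" if "e \<in> bidx n l" for e
    using pb[of h p 1 e] Tc h1 that by (simp add: P_def)
  \<comment> \<open>\<open>h\<close> and \<open>p\<close> were built from the rows other than
    \<open>i\<close>, so row \<open>i\<close> may still be replaced. This is the independence that
    the integration over row \<open>i\<close> will rely on.\<close>
  have main: "\<bar>y i\<bar> * \<bar>\<Sum>j<l. h j * g' (i, j)\<bar> \<le> (1 + 2 / D * (\<Sum>k\<in>S'. R k)) * rownorm (Suc n) l x g' S y"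
    if g': "\<forall>k\<in>S - {i}. \<forall>j<l. g' (k, j) = g (k, j)" for y g'
  proof -
    define v where "v = rowcomb x g' S y"
    \<comment> \<open>The vector polynomial evaluated on the row combination: multiplying row
      \<open>k\<close> by \<open>x k\<close> raises the power by one, hence the index
      \<open>Suc (fst e)\<close>.\<close>
    define \<Lambda> where "\<Lambda> = (\<Sum>j<l. h j * v (0, j)) + (\<Sum>e\<in>bidx n l. p e * (v (Suc (fst e), snd e) - x i * v e))"
    define T' where "T' k = (\<Sum>j<l. h j * g' (k, j)) + (x k - x i) * (\<Sum>e\<in>bidx n l. p e * (x k ^ fst e * g' (k, snd e)))" for k
    have T'0: "T' k = 0" if "k \<in> S - {i}" for k
    proof -
      have "T' k = T h p k" unfolding T'_def T_def
        using g' that by (auto simp: bidx_def intro!: arg_cong2[where f = "(+)"] arg_cong2[where f = "(*)"] sum.cong)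
      then show ?thesis using Tc[OF that] by simp
    qed
    have 1: "(\<Sum>j<l. h j * v (0, j)) = (\<Sum>k\<in>S. y k * (\<Sum>j<l. h j * g' (k, j)))"
      unfolding v_def rowcomb_def sum_distrib_left by (subst sum.swap) (simp add: mult_ac)
    have 2: "(\<Sum>e\<in>bidx n l. p e * (v (Suc (fst e), snd e) - x i * v e))
       = (\<Sum>k\<in>S. y k * ((x k - x i) * (\<Sum>e\<in>bidx n l. p e * (x k ^ fst e * g' (k, snd e)))))"
    proof -
      have "v (Suc (fst e), snd e) - x i * v e = (\<Sum>k\<in>S. y k * (x k - x i) * (x k ^ fst e * g' (k, snd e)))" for e
        by (simp add: v_def rowcomb_def sum_distrib_left sum_subtractf[symmetric] algebra_simps)
      then have "(\<Sum>e\<in>bidx n l. p e * (v (Suc (fst e), snd e) - x i * v e))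
         = (\<Sum>e\<in>bidx n l. \<Sum>k\<in>S. p e * (y k * (x k - x i) * (x k ^ fst e * g' (k, snd e))))"
        by (simp add: sum_distrib_left)
      also have "\<dots> = (\<Sum>k\<in>S. \<Sum>e\<in>bidx n l. p e * (y k * (x k - x i) * (x k ^ fst e * g' (k, snd e))))"
        by (rule sum.swap)
      finally show ?thesis by (simp add: sum_distrib_left mult_ac)
    qed
    have "\<Lambda> = (\<Sum>k\<in>S. y k * T' k)"
      unfolding \<Lambda>_def 1 2 T'_def sum.distrib[symmetric] by (intro sum.cong refl) (simp add: distrib_left)
    also have "\<dots> = y i * T' i"
      using S(1) i T'0 by (subst sum.remove[of S i]) auto
    finally have L1: "\<bar>\<Lambda>\<bar> = \<bar>y i\<bar> * \<bar>\<Sum>j<l. h j * g' (i, j)\<bar>" by (simp add: T'_def abs_mult)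
    let ?N = "rownorm (Suc n) l x g' S y"
    have N: "?N = (\<Sum>e\<in>bidx (Suc n) l. \<bar>v e\<bar>)" by (simp add: rownorm_def v_def)
    have a: "\<bar>\<Sum>j<l. h j * v (0, j)\<bar> \<le> ?N"
    proof -
      have "\<bar>\<Sum>j<l. h j * v (0, j)\<bar> \<le> (\<Sum>j<l. \<bar>h j * v (0, j)\<bar>)" by (rule sum_abs)
      also have "\<dots> \<le> (\<Sum>j<l. \<bar>v (0, j)\<bar>)"
        using h1 by (intro sum_mono) (simp add: abs_mult mult_left_le_one_le)
      also have "\<dots> = (\<Sum>e\<in>Pair 0 ` {..<l}. \<bar>v e\<bar>)" by (subst sum.reindex) (auto simp: inj_on_def)
      also have "\<dots> \<le> ?N" unfolding N by (rule sum_mono2) (auto simp: bidx_def)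
      finally show ?thesis .
    qed
    have b1: "(\<Sum>e\<in>bidx n l. \<bar>v (Suc (fst e), snd e)\<bar>) \<le> ?N"
    proof -
      have "(\<Sum>e\<in>bidx n l. \<bar>v (Suc (fst e), snd e)\<bar>) = (\<Sum>e\<in>(\<lambda>e. (Suc (fst e), snd e)) ` bidx n l. \<bar>v e\<bar>)"
        by (subst sum.reindex) (auto simp: inj_on_def)
      also have "\<dots> \<le> ?N" unfolding N by (rule sum_mono2) (auto simp: bidx_def)
      finally show ?thesis .
    qed
    have b2: "(\<Sum>e\<in>bidx n l. \<bar>v e\<bar>) \<le> ?N" unfolding N by (rule sum_mono2) (auto simp: bidx_def)
    have "\<bar>\<Sum>e\<in>bidx n l. p e * (v (Suc (fst e), snd e) - x i * v e)\<bar>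
      \<le> (\<Sum>e\<in>bidx n l. \<bar>p e * (v (Suc (fst e), snd e) - x i * v e)\<bar>)" by (rule sum_abs)
    also have "\<dots> \<le> (\<Sum>e\<in>bidx n l. P * (\<bar>v (Suc (fst e), snd e)\<bar> + \<bar>v e\<bar>))"
    proof (rule sum_mono)
      fix e assume e: "e \<in> bidx n l"
      have "\<bar>x i * v e\<bar> \<le> \<bar>v e\<bar>" using x[OF i] by (simp add: abs_mult mult_left_le_one_le)
      then have "\<bar>v (Suc (fst e), snd e) - x i * v e\<bar> \<le> \<bar>v (Suc (fst e), snd e)\<bar> + \<bar>v e\<bar>" by linarith
      then show "\<bar>p e * (v (Suc (fst e), snd e) - x i * v e)\<bar> \<le> P * (\<bar>v (Suc (fst e), snd e)\<bar> + \<bar>v e\<bar>)"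
        unfolding abs_mult using pP[OF e] P0 by (intro mult_mono) auto
    qed
    also have "\<dots> = P * ((\<Sum>e\<in>bidx n l. \<bar>v (Suc (fst e), snd e)\<bar>) + (\<Sum>e\<in>bidx n l. \<bar>v e\<bar>))"
      by (simp add: sum_distrib_left sum.distrib distrib_left)
    also have "\<dots> \<le> P * (?N + ?N)" using b1 b2 P0 by (intro mult_left_mono) auto
    finally have "\<bar>\<Lambda>\<bar> \<le> ?N + P * (?N + ?N)" unfolding \<Lambda>_def using a by linarith
    also have "\<dots> = (1 + 2 / D * (\<Sum>k\<in>S'. R k)) * ?N" by (simp add: P_def algebra_simps)
    finally show ?thesis using L1 by simp
  qed
  show ?thesis
  proof (intro exI[of _ h] conjI allI impI)
    show "\<bar>h j\<bar> \<le> 1" if "j < l" for j using h1[OF that] .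
    show "\<exists>j<l. \<bar>h j\<bar> = 1" by (rule h2)
    show "\<bar>y i\<bar> * \<bar>\<Sum>j<l. h j * g' (i, j)\<bar> \<le> (1 + 2 / D * (\<Sum>k\<in>S'. R k)) * rownorm (Suc n) l x g' S y"
      if "\<forall>k\<in>S - {i}. \<forall>j<l. g' (k, j) = g (k, j)" for y g' using main[OF that] .
  qed
qed

text \<open>The fourth root of a quotient with \<open>0 / 0 = 0\<close> and a nonzero numerator over
  0 infinite. For finite \<rho>, being at most \<rho> then means
  \<open>a \<le> \<rho> ^ 4 * b\<close> also when \<open>b = 0\<close>.\<close>

definition qt :: "real \<Rightarrow> real \<Rightarrow> ennreal" where
  "qt a b = (if a = 0 then 0 else if b = 0 then \<infinity> else ennreal ((a / b) powr (1 / 4)))"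

text \<open>The fourth root of the weighted bound for the left inverse: the smallest constant with
  \<open>\<bar>y\<^sub>i\<bar> (1 + \<bar>g\<^sub>i\<bar>\<^sub>1) \<le> U\<^sup>4 \<bar>\<Sum>\<^sub>k y\<^sub>k row\<^sub>k\<bar>\<^sub>1\<close>. Rational weights make it a countable supremum. Its mean
  is finite because \<open>\<bar>\<xi>\<bar> powr (-1/4)\<close> is integrable for a Gaussian \<open>\<xi>\<close>.\<close>
definition invbd :: "nat \<Rightarrow> nat \<Rightarrow> (nat \<Rightarrow> real) \<Rightarrow> nat set \<Rightarrow> nat \<Rightarrow> (nat \<times> nat \<Rightarrow> real) \<Rightarrow> ennreal" where
  "invbd n l x S i g = (SUP y \<in> S \<rightarrow>\<^sub>E \<rat>. qt (\<bar>y i\<bar> * gsize l g i) (rownorm n l x g S y))"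

lemma rational_seq_above:
  fixes y :: real
  obtains q :: "nat \<Rightarrow> real" where "\<And>m. q m \<in> \<rat>" "\<And>m. y < q m" "q \<longlonglongrightarrow> y"
proof -
  have "\<exists>q\<in>\<rat>. y < q \<and> q < y + 1 / real (Suc m)" for m :: nat
    using Rats_dense_in_real[of y "y + 1 / real (Suc m)"] by auto
  then obtain q where q: "\<And>m. q m \<in> \<rat>" "\<And>m. y < q m" "\<And>m. q m < y + 1 / real (Suc m)"
    by metis
  have "q \<longlonglongrightarrow> y"
  proof (rule real_tendsto_sandwich[of "\<lambda>_. y" _ _ "\<lambda>m. y + 1 / real (Suc m)"])
    show "(\<lambda>m. y + 1 / real (Suc m)) \<longlonglongrightarrow> y"
      using tendsto_add[OF tendsto_const[of y] LIMSEQ_inverse_real_of_nat] by (simp add: inverse_eq_divide)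
  qed (use q in \<open>auto intro!: always_eventually less_imp_le\<close>)
  with q(1,2) show thesis by (rule that)
qed

lemma rational_approx:
  fixes y :: "'i \<Rightarrow> real"
  shows "\<exists>Y. (\<forall>m::nat. Y m \<in> S \<rightarrow>\<^sub>E \<rat>) \<and> (\<forall>i\<in>S. (\<lambda>m. Y m i) \<longlonglongrightarrow> y i)"
proof -
  have "\<exists>q::nat \<Rightarrow> real. (\<forall>m. q m \<in> \<rat>) \<and> q \<longlonglongrightarrow> y i" for i
    using rational_seq_above[of "y i"] by blast
  then obtain q where "\<And>i m::nat. q i m \<in> \<rat>" "\<And>i. q i \<longlonglongrightarrow> y i" by metis
  then show ?thesis by (intro exI[of _ "\<lambda>m. restrict (\<lambda>i. q i m) S"]) auto
qed

lemma tendsto_rownorm: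
  assumes "\<And>i. i \<in> S \<Longrightarrow> (\<lambda>m. Y m i) \<longlonglongrightarrow> y i"
  shows "(\<lambda>m. rownorm n l x g S (Y m)) \<longlonglongrightarrow> rownorm n l x g S y"
  unfolding rownorm_def rowcomb_def
  by (intro tendsto_sum tendsto_rabs tendsto_mult tendsto_const assms)

lemma powr_quarter_power: "0 \<le> a \<Longrightarrow> (a powr (1 / 4)) ^ 4 = (a::real)"
  by (cases "a = 0") (simp_all add: powr_realpow[symmetric] powr_powr)

lemma powr_quarter_le:
  assumes "0 \<le> (a::real)" "0 \<le> \<rho>"
  shows "a powr (1 / 4) \<le> \<rho> \<longleftrightarrow> a \<le> \<rho> ^ 4"
proof (cases "a = 0")
  case False
  then have a: "0 < a" using assms by simp
  have e: "(a powr (1 / 4)) ^ 4 = a" using assms(1) by (rule powr_quarter_power)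
  show ?thesis
    using power_mono_iff[of "a powr (1 / 4)" \<rho> 4] assms e by simp
qed (use assms in auto)

text \<open>The inequality survives limits in the weights, so the rational weights of the supremum
  give all real ones.\<close>

lemma invbd_bound:
  assumes "invbd n l x S k g \<le> ennreal \<rho>" "0 \<le> \<rho>" "k \<in> S"
  shows "\<bar>y k\<bar> * gsize l g k \<le> \<rho> ^ 4 * rownorm n l x g S y"
proof -
  have rat: "\<bar>z k\<bar> * gsize l g k \<le> \<rho> ^ 4 * rownorm n l x g S z" if z: "z \<in> S \<rightarrow>\<^sub>E \<rat>" for z
  proof -
    let ?a = "\<bar>z k\<bar> * gsize l g k" and ?b = "rownorm n l x g S z"
    have le: "qt ?a ?b \<le> ennreal \<rho>"
      using assms(1) SUP_upper[OF z, of "\<lambda>y. qt (\<bar>y k\<bar> * gsize l g k) (rownorm n l x g S y)"]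
      unfolding invbd_def by (rule order_trans[rotated])
    have a0: "0 \<le> ?a" by (simp add: less_imp_le)
    show ?thesis
    proof (cases "?a = 0")
      case True
      then show ?thesis using assms(2) by simp
    next
      case False
      then have b: "?b \<noteq> 0" using le by (auto simp: qt_def top_unique)
      then have b0: "0 < ?b" using rownorm_nonneg[of n l x g S z] by linarith
      have "(?a / ?b) powr (1 / 4) \<le> \<rho>"
        using le False b assms(2) by (simp add: qt_def)
      then have "?a / ?b \<le> \<rho> ^ 4"
        using a0 b0 assms(2) by (subst (asm) powr_quarter_le) auto
      then show ?thesis using b0 by (simp add: pos_divide_le_eq)
    qed
  qed
  obtain Y where Y: "\<And>m. Y m \<in> S \<rightarrow>\<^sub>E \<rat>" "\<And>i. i \<in> S \<Longrightarrow> (\<lambda>m::nat. Y m i) \<longlonglongrightarrow> y i"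
    using rational_approx[of S y] by blast
  show ?thesis
  proof (rule LIMSEQ_le)
    show "(\<lambda>m. \<bar>Y m k\<bar> * gsize l g k) \<longlonglongrightarrow> \<bar>y k\<bar> * gsize l g k"
      by (intro tendsto_intros Y(2) assms(3))
    show "(\<lambda>m. \<rho> ^ 4 * rownorm n l x g S (Y m)) \<longlonglongrightarrow> \<rho> ^ 4 * rownorm n l x g S y"
      by (intro tendsto_intros tendsto_rownorm Y(2))
    show "\<exists>N. \<forall>m\<ge>N. \<bar>Y m k\<bar> * gsize l g k \<le> \<rho> ^ 4 * rownorm n l x g S (Y m)"
      using rat[OF Y(1)] by blast
  qed
qed

text \<open>Subadditivity of the fourth root in another form. It turns the recursion of
  \<open>block_vandermonde_step\<close>, linear in fourth powers, into one that is linear in the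
  roots, whose means can be added.\<close>

lemma sum_power4_le:
  fixes X :: "'i \<Rightarrow> real"
  assumes "finite A" "\<And>i. i \<in> A \<Longrightarrow> 0 \<le> X i" "0 \<le> c"
  shows "c ^ 4 + (\<Sum>i\<in>A. X i ^ 4) \<le> (c + (\<Sum>i\<in>A. X i)) ^ 4"
  using assms(1,2)
proof (induction A rule: finite_induct)
  case (insert i A)
  have two: "a ^ 4 + b ^ 4 \<le> (a + b) ^ 4" if "0 \<le> a" "0 \<le> b" for a b :: real
  proof -
    have "(a + b) ^ 4 = a ^ 4 + b ^ 4 + (4 * a ^ 3 * b + 6 * a\<^sup>2 * b\<^sup>2 + 4 * a * b ^ 3)"
      by (simp add: power4_eq_xxxx power3_eq_cube power2_eq_square algebra_simps)
    then show ?thesis using that by simp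
  qed
  have "c ^ 4 + (\<Sum>i\<in>insert i A. X i ^ 4) \<le> (c + (\<Sum>i\<in>A. X i)) ^ 4 + X i ^ 4"
    using insert by simp
  also have "\<dots> \<le> (c + (\<Sum>i\<in>A. X i) + X i) ^ 4"
    using insert assms(3) by (intro two add_nonneg_nonneg sum_nonneg) auto
  finally show ?case using insert by (simp add: add_ac)
qed simp

text \<open>\<open>h\<close> is fixed by the other rows before \<open>g'\<close> is quantified.
  Given these rows, the bound is a function of row \<open>i\<close> alone times a constant, so the
  mean over row \<open>i\<close> can be taken by itself.\<close>

lemma invbd_step:
  assumes S: "finite S" "card S = Suc n * l" and i: "i \<in> S" and S': "S' \<subseteq> S - {i}" "card S' = n * l"
    and l: "0 < l"
    and x: "\<And>k. k \<in> S \<Longrightarrow> 0 \<le> x k \<and> x k \<le> 1"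
    and gap: "0 < D" "\<And>k. k \<in> S - {i} \<Longrightarrow> D \<le> \<bar>x k - x i\<bar>"
  shows "\<exists>h. (\<exists>j<l. \<bar>h j\<bar> = 1) \<and>
    (\<forall>g'. (\<forall>k\<in>S - {i}. \<forall>j<l. g' (k, j) = g (k, j)) \<longrightarrow>
      invbd (Suc n) l x S i g' \<le> qt (gsize l g' i) \<bar>\<Sum>j<l. h j * g' (i, j)\<bar>
        * (1 + ennreal ((2 / D) powr (1 / 4)) * (\<Sum>k\<in>S'. invbd n l x S' k g)))"
proof -
  define c where "c = (2 / D) powr (1 / 4)"
  have c0: "0 < c" using gap(1) by (simp add: c_def)
  have c4: "c ^ 4 = 2 / D" using gap(1) unfolding c_def by (intro powr_quarter_power) simp
  have fS': "finite S'" using S(1) S'(1) finite_subset by blast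
  have qpos: "0 < qt (gsize l g' i) b" if "0 \<le> b" for g' b
    using that gsize_pos[of l g' i] by (auto simp: qt_def)
  show ?thesis
  proof (cases "\<exists>k\<in>S'. invbd n l x S' k g = \<infinity>")
    \<comment> \<open>If a constant of the smaller matrix is infinite, so is the right-hand side,
      because \<open>qt\<close> with a positive numerator is never 0; any \<open>h\<close> with an
      entry of modulus 1 will do.\<close>
    case True
    then have "(\<Sum>k\<in>S'. invbd n l x S' k g) = \<infinity>" using fS' by simp
    then have "1 + ennreal c * (\<Sum>k\<in>S'. invbd n l x S' k g) = \<infinity>"
      using c0 by (simp add: ennreal_mult_top)
    then have inf: "qt (gsize l g' i) \<bar>\<Sum>j<l. 1 * g' (i, j)\<bar> * (1 + ennreal c * (\<Sum>k\<in>S'. invbd n l x S' k g)) = \<infinity>" for g'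
      using qpos[of "\<bar>\<Sum>j<l. 1 * g' (i, j)\<bar>" g'] by (simp add: ennreal_mult_top)
    show ?thesis
    proof (intro exI[of _ "\<lambda>_. 1"] conjI allI impI)
      show "\<exists>j<l. \<bar>1::real\<bar> = 1" using l by auto
    qed (unfold c_def[symmetric] inf, simp)
  next
    case False
    define \<rho> where "\<rho> k = enn2real (invbd n l x S' k g)" for k
    have \<rho>: "invbd n l x S' k g = ennreal (\<rho> k)" "0 \<le> \<rho> k" if "k \<in> S'" for k
      using False that by (auto simp: \<rho>_def less_top)
    have R: "\<bar>y k\<bar> * gsize l g k \<le> \<rho> k ^ 4 * rownorm n l x g S' y" if "k \<in> S'" for k y
      using invbd_bound[of n l x S' k g "\<rho> k" y] \<rho>[OF that] that by simp
    obtain h where h: "\<exists>j<l. \<bar>h j\<bar> = 1" and main: "\<And>y g'. (\<forall>k\<in>S - {i}. \<forall>j<l. g' (k, j) = g (k, j)) \<Longrightarrow>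
      \<bar>y i\<bar> * \<bar>\<Sum>j<l. h j * g' (i, j)\<bar> \<le> (1 + 2 / D * (\<Sum>k\<in>S'. \<rho> k ^ 4)) * rownorm (Suc n) l x g' S y"
      using block_vandermonde_step[OF S i S' l x gap R] by auto
    define W where "W = 1 + c * (\<Sum>k\<in>S'. \<rho> k)"
    have W1: "1 \<le> W" using c0 \<rho>(2) by (simp add: W_def sum_nonneg)
    have W4: "1 + 2 / D * (\<Sum>k\<in>S'. \<rho> k ^ 4) \<le> W ^ 4"
      using sum_power4_le[OF fS', of "\<lambda>k. c * \<rho> k" 1] c0 \<rho>(2)
      by (simp add: W_def power_mult_distrib c4 sum_distrib_left)
    have Weq: "1 + ennreal c * (\<Sum>k\<in>S'. invbd n l x S' k g) = ennreal W"
    proof -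
      have "(\<Sum>k\<in>S'. invbd n l x S' k g) = (\<Sum>k\<in>S'. ennreal (\<rho> k))" using \<rho>(1) by (rule sum.cong[OF refl])
      also have "\<dots> = ennreal (\<Sum>k\<in>S'. \<rho> k)" using \<rho>(2) by (rule sum_ennreal)
      finally show ?thesis
        using c0 \<rho>(2) by (simp add: W_def ennreal_mult[symmetric] ennreal_1[symmetric] sum_nonneg del: ennreal_1)
    qed
    show ?thesis
    proof (intro exI[of _ h] conjI allI impI h)
      fix g' assume g': "\<forall>k\<in>S - {i}. \<forall>j<l. g' (k, j) = g (k, j)"
      let ?G = "gsize l g' i" and ?\<xi> = "\<bar>\<Sum>j<l. h j * g' (i, j)\<bar>"
      have G: "0 < ?G" by simp
      have "qt (\<bar>y i\<bar> * ?G) (rownorm (Suc n) l x g' S y) \<le> qt ?G ?\<xi> * ennreal W" for y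
      proof -
        let ?N = "rownorm (Suc n) l x g' S y"
        consider "y i = 0" | "?\<xi> = 0" | "y i \<noteq> 0" "0 < ?\<xi>" by linarith
        then show ?thesis
        proof cases
          case 1
          then show ?thesis by (simp add: qt_def)
        next
          case 2
          then have "qt ?G ?\<xi> * ennreal W = \<infinity>"
            using G W1 by (simp add: qt_def ennreal_top_mult)
          then show ?thesis by simp
        next
          case 3
          have "\<bar>y i\<bar> * ?\<xi> \<le> (1 + 2 / D * (\<Sum>k\<in>S'. \<rho> k ^ 4)) * ?N" by (rule main[OF g'])
          also have "\<dots> \<le> W ^ 4 * ?N" using W4 by (rule mult_right_mono) simp
          finally have le: "\<bar>y i\<bar> * ?\<xi> \<le> W ^ 4 * ?N" .
          have "0 < \<bar>y i\<bar> * ?\<xi>" using 3 by simp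
          then have "?N \<noteq> 0" using le by auto
          then have N: "0 < ?N" using rownorm_nonneg[of "Suc n" l x g' S y] by linarith
          have "\<bar>y i\<bar> * ?G / ?N \<le> W ^ 4 * (?G / ?\<xi>)"
            using le N 3(2) G by (simp add: field_simps mult_right_mono)
          also have "\<dots> = (W * (?G / ?\<xi>) powr (1 / 4)) ^ 4"
            using G 3(2) by (subst power_mult_distrib, subst powr_quarter_power) auto
          finally have "(\<bar>y i\<bar> * ?G / ?N) powr (1 / 4) \<le> W * (?G / ?\<xi>) powr (1 / 4)"
            using N W1 by (subst powr_quarter_le) auto
          then show ?thesis using N 3 G W1
            by (simp add: qt_def ennreal_mult[symmetric] mult.commute)
        qed
      qed
      then show "invbd (Suc n) l x S i g' \<le> qt ?G ?\<xi>
        * (1 + ennreal ((2 / D) powr (1 / 4)) * (\<Sum>k\<in>S'. invbd n l x S' k g))"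
        unfolding c_def[symmetric] Weq invbd_def[of "Suc n"] by (intro SUP_least)
    qed
  qed
qed

section \<open>Means over the Gaussian entries\<close>

abbreviation std_normal :: "real measure" where
  "std_normal \<equiv> density lborel (\<lambda>x. ennreal (std_normal_density x))"

abbreviation gprod :: "'i set \<Rightarrow> ('i \<Rightarrow> real) measure" where
  "gprod I \<equiv> Pi\<^sub>M I (\<lambda>_. std_normal)"

lemma prob_space_std_normal: "prob_space std_normal"
  using prob_space_normal_density[of 1 0] by simp

interpretation std_normal: product_prob_space "\<lambda>_. std_normal" I for I :: "'i set"
  unfolding product_prob_space_def product_prob_space_axioms_def product_sigma_finite_def
  using prob_space_std_normal prob_space_imp_sigma_finite by blast

lemma sets_std_normal [measurable_cong]: "sets std_normal = sets borel" by simp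

definition isq :: "real \<Rightarrow> ennreal" where
  "isq b = (if b = 0 then \<infinity> else ennreal (\<bar>b\<bar> powr (- 1 / 2)))"

lemma isq_measurable [measurable]: "isq \<in> borel_measurable borel"
  unfolding isq_def by measurable

lemma qt_measurable [measurable]:
  assumes [measurable]: "f \<in> borel_measurable M" "g \<in> borel_measurable M"
  shows "(\<lambda>x. qt (f x) (g x)) \<in> borel_measurable M"
  unfolding qt_def by measurable

text \<open>Numerator and denominator will depend on the same Gaussian row;
  \<open>u * v \<le> u ^ 2 + v ^ 2\<close> separates them. Squaring doubles the exponent, and this
  is why fourth roots are taken: the remaining power -1/2 of \<open>b\<close> is integrable near 0,
  while square roots would leave the power -1, which is not.\<close>

lemma qt_le:
  assumes "1 \<le> a" shows "qt a \<bar>b\<bar> \<le> ennreal a + isq b"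
proof (cases "b = 0")
  case False
  define u v where "u = a powr (1 / 4)" and "v = \<bar>b\<bar> powr (- 1 / 4)"
  have "(a / \<bar>b\<bar>) powr (1 / 4) = u * v"
    using assms False by (simp add: u_def v_def powr_divide powr_minus_divide)
  also have "\<dots> \<le> u ^ 2 + v ^ 2"
    using zero_le_power2[of "u - v"] zero_le_power2[of u] zero_le_power2[of v] zero_le_power2[of "u + v"]
    unfolding power2_diff power2_sum by linarith
  also have "u ^ 2 = a powr (1 / 2)" using assms by (simp add: u_def powr_realpow[symmetric] powr_powr)
  also have "v ^ 2 = \<bar>b\<bar> powr (- 1 / 2)" using False by (simp add: v_def powr_realpow[symmetric] powr_powr)
  also have "a powr (1 / 2) \<le> a powr 1" using assms by (intro powr_mono) auto
  finally have "(a / \<bar>b\<bar>) powr (1 / 4) \<le> a + \<bar>b\<bar> powr (- 1 / 2)" using assms by simp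
  then show ?thesis using False assms
    by (auto simp: qt_def isq_def ennreal_plus[symmetric] simp del: ennreal_plus)
qed (auto simp: isq_def)

lemma nn_integral_isq_unit: "(\<integral>\<^sup>+y. isq y * indicator {-1..1} y \<partial>lborel) \<le> 4"
proof -
  define f :: "real \<Rightarrow> real" where "f y = (if y \<in> {0..1} then y powr (- 1 / 2) else 0)" for y
  have [measurable]: "f \<in> borel_measurable borel" unfolding f_def by measurable
  have "((\<lambda>y::real. y powr (- 1 / 2)) has_integral 2) {0..1}"
    using has_integral_powr_from_0[of "- 1 / 2" 1] by simp
  then have "(f has_integral 2) UNIV"
    unfolding f_def by (subst has_integral_restrict_UNIV) simp
  moreover have "0 \<le> f y" for y by (simp add: f_def)
  ultimately have f: "(\<integral>\<^sup>+y. ennreal (f y) \<partial>lborel) = ennreal 2"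
    by (intro nn_integral_has_integral_lborel) measurable
  have f': "(\<integral>\<^sup>+y. ennreal (f (- y)) \<partial>lborel) = ennreal 2"
    using nn_integral_real_affine[of "\<lambda>y. ennreal (f y)" "-1" 0] f by simp
  have "(\<integral>\<^sup>+y. isq y * indicator {-1..1} y \<partial>lborel) \<le> (\<integral>\<^sup>+y. ennreal (f y) + ennreal (f (- y)) \<partial>lborel)"
  proof (rule nn_integral_mono_AE)
    have "AE y in lborel. y \<noteq> (0::real)" by (rule AE_lborel_singleton)
    then show "AE y in lborel. isq y * indicator {-1..1} y \<le> ennreal (f y) + ennreal (f (- y))"
    proof eventually_elim
      case (elim y)
      then show ?case by (cases "y < 0") (auto simp: isq_def f_def indicator_def)
    qed
  qed
  also have "\<dots> = (\<integral>\<^sup>+y. ennreal (f y) \<partial>lborel) + (\<integral>\<^sup>+y. ennreal (f (- y)) \<partial>lborel)"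
    by (rule nn_integral_add) auto
  also have "\<dots> = 4" unfolding f f' by (simp add: ennreal_plus[symmetric] del: ennreal_plus)
  finally show ?thesis .
qed

text \<open>Uniform in the offset \<open>c\<close>, which will carry the other entries of the row.
  Where the argument exceeds 1 in modulus the integrand is at most the density, with total mass 1;
  elsewhere the density is at most 1 and the singularity integrates to at most 4.\<close>

lemma nn_integral_std_normal_isq:
  assumes "\<bar>s\<bar> = 1"
  shows "(\<integral>\<^sup>+x. isq (c + s * x) \<partial>std_normal) \<le> 5"
proof -
  have [measurable]: "(\<lambda>x. isq (c + s * x)) \<in> borel_measurable borel" by measurable
  have pw: "ennreal (std_normal_density x) * isq (c + s * x)
     \<le> ennreal (std_normal_density x) + isq (c + s * x) * indicator {-1..1} (c + s * x)" for x
  proof (cases "c + s * x \<in> {-1..1}")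
    case True
    have "std_normal_density x \<le> 1"
    proof -
      have "exp (- x\<^sup>2 / 2) \<le> 1" by simp
      moreover have "1 \<le> sqrt (2 * pi)" using pi_gt3 by simp
      ultimately show ?thesis unfolding std_normal_density_def
        by (intro mult_le_one) (auto simp: divide_le_eq)
    qed
    then have "ennreal (std_normal_density x) * isq (c + s * x) \<le> 1 * isq (c + s * x)"
      by (intro mult_right_mono) (auto simp: ennreal_le_1)
    then show ?thesis using True by (simp add: add_increasing)
  next
    case False
    then have "1 < \<bar>c + s * x\<bar>" by auto
    then have "isq (c + s * x) \<le> 1"
      by (auto simp: isq_def ennreal_le_1 powr_minus_divide intro!: ge_one_powr_ge_zero)
    then have "ennreal (std_normal_density x) * isq (c + s * x) \<le> ennreal (std_normal_density x) * 1"
      by (rule mult_left_mono) simp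
    then show ?thesis by (simp add: add_increasing2)
  qed
  have "(\<integral>\<^sup>+x. isq (c + s * x) \<partial>std_normal) = (\<integral>\<^sup>+x. ennreal (std_normal_density x) * isq (c + s * x) \<partial>lborel)"
    by (rule nn_integral_density) auto
  also have "\<dots> \<le> (\<integral>\<^sup>+x. ennreal (std_normal_density x) + isq (c + s * x) * indicator {-1..1} (c + s * x) \<partial>lborel)"
    by (intro nn_integral_mono pw)
  also have "\<dots> = (\<integral>\<^sup>+x. ennreal (std_normal_density x) \<partial>lborel)
      + (\<integral>\<^sup>+x. isq (c + s * x) * indicator {-1..1} (c + s * x) \<partial>lborel)"
    by (rule nn_integral_add) auto
  also have "(\<integral>\<^sup>+x. ennreal (std_normal_density x) \<partial>lborel) = 1"
    using prob_space.emeasure_space_1[OF prob_space_std_normal] by (simp add: emeasure_density)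
  also have "(\<integral>\<^sup>+x. isq (c + s * x) * indicator {-1..1} (c + s * x) \<partial>lborel) \<le> 4"
  proof -
    have "s \<noteq> 0" using assms by auto
    then show ?thesis
      using nn_integral_real_affine[of "\<lambda>y. isq y * indicator {-1..1} y" s c] assms nn_integral_isq_unit by simp
  qed
  finally show ?thesis by (simp add: add_left_mono)
qed

lemma nn_integral_std_normal_abs: "(\<integral>\<^sup>+x. ennreal \<bar>x\<bar> \<partial>std_normal) \<le> 1"
proof -
  have "(\<integral>\<^sup>+x. ennreal \<bar>x\<bar> \<partial>std_normal) = (\<integral>\<^sup>+x. ennreal (std_normal_density x) * ennreal \<bar>x\<bar> \<partial>lborel)"
    by (rule nn_integral_density) auto
  also have "\<dots> = (\<integral>\<^sup>+x. ennreal (std_normal_density x * \<bar>x\<bar> ^ (2 * 0 + 1)) \<partial>lborel)"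
    by (simp add: ennreal_mult)
  also have "\<dots> = ennreal (\<integral>x. std_normal_density x * \<bar>x\<bar> ^ (2 * 0 + 1) \<partial>lborel)"
    by (rule nn_integral_eq_integral[OF integrable_std_normal_moment_abs]) auto
  also have "\<dots> = ennreal (sqrt (2 / pi))" unfolding integral_std_normal_moment_abs_odd by simp
  also have "\<dots> \<le> 1" using pi_gt3 by (simp add: ennreal_le_1)
  finally show ?thesis .
qed

lemma nn_integral_component_abs:
  assumes "e \<in> I"
  shows "(\<integral>\<^sup>+\<omega>. ennreal \<bar>\<omega> e\<bar> \<partial>gprod I) \<le> 1"
proof -
  have "(\<integral>\<^sup>+\<omega>. ennreal \<bar>\<omega> e\<bar> \<partial>gprod I) =
     (\<integral>\<^sup>+x. ennreal \<bar>x\<bar> \<partial>distr (gprod I) std_normal (\<lambda>\<omega>. \<omega> e))"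
    using assms by (subst nn_integral_distr) auto
  also have "\<dots> \<le> 1" using nn_integral_std_normal_abs by (simp add: std_normal.PiM_component[OF assms])
  finally show ?thesis .
qed

lemma nn_integral_gsize:
  assumes "{i} \<times> {..<l} \<subseteq> I"
  shows "(\<integral>\<^sup>+\<omega>. ennreal (gsize l \<omega> i) \<partial>gprod I) \<le> ennreal (1 + real l)"
proof -
  have [measurable]: "(\<lambda>\<omega>. \<omega> (i, j)) \<in> borel_measurable (gprod I)" if "j < l" for j
    using assms that by (intro measurable_PiM_component_rev) auto
  have "(\<integral>\<^sup>+\<omega>. ennreal (gsize l \<omega> i) \<partial>gprod I)
      = (\<integral>\<^sup>+\<omega>. 1 + (\<Sum>j<l. ennreal \<bar>\<omega> (i, j)\<bar>) \<partial>gprod I)"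
    by (simp add: gsize_def sum_nonneg sum_ennreal)
  also have "\<dots> = (\<integral>\<^sup>+\<omega>. 1 \<partial>gprod I) + (\<integral>\<^sup>+\<omega>. (\<Sum>j<l. ennreal \<bar>\<omega> (i, j)\<bar>) \<partial>gprod I)"
    by (rule nn_integral_add) auto
  also have "(\<integral>\<^sup>+\<omega>. (\<Sum>j<l. ennreal \<bar>\<omega> (i, j)\<bar>) \<partial>gprod I)
      = (\<Sum>j<l. \<integral>\<^sup>+\<omega>. ennreal \<bar>\<omega> (i, j)\<bar> \<partial>gprod I)"
    by (rule nn_integral_sum) auto
  also have "\<dots> \<le> (\<Sum>j<l. 1)" using assms by (intro sum_mono nn_integral_component_abs) auto
  also have "(\<integral>\<^sup>+\<omega>. 1 \<partial>gprod I) = 1"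
    by (simp add: std_normal.emeasure_space_1)
  finally show ?thesis
    by (simp add: ennreal_plus add_left_mono ennreal_of_nat_eq_real_of_nat)
qed

text \<open>Given the other entries, the pairing is an offset plus or minus a standard Gaussian,
  since \<open>h j0\<close> has modulus 1. The total \<open>(1 + l) + 5\<close> is at most
  \<open>7 * l\<close>.\<close>

lemma nn_integral_row:
  assumes j0: "j0 < l" "\<bar>h j0\<bar> = 1"
  shows "(\<integral>\<^sup>+\<gamma>. qt (gsize l \<gamma> i) \<bar>\<Sum>j<l. h j * \<gamma> (i, j)\<bar> \<partial>gprod ({i} \<times> {..<l})) \<le> ennreal (7 * real l)"
proof -
  let ?J = "{i} \<times> {..<l}" and ?J' = "{i} \<times> ({..<l} - {j0})"
  have J: "?J = insert (i, j0) ?J'" using j0(1) by auto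
  have [measurable]: "(\<lambda>\<omega>. \<omega> (i, j)) \<in> borel_measurable (gprod ?J)" if "j < l" for j
    using that by (intro measurable_PiM_component_rev) auto
  have [measurable]: "(\<lambda>\<omega>. gsize l \<omega> i) \<in> borel_measurable (gprod ?J)"
    unfolding gsize_def by measurable
  have iM: "(\<lambda>\<omega>. isq (\<Sum>j<l. h j * \<omega> (i, j))) \<in> borel_measurable (gprod ?J)"
    by measurable
  have "(\<integral>\<^sup>+\<gamma>. qt (gsize l \<gamma> i) \<bar>\<Sum>j<l. h j * \<gamma> (i, j)\<bar> \<partial>gprod ?J)
    \<le> (\<integral>\<^sup>+\<gamma>. ennreal (gsize l \<gamma> i) + isq (\<Sum>j<l. h j * \<gamma> (i, j)) \<partial>gprod ?J)"
    by (intro nn_integral_mono qt_le gsize_ge_1)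
  also have "\<dots> = (\<integral>\<^sup>+\<gamma>. ennreal (gsize l \<gamma> i) \<partial>gprod ?J)
      + (\<integral>\<^sup>+\<gamma>. isq (\<Sum>j<l. h j * \<gamma> (i, j)) \<partial>gprod ?J)"
    using iM by (intro nn_integral_add) measurable
  also have "(\<integral>\<^sup>+\<gamma>. ennreal (gsize l \<gamma> i) \<partial>gprod ?J) \<le> ennreal (1 + real l)"
    by (rule nn_integral_gsize) simp
  also have "(\<integral>\<^sup>+\<gamma>. isq (\<Sum>j<l. h j * \<gamma> (i, j)) \<partial>gprod ?J)
     = (\<integral>\<^sup>+\<gamma>. \<integral>\<^sup>+u. isq (\<Sum>j<l. h j * (\<gamma>((i, j0) := u)) (i, j)) \<partial>std_normal \<partial>gprod ?J')"
    unfolding J using iM unfolding J by (intro std_normal.product_nn_integral_insert) auto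
  also have "\<dots> \<le> (\<integral>\<^sup>+\<gamma>. 5 \<partial>gprod ?J')"
  proof (rule nn_integral_mono)
    fix \<gamma>
    have "(\<Sum>j<l. h j * (\<gamma>((i, j0) := u)) (i, j)) = (\<Sum>j\<in>{..<l} - {j0}. h j * \<gamma> (i, j)) + h j0 * u" for u
    proof -
      have "(\<Sum>j<l. h j * (\<gamma>((i, j0) := u)) (i, j)) = h j0 * (\<gamma>((i, j0) := u)) (i, j0) + (\<Sum>j\<in>{..<l} - {j0}. h j * (\<gamma>((i, j0) := u)) (i, j))"
        using j0(1) by (intro sum.remove) auto
      moreover have "(\<Sum>j\<in>{..<l} - {j0}. h j * (\<gamma>((i, j0) := u)) (i, j)) = (\<Sum>j\<in>{..<l} - {j0}. h j * \<gamma> (i, j))"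
        by (rule sum.cong) auto
      ultimately show ?thesis by simp
    qed
    then show "(\<integral>\<^sup>+u. isq (\<Sum>j<l. h j * (\<gamma>((i, j0) := u)) (i, j)) \<partial>std_normal) \<le> 5"
      using nn_integral_std_normal_isq[OF j0(2)] by simp
  qed
  also have "(\<integral>\<^sup>+\<gamma>. 5 \<partial>gprod ?J') = 5"
    by (simp add: std_normal.emeasure_space_1)
  finally have "(\<integral>\<^sup>+\<gamma>. qt (gsize l \<gamma> i) \<bar>\<Sum>j<l. h j * \<gamma> (i, j)\<bar> \<partial>gprod ?J) \<le> ennreal (1 + real l) + 5"
    by (simp add: add_mono)
  also have "\<dots> = ennreal (6 + real l)"
    by (simp add: ennreal_plus[symmetric] ennreal_numeral[symmetric] del: ennreal_plus ennreal_numeral)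
  also have "\<dots> \<le> ennreal (7 * real l)" using j0(1) by (intro ennreal_leI) linarith
  finally show ?thesis .
qed

lemma invbd_measurable [measurable]:
  assumes "finite S" "S \<times> {..<l} \<subseteq> I" "i \<in> S"
  shows "invbd n l x S i \<in> borel_measurable (gprod I)"
proof -
  have m: "(\<lambda>\<omega>. \<omega> (k, j)) \<in> borel_measurable (gprod I)" if "k \<in> S" "j < l" for k j
    using that assms(2) by (intro measurable_PiM_component_rev) auto
  have "countable (S \<rightarrow>\<^sub>E (\<rat>::real set))"
    using assms(1) by (intro Finite_Cartesian_Product.countable_PiE countable_rat) auto
  moreover have "(\<lambda>g. qt (\<bar>y i\<bar> * gsize l g i) (rownorm n l x g S y)) \<in> borel_measurable (gprod I)" for y
    unfolding gsize_def rownorm_def rowcomb_def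
    by (intro qt_measurable borel_measurable_times borel_measurable_sum borel_measurable_add borel_measurable_abs
        borel_measurable_const m assms(3)) (auto simp: bidx_def)
  ultimately show ?thesis unfolding invbd_def by (intro borel_measurable_SUP)
qed

text \<open>Row \<open>i\<close> is integrated against all other entries by Fubini. Each level
  contributes \<open>7 * N\<close> for the row, \<open>N\<close> for the sum over the smaller
  system, the fourth root of \<open>2 / D\<close> for the gap, and 2 for absorbing the summand
  1.\<close>

lemma nn_integral_invbd:
  assumes l: "0 < l" and D: "0 < D" "D \<le> 1"
    and S: "finite S" "card S = Suc n * l" and i: "i \<in> S" and I: "finite I" "S \<times> {..<l} \<subseteq> I"
    and x: "\<And>k. k \<in> S \<Longrightarrow> 0 \<le> x k \<and> x k \<le> 1"
    and gap: "\<And>k k'. k \<in> S \<Longrightarrow> k' \<in> S \<Longrightarrow> k \<noteq> k' \<Longrightarrow> D \<le> \<bar>x k - x k'\<bar>"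
    and N: "Suc n * l \<le> N"
  shows "(\<integral>\<^sup>+g. invbd (Suc n) l x S i g \<partial>gprod I)
     \<le> ennreal (7 * N * (14 * N * (2 / D) powr (1 / 4) * N) ^ n)"
  using S i I x gap N
proof (induction n arbitrary: S i I)
  have step: "(\<integral>\<^sup>+g. invbd (Suc n) l x S i g \<partial>gprod I)
     \<le> ennreal (7 * real N) * (1 + ennreal ((2 / D) powr (1 / 4)) *
        (\<Sum>k\<in>S'. \<integral>\<^sup>+g. invbd n l x S' k g \<partial>gprod (I - {i} \<times> {..<l})))"
    if S: "finite S" "card S = Suc n * l" and i: "i \<in> S" and I: "finite I" "S \<times> {..<l} \<subseteq> I"
    and x: "\<And>k. k \<in> S \<Longrightarrow> 0 \<le> x k \<and> x k \<le> 1"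
    and gap: "\<And>k k'. k \<in> S \<Longrightarrow> k' \<in> S \<Longrightarrow> k \<noteq> k' \<Longrightarrow> D \<le> \<bar>x k - x k'\<bar>"
    and N: "Suc n * l \<le> N" and S': "S' \<subseteq> S - {i}" "card S' = n * l" for n S i I S'
  proof -
    let ?J = "{i} \<times> {..<l}"
    define A where "A = I - ?J"
    have IA: "I = A \<union> ?J" "A \<inter> ?J = {}" "finite A" using I i by (auto simp: A_def)
    have fS': "finite S'" using S(1) S'(1) finite_subset by blast
    have S'A: "S' \<times> {..<l} \<subseteq> A" using S'(1) I(2) by (auto simp: A_def)
    let ?P = "\<lambda>I. gprod I"
    define W where "W g = 1 + ennreal ((2 / D) powr (1 / 4)) * (\<Sum>k\<in>S'. invbd n l x S' k g)" for g
    have mS': "invbd n l x S' k \<in> borel_measurable (?P A)" if "k \<in> S'" for k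
      using fS' S'A that by (rule invbd_measurable)
    have msum: "(\<lambda>a. \<Sum>k\<in>S'. invbd n l x S' k a) \<in> borel_measurable (?P A)"
      using mS' by (rule borel_measurable_sum)
    have mcsum: "(\<lambda>a. ennreal ((2 / D) powr (1 / 4)) * (\<Sum>k\<in>S'. invbd n l x S' k a)) \<in> borel_measurable (?P A)"
      by (intro borel_measurable_times_ennreal borel_measurable_const msum)
    have "(\<integral>\<^sup>+g. invbd (Suc n) l x S i g \<partial>?P I)
       = (\<integral>\<^sup>+a. \<integral>\<^sup>+b. invbd (Suc n) l x S i (merge A ?J (a, b)) \<partial>?P ?J \<partial>?P A)"
      unfolding IA(1) using IA S i I by (intro std_normal.product_nn_integral_fold invbd_measurable) auto
    also have "\<dots> \<le> (\<integral>\<^sup>+a. ennreal (7 * real N) * W a \<partial>?P A)"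
    proof (rule nn_integral_mono)
      fix a
      have gap': "D \<le> \<bar>x k - x i\<bar>" if "k \<in> S - {i}" for k using gap[of k i] i that by blast
      have "\<exists>h. (\<exists>j<l. \<bar>h j\<bar> = 1) \<and> (\<forall>g'. (\<forall>k\<in>S - {i}. \<forall>j<l. g' (k, j) = a (k, j)) \<longrightarrow>
          invbd (Suc n) l x S i g' \<le> qt (gsize l g' i) \<bar>\<Sum>j<l. h j * g' (i, j)\<bar> * W a)"
        unfolding W_def using S i S' l x D(1) gap' by (rule invbd_step)
      then obtain h where h: "\<exists>j<l. \<bar>h j\<bar> = 1" and le: "\<forall>g'. (\<forall>k\<in>S - {i}. \<forall>j<l. g' (k, j) = a (k, j)) \<longrightarrow>
          invbd (Suc n) l x S i g' \<le> qt (gsize l g' i) \<bar>\<Sum>j<l. h j * g' (i, j)\<bar> * W a"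
        by blast
      have "(\<integral>\<^sup>+b. invbd (Suc n) l x S i (merge A ?J (a, b)) \<partial>?P ?J)
        \<le> (\<integral>\<^sup>+b. qt (gsize l b i) \<bar>\<Sum>j<l. h j * b (i, j)\<bar> * W a \<partial>?P ?J)"
      proof (rule nn_integral_mono)
        fix b
        let ?m = "merge A ?J (a, b)"
        have "?m (k, j) = a (k, j)" if "k \<in> S - {i}" "j < l" for k j
          using that I(2) by (auto simp: merge_def A_def)
        then have "invbd (Suc n) l x S i ?m \<le> qt (gsize l ?m i) \<bar>\<Sum>j<l. h j * ?m (i, j)\<bar> * W a"
          by (intro le[rule_format]) auto
        moreover have b: "?m (i, j) = b (i, j)" if "j < l" for j
          using that by (auto simp: merge_def A_def)
        moreover have "gsize l ?m i = gsize l b i" unfolding gsize_def using b by simp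
        moreover have "(\<Sum>j<l. h j * ?m (i, j)) = (\<Sum>j<l. h j * b (i, j))" using b by simp
        ultimately show "invbd (Suc n) l x S i ?m \<le> qt (gsize l b i) \<bar>\<Sum>j<l. h j * b (i, j)\<bar> * W a" by simp
      qed
      also have "\<dots> = (\<integral>\<^sup>+b. qt (gsize l b i) \<bar>\<Sum>j<l. h j * b (i, j)\<bar> \<partial>?P ?J) * W a"
      proof (rule nn_integral_multc)
        have "(\<lambda>\<omega>. \<omega> (i, j)) \<in> borel_measurable (?P ?J)" if "j < l" for j
          using that by (intro measurable_PiM_component_rev) auto
        then show "(\<lambda>b. qt (gsize l b i) \<bar>\<Sum>j<l. h j * b (i, j)\<bar>) \<in> borel_measurable (?P ?J)"
          unfolding gsize_def
          by (intro qt_measurable borel_measurable_times borel_measurable_sum borel_measurable_add borel_measurable_abs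
              borel_measurable_const) auto
      qed
      also have "\<dots> \<le> ennreal (7 * real N) * W a"
      proof (rule mult_right_mono)
        have "(\<integral>\<^sup>+b. qt (gsize l b i) \<bar>\<Sum>j<l. h j * b (i, j)\<bar> \<partial>?P ?J) \<le> ennreal (7 * real l)"
          using h by (elim exE conjE) (rule nn_integral_row)
        also have "\<dots> \<le> ennreal (7 * real N)" using N by (intro ennreal_leI) auto
        finally show "(\<integral>\<^sup>+b. qt (gsize l b i) \<bar>\<Sum>j<l. h j * b (i, j)\<bar> \<partial>?P ?J) \<le> ennreal (7 * real N)" .
      qed simp
      finally show "(\<integral>\<^sup>+b. invbd (Suc n) l x S i (merge A ?J (a, b)) \<partial>?P ?J) \<le> ennreal (7 * real N) * W a" .
    qed
    also have "\<dots> = ennreal (7 * real N) * (\<integral>\<^sup>+a. W a \<partial>?P A)"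
      unfolding W_def by (intro nn_integral_cmult borel_measurable_add borel_measurable_const mcsum)
    also have "(\<integral>\<^sup>+a. W a \<partial>?P A) = (\<integral>\<^sup>+a. 1 \<partial>?P A)
        + (\<integral>\<^sup>+a. ennreal ((2 / D) powr (1 / 4)) * (\<Sum>k\<in>S'. invbd n l x S' k a) \<partial>?P A)"
      unfolding W_def by (intro nn_integral_add borel_measurable_const mcsum)
    also have "(\<integral>\<^sup>+a. 1 \<partial>?P A) = 1" by (simp add: std_normal.emeasure_space_1)
    also have "(\<integral>\<^sup>+a. ennreal ((2 / D) powr (1 / 4)) * (\<Sum>k\<in>S'. invbd n l x S' k a) \<partial>?P A)
        = ennreal ((2 / D) powr (1 / 4)) * (\<integral>\<^sup>+a. (\<Sum>k\<in>S'. invbd n l x S' k a) \<partial>?P A)"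
      by (intro nn_integral_cmult msum)
    also have "(\<integral>\<^sup>+a. (\<Sum>k\<in>S'. invbd n l x S' k a) \<partial>?P A) = (\<Sum>k\<in>S'. \<integral>\<^sup>+a. invbd n l x S' k a \<partial>?P A)"
      using mS' by (rule nn_integral_sum)
    finally show ?thesis unfolding A_def .
  qed
  {
    case 0
    \<comment> \<open>For \<open>n = 0\<close> the smaller system is empty and its factor is
      1.\<close>
    then show ?case using step[of S 0 i I "{}"] by simp
  next
    case (Suc n)
    define c where "c = (2 / D) powr (1 / 4)"
    have c1: "1 \<le> c" unfolding c_def using D by (intro ge_one_powr_ge_zero) auto
    define B where "B = 7 * real N * (14 * real N * c * real N) ^ n"
    have N1: "1 \<le> real N" using Suc.prems l by (cases N) auto
    have B1: "1 \<le> B"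
    proof -
      show ?thesis unfolding B_def using N1 c1 by (intro mult_ge1_I one_le_power) auto
    qed
    have "Suc n * l \<le> card (S - {i})" using Suc.prems l by simp
    \<comment> \<open>Without row \<open>i\<close> there remain \<open>Suc n * l + l - 1\<close>
      rows, and any \<open>Suc n * l\<close> of them will do; only row \<open>i\<close> is
      integrated out at this level.\<close>
    then obtain S' where S': "S' \<subseteq> S - {i}" "card S' = Suc n * l" "finite S'"
      by (rule obtain_subset_with_card_n)
    have le: "(\<integral>\<^sup>+g. invbd (Suc n) l x S' k g \<partial>gprod (I - {i} \<times> {..<l})) \<le> ennreal B" if "k \<in> S'" for k
      unfolding B_def c_def
    proof (rule Suc.IH)
      show "D \<le> \<bar>x k - x k'\<bar>" if "k \<in> S'" "k' \<in> S'" "k \<noteq> k'" for k k'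
        using Suc.prems(7)[of k k'] S'(1) that by blast
    qed (use S' Suc.prems that in auto)
    have "(\<integral>\<^sup>+g. invbd (Suc (Suc n)) l x S i g \<partial>gprod I)
     \<le> ennreal (7 * real N) * (1 + ennreal c *
        (\<Sum>k\<in>S'. \<integral>\<^sup>+g. invbd (Suc n) l x S' k g \<partial>gprod (I - {i} \<times> {..<l})))"
      unfolding c_def using Suc.prems S' by (intro step) auto
    also have "\<dots> \<le> ennreal (7 * real N) * (1 + ennreal c * (\<Sum>k\<in>S'. ennreal B))"
      using le by (intro mult_left_mono add_left_mono sum_mono) auto
    also have "\<dots> = ennreal (7 * real N * (1 + c * (real (Suc n * l) * B)))"
      using c1 B1 S'(2) by (simp add: ennreal_mult ennreal_of_nat_eq_real_of_nat)
    also have "\<dots> \<le> ennreal (7 * real N * (2 * real N * c * B))"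
    proof (intro ennreal_leI mult_left_mono)
      have "Suc n * l \<le> N" using Suc.prems by simp
      then have "real (Suc n * l) \<le> real N" by (rule of_nat_mono)
      then have "c * (real (Suc n * l) * B) \<le> c * (real N * B)" using c1 B1 by (intro mult_left_mono mult_right_mono) auto
      \<comment> \<open>All factors are at least 1, so the summand 1 is absorbed by
        doubling.\<close>
      moreover have "1 \<le> c * (real N * B)"
        using c1 N1 B1 by (intro mult_ge1_I)
      ultimately show "1 + c * (real (Suc n * l) * B) \<le> 2 * real N * c * B" by (simp add: mult_ac)
    qed simp
    also have "7 * real N * (2 * real N * c * B) = 7 * real N * (14 * real N * c * real N) ^ Suc n"
      by (simp add: B_def)
    finally show ?case unfolding c_def .
  }
qed

section \<open>Rotation invariance of the Gaussian measure\<close>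

text \<open>Points of the product measure are undefined outside \<open>I\<close>, so the sum is
  restricted to \<open>I\<close> in order to stay in the space.\<close>

definition fadd :: "'i set \<Rightarrow> ('i \<Rightarrow> real) \<Rightarrow> ('i \<Rightarrow> real) \<Rightarrow> 'i \<Rightarrow> real" where
  "fadd I x y = (\<lambda>i\<in>I. x i + y i)"

abbreviation lprod :: "'i set \<Rightarrow> ('i \<Rightarrow> real) measure" where
  "lprod I \<equiv> Pi\<^sub>M I (\<lambda>_. lborel)"

interpretation lborel_prod: product_sigma_finite "\<lambda>_::'i. lborel :: real measure"
  by standard

lemma fadd_measurable [measurable]:
  assumes [measurable]: "f \<in> measurable M (lprod I)" "g \<in> measurable M (lprod I)"
  shows "(\<lambda>w. fadd I (f w) (g w)) \<in> measurable M (lprod I)"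
  unfolding fadd_def
proof (rule measurable_restrict)
  fix i assume i: "i \<in> I"
  have "(\<lambda>w. f w i) \<in> borel_measurable M" "(\<lambda>w. g w i) \<in> borel_measurable M"
    using measurable_compose[OF assms(1) measurable_component_singleton[OF i]]
      measurable_compose[OF assms(2) measurable_component_singleton[OF i]] by simp_all
  then show "(\<lambda>w. f w i + g w i) \<in> measurable M lborel" by simp
qed

lemma lprod_translation:
  assumes I: "finite I" and y: "y \<in> space (lprod I)"
  shows "distr (lprod I) (lprod I) (\<lambda>x. fadd I x y) = lprod I"
proof (rule lborel_prod.PiM_eqI[OF I])
  have [measurable]: "(\<lambda>x. fadd I x y) \<in> measurable (lprod I) (lprod I)"
    using y by (intro fadd_measurable) auto
  fix A :: "'a \<Rightarrow> real set" assume A: "\<And>i. i \<in> I \<Longrightarrow> A i \<in> sets lborel"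
  have "emeasure (distr (lprod I) (lprod I) (\<lambda>x. fadd I x y)) (Pi\<^sub>E I A)
      = emeasure (lprod I) ((\<lambda>x. fadd I x y) -` (Pi\<^sub>E I A) \<inter> space (lprod I))"
    using A I by (intro emeasure_distr) (auto intro!: sets_PiM_I_finite)
  also have "(\<lambda>x. fadd I x y) -` (Pi\<^sub>E I A) \<inter> space (lprod I) = Pi\<^sub>E I (\<lambda>i. (\<lambda>u. y i + u) -` A i)"
    by (auto simp: space_PiM fadd_def PiE_iff add.commute extensional_def)
  also have "emeasure (lprod I) (Pi\<^sub>E I (\<lambda>i. (\<lambda>u. y i + u) -` A i)) = (\<Prod>i\<in>I. emeasure lborel ((\<lambda>u. y i + u) -` A i))"
  proof (rule lborel_prod.emeasure_PiM[OF I])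
    fix i assume "i \<in> I"
    then have "A i \<in> sets borel" using A by simp
    then have "(\<lambda>u. y i + u) -` A i \<inter> space borel \<in> sets borel" by (rule measurable_sets[rotated]) simp
    then show "(\<lambda>u. y i + u) -` A i \<in> sets lborel" by simp
  qed
  also have "\<dots> = (\<Prod>i\<in>I. emeasure lborel (A i))"
  proof (rule prod.cong[OF refl])
    fix i assume i: "i \<in> I"
    have "emeasure lborel (A i) = emeasure (distr lborel borel ((+) (y i))) (A i)"
      by (simp add: lborel_distr_plus)
    also have "\<dots> = emeasure lborel ((+) (y i) -` A i \<inter> space lborel)"
      using A[OF i] by (intro emeasure_distr) auto
    finally show "emeasure lborel ((\<lambda>u. y i + u) -` A i) = emeasure lborel (A i)" by simp
  qed
  finally show "emeasure (distr (lprod I) (lprod I) (\<lambda>x. fadd I x y)) (Pi\<^sub>E I A) = (\<Prod>i\<in>I. emeasure lborel (A i))" .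
qed simp

lemma nn_integral_lprod_translation:
  assumes I: "finite I" and y: "y \<in> space (lprod I)" and f: "f \<in> borel_measurable (lprod I)"
  shows "(\<integral>\<^sup>+x. f (fadd I x y) \<partial>lprod I) = (\<integral>\<^sup>+x. f x \<partial>lprod I)"
proof -
  have "(\<integral>\<^sup>+x. f x \<partial>lprod I) = (\<integral>\<^sup>+x. f x \<partial>distr (lprod I) (lprod I) (\<lambda>x. fadd I x y))"
    using lprod_translation[OF I y] by simp
  also have "\<dots> = (\<integral>\<^sup>+x. f (fadd I x y) \<partial>lprod I)"
    using y f by (intro nn_integral_distr fadd_measurable) auto
  finally show ?thesis by simp
qed

definition gdens :: "'i set \<Rightarrow> ('i \<Rightarrow> real) \<Rightarrow> ennreal" where
  "gdens I x = (\<Prod>i\<in>I. ennreal (std_normal_density (x i)))"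

lemma gdens_measurable [measurable]: "gdens I \<in> borel_measurable (lprod I)"
  unfolding gdens_def
proof (rule borel_measurable_prod_ennreal)
  fix i assume "i \<in> I"
  then have "(\<lambda>x. x i) \<in> borel_measurable (lprod I)"
    using measurable_component_singleton[of i I "\<lambda>_. lborel"] by simp
  then show "(\<lambda>x. ennreal (std_normal_density (x i))) \<in> borel_measurable (lprod I)" by measurable
qed

lemma PiM_std_normal_density:
  assumes I: "finite I"
  shows "gprod I = density (lprod I) (gdens I)"
proof (rule std_normal.PiM_eqI[OF I, symmetric])
  show "sets (density (lprod I) (gdens I)) = sets (gprod I)"
    by (simp cong: sets_PiM_cong)
  fix A :: "'a \<Rightarrow> real set" assume A: "\<And>i. i \<in> I \<Longrightarrow> A i \<in> sets std_normal"
  have "emeasure (density (lprod I) (gdens I)) (Pi\<^sub>E I A) = (\<integral>\<^sup>+x. gdens I x * indicator (Pi\<^sub>E I A) x \<partial>lprod I)"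
    using A I by (intro emeasure_density) (auto intro!: sets_PiM_I_finite)
  also have "\<dots> = (\<integral>\<^sup>+x. (\<Prod>i\<in>I. ennreal (std_normal_density (x i)) * indicator (A i) (x i)) \<partial>lprod I)"
  proof (rule nn_integral_cong)
    fix x assume x: "x \<in> space (lprod I)"
    then have "(indicator (Pi\<^sub>E I A) x :: ennreal) = (\<Prod>i\<in>I. indicator (A i) (x i))"
      using I by (auto simp: indicator_def space_PiM PiE_iff prod_zero_iff intro!: prod.neutral)
    then show "gdens I x * indicator (Pi\<^sub>E I A) x = (\<Prod>i\<in>I. ennreal (std_normal_density (x i)) * indicator (A i) (x i))"
      by (simp add: gdens_def prod.distrib)
  qed
  also have "\<dots> = (\<Prod>i\<in>I. \<integral>\<^sup>+u. ennreal (std_normal_density u) * indicator (A i) u \<partial>lborel)"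
    using A by (intro lborel_prod.product_nn_integral_prod[OF I]) auto
  also have "\<dots> = (\<Prod>i\<in>I. emeasure std_normal (A i))"
    using A by (intro prod.cong refl emeasure_density[symmetric]) auto
  finally show "emeasure (density (lprod I) (gdens I)) (Pi\<^sub>E I A) = (\<Prod>i\<in>I. emeasure std_normal (A i))" .
qed

lemma gdens_norm_cong:
  assumes "finite I" "(\<Sum>i\<in>I. (x i)\<^sup>2) = (\<Sum>i\<in>I. (y i)\<^sup>2)"
  shows "gdens I x = gdens I y"
proof -
  have e: "gdens I z = ennreal ((1 / sqrt (2 * pi)) ^ card I * exp (- (\<Sum>i\<in>I. (z i)\<^sup>2) / 2))" for z
  proof -
    have "gdens I z = ennreal (\<Prod>i\<in>I. std_normal_density (z i))"
      unfolding gdens_def by (rule prod_ennreal) simp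
    also have "(\<Prod>i\<in>I. std_normal_density (z i)) = (\<Prod>i\<in>I. 1 / sqrt (2 * pi)) * (\<Prod>i\<in>I. exp (- (z i)\<^sup>2 / 2))"
      unfolding prod.distrib[symmetric] by (rule prod.cong) (auto simp: std_normal_density_def)
    also have "(\<Prod>i\<in>I. exp (- (z i)\<^sup>2 / 2)) = exp (\<Sum>i\<in>I. - (z i)\<^sup>2 / 2)"
      using assms(1) by (rule exp_sum[symmetric])
    also have "(\<Sum>i\<in>I. - (z i)\<^sup>2 / 2) = - (\<Sum>i\<in>I. (z i)\<^sup>2) / 2"
      by (simp add: sum_negf sum_divide_distrib)
    finally show ?thesis by simp
  qed
  show ?thesis unfolding e assms(2) ..
qed

text \<open>Lebesgue measure is, up to a factor, the only translation invariant measure (compare two such measures by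
  Fubini against a symmetric function), and the Gaussian weight shows that the factor is 1 for an isometry.\<close>

lemma lprod_isometry:
  assumes I: "finite I" and T: "T \<in> measurable (lprod I) (lprod I)"
    and add: "\<And>x y. T (fadd I x y) = fadd I (T x) (T y)"
    and surj: "\<And>y. y \<in> space (lprod I) \<Longrightarrow> \<exists>x\<in>space (lprod I). T x = y"
    and iso: "\<And>x. x \<in> space (lprod I) \<Longrightarrow> (\<Sum>i\<in>I. (T x i)\<^sup>2) = (\<Sum>i\<in>I. (x i)\<^sup>2)"
  shows "distr (lprod I) (lprod I) T = lprod I"
proof -
  note [measurable] = T
  let ?L = "lprod I" and ?\<nu> = "distr (lprod I) (lprod I) T"
  interpret L: sigma_finite_measure ?L using I by (rule lborel_prod.sigma_finite)
  have neg: "(\<lambda>i\<in>I. - x i) \<in> space ?L" for x by (simp add: space_PiM)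
  have gI: "(\<integral>\<^sup>+x. gdens I x \<partial>?L) = 1"
  proof -
    have "(\<integral>\<^sup>+x. gdens I x \<partial>?L) = emeasure (density ?L (gdens I)) (space ?L)"
      by (subst emeasure_density) (auto intro!: nn_integral_cong simp: indicator_def)
    also have "\<dots> = 1" using std_normal.emeasure_space_1[of I] PiM_std_normal_density[OF I] by (simp add: space_PiM)
    finally show ?thesis .
  qed
  have g\<nu>: "(\<integral>\<^sup>+x. gdens I (T x) \<partial>?L) = 1"
    using gI gdens_norm_cong[OF I iso] by (simp cong: nn_integral_cong)
  have main: "(\<integral>\<^sup>+x. f x \<partial>?L) = (\<integral>\<^sup>+w. f (T w) \<partial>?L)" if [measurable]: "f \<in> borel_measurable ?L" for f
  proof -
    have "(\<integral>\<^sup>+x. f x \<partial>?L) = (\<integral>\<^sup>+w. gdens I (T w) * (\<integral>\<^sup>+x. f x \<partial>?L) \<partial>?L)"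
      using g\<nu> by (subst nn_integral_multc) auto
    also have "\<dots> = (\<integral>\<^sup>+w. (\<integral>\<^sup>+x. gdens I (T w) * f (fadd I x (T w)) \<partial>?L) \<partial>?L)"
    proof (rule nn_integral_cong)
      fix w assume w: "w \<in> space ?L"
      then have Tw: "T w \<in> space ?L" using measurable_space[OF T] by blast
      then have "(\<integral>\<^sup>+x. f x \<partial>?L) = (\<integral>\<^sup>+x. f (fadd I x (T w)) \<partial>?L)"
        using nn_integral_lprod_translation[OF I Tw, of f] by simp
      then show "gdens I (T w) * (\<integral>\<^sup>+x. f x \<partial>?L) = (\<integral>\<^sup>+x. gdens I (T w) * f (fadd I x (T w)) \<partial>?L)"
        using Tw by (subst nn_integral_cmult) auto
    qed
    also have "\<dots> = (\<integral>\<^sup>+x. (\<integral>\<^sup>+w. gdens I (T w) * f (fadd I x (T w)) \<partial>?L) \<partial>?L)"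
    proof -
      interpret pair_sigma_finite ?L ?L by unfold_locales
      show ?thesis by (rule Fubini') measurable
    qed
    also have "\<dots> = (\<integral>\<^sup>+x. (\<integral>\<^sup>+w. gdens I (fadd I x (\<lambda>i\<in>I. - T w i)) * f (T w) \<partial>?L) \<partial>?L)"
    proof (rule nn_integral_cong)
      fix x assume x: "x \<in> space ?L"
      \<comment> \<open>Replacing \<open>w\<close> by \<open>w + u\<close> with
        \<open>T u = - x\<close> moves \<open>x\<close> from the argument of \<open>f\<close> into
        the Gaussian weight, which is even. Integrating over \<open>x\<close> afterwards leaves
        total mass 1. Surjectivity of \<open>T\<close> enters here.\<close>
      obtain u where u: "u \<in> space ?L" "T u = (\<lambda>i\<in>I. - x i)" using surj[OF neg] by blast
      have [measurable]: "(\<lambda>w. gdens I (T w) * f (fadd I x (T w))) \<in> borel_measurable ?L"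
        using x by measurable
      have "(\<integral>\<^sup>+w. gdens I (T w) * f (fadd I x (T w)) \<partial>?L)
         = (\<integral>\<^sup>+w. gdens I (T (fadd I w u)) * f (fadd I x (T (fadd I w u))) \<partial>?L)"
        by (rule nn_integral_lprod_translation[OF I u(1), symmetric]) measurable
      also have "\<dots> = (\<integral>\<^sup>+w. gdens I (fadd I x (\<lambda>i\<in>I. - T w i)) * f (T w) \<partial>?L)"
      proof (rule nn_integral_cong)
        fix w assume w: "w \<in> space ?L"
        then have Tw: "T w \<in> space ?L" using measurable_space[OF T] by blast
        have "fadd I x (T (fadd I w u)) = T w"
          using Tw unfolding add u(2) by (auto simp: fadd_def space_PiM PiE_iff extensional_def)
        moreover have "gdens I (T (fadd I w u)) = gdens I (fadd I x (\<lambda>i\<in>I. - T w i))"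
          unfolding add u(2) by (rule gdens_norm_cong[OF I]) (auto simp: fadd_def power2_commute intro!: sum.cong)
        ultimately show "gdens I (T (fadd I w u)) * f (fadd I x (T (fadd I w u))) = gdens I (fadd I x (\<lambda>i\<in>I. - T w i)) * f (T w)"
          by simp
      qed
      finally show "(\<integral>\<^sup>+w. gdens I (T w) * f (fadd I x (T w)) \<partial>?L)
         = (\<integral>\<^sup>+w. gdens I (fadd I x (\<lambda>i\<in>I. - T w i)) * f (T w) \<partial>?L)" .
    qed
    also have "\<dots> = (\<integral>\<^sup>+w. (\<integral>\<^sup>+x. gdens I (fadd I x (\<lambda>i\<in>I. - T w i)) * f (T w) \<partial>?L) \<partial>?L)"
    proof -
      interpret pair_sigma_finite ?L ?L by unfold_locales
      have [measurable]: "(\<lambda>w. \<lambda>i\<in>I. - T w i) \<in> measurable ?L ?L"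
      proof (rule measurable_restrict)
        fix i assume "i \<in> I"
        then have "(\<lambda>w. T w i) \<in> borel_measurable ?L"
          using measurable_compose[OF T measurable_component_singleton[of i I "\<lambda>_. lborel"]] by simp
        then show "(\<lambda>w. - T w i) \<in> measurable ?L lborel" by simp
      qed
      show ?thesis by (rule Fubini'[symmetric]) measurable
    qed
    also have "\<dots> = (\<integral>\<^sup>+w. f (T w) \<partial>?L)"
    proof (rule nn_integral_cong)
      fix w
      have "(\<lambda>x. gdens I (fadd I x (\<lambda>i\<in>I. - T w i))) \<in> borel_measurable ?L"
        using neg[of "T w"] by measurable
      then have "(\<integral>\<^sup>+x. gdens I (fadd I x (\<lambda>i\<in>I. - T w i)) * f (T w) \<partial>?L)
         = (\<integral>\<^sup>+x. gdens I (fadd I x (\<lambda>i\<in>I. - T w i)) \<partial>?L) * f (T w)"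
        by (rule nn_integral_multc)
      also have "(\<integral>\<^sup>+x. gdens I (fadd I x (\<lambda>i\<in>I. - T w i)) \<partial>?L) = 1"
        using nn_integral_lprod_translation[OF I neg gdens_measurable] gI by simp
      finally show "(\<integral>\<^sup>+x. gdens I (fadd I x (\<lambda>i\<in>I. - T w i)) * f (T w) \<partial>?L) = f (T w)" by (simp only: mult_1_left)
    qed
    finally show ?thesis .
  qed
  show ?thesis
  proof (rule measure_eqI)
    fix A assume A: "A \<in> sets ?\<nu>"
    then have [measurable]: "A \<in> sets ?L" by simp
    have "emeasure ?\<nu> A = (\<integral>\<^sup>+x. indicator A x \<partial>?\<nu>)" using A by simp
    also have "\<dots> = (\<integral>\<^sup>+w. indicator A (T w) \<partial>?L)" by (rule nn_integral_distr) measurable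
    also have "\<dots> = (\<integral>\<^sup>+x. indicator A x \<partial>?L)" by (rule main[symmetric]) measurable
    finally show "emeasure ?\<nu> A = emeasure ?L A" by simp
  qed simp
qed

lemma std_normal_isometry:
  assumes I: "finite I" and T: "T \<in> measurable (lprod I) (lprod I)"
    and add: "\<And>x y. T (fadd I x y) = fadd I (T x) (T y)"
    and surj: "\<And>y. y \<in> space (lprod I) \<Longrightarrow> \<exists>x\<in>space (lprod I). T x = y"
    and iso: "\<And>x. x \<in> space (lprod I) \<Longrightarrow> (\<Sum>i\<in>I. (T x i)\<^sup>2) = (\<Sum>i\<in>I. (x i)\<^sup>2)"
  shows "distr (gprod I) (gprod I) T = gprod I"
proof (rule measure_eqI)
  let ?L = "lprod I" and ?P = "gprod I"
  note [measurable] = T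
  have P: "?P = density ?L (gdens I)" by (rule PiM_std_normal_density[OF I])
  fix A assume "A \<in> sets (distr ?P ?P T)"
  then have A [measurable]: "A \<in> sets ?L" unfolding P by simp
  have "emeasure (distr ?P ?P T) A = emeasure ?P (T -` A \<inter> space ?L)"
    unfolding P by (subst emeasure_distr) auto
  also have "\<dots> = (\<integral>\<^sup>+w. gdens I w * indicator (T -` A \<inter> space ?L) w \<partial>?L)"
    unfolding P by (rule emeasure_density) auto
  also have "\<dots> = (\<integral>\<^sup>+w. gdens I (T w) * indicator A (T w) \<partial>?L)"
    using gdens_norm_cong[OF I iso] by (intro nn_integral_cong) (auto simp: indicator_def)
  also have "\<dots> = (\<integral>\<^sup>+x. gdens I x * indicator A x \<partial>distr ?L ?L T)"
    by (rule nn_integral_distr[symmetric]) measurable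
  also have "\<dots> = (\<integral>\<^sup>+x. gdens I x * indicator A x \<partial>?L)"
    using lprod_isometry[OF assms] by simp
  also have "\<dots> = emeasure ?P A" unfolding P by (rule emeasure_density[symmetric]) auto
  finally show "emeasure (distr ?P ?P T) A = emeasure ?P A" .
qed simp

section \<open>Eigenbasis coordinates\<close>

lemma conjugate_real_vec [simp]: "conjugate (v :: real vec) = v"
  by (intro eq_vecI) auto

section \<open>Orthogonal diagonalization of symmetric matrices\<close>

lemma orthonormal_extension:
  fixes v :: "real vec"
  assumes v: "v \<in> carrier_vec n" "v \<noteq> 0\<^sub>v n" and n: "0 < n"
  shows "\<exists>W \<in> carrier_mat n n. transpose_mat W * W = 1\<^sub>m n \<and> (\<exists>c. col W 0 = c \<cdot>\<^sub>v v)"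
proof -
  interpret cof_vec_space n "TYPE(real)" .
  define b where "b = basis_completion v"
  define ws where "ws = gram_schmidt n b"
  note bc = basis_completion[OF v, folded b_def]
  have len_b: "length b = n" and hdb: "hd b = v" using bc by auto
  obtain vs where bv: "b = v # vs" using len_b hdb n by (cases b) auto
  have ws: "set ws \<subseteq> carrier_vec n" "corthogonal ws" "length ws = n"
    using gram_schmidt_result[OF bc(2,4,5), of ws] len_b by (auto simp: ws_def)
  \<comment> \<open>Gram-Schmidt keeps its first vector, so after normalization the first column is
    a multiple of \<open>v\<close>.\<close>
  have hdws: "hd ws = v" unfolding ws_def bv using v(1) by (rule gram_schmidt_hd)
  have w: "ws ! i \<in> carrier_vec n" if "i < n" for i using ws that by auto
  have orth: "scalar_prod (ws ! i) (ws ! j) = 0 \<longleftrightarrow> i \<noteq> j" if "i < n" "j < n" for i j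
    using corthogonalD[OF ws(2), of i j] that ws(3) by simp
  have pos: "0 < scalar_prod (ws ! i) (ws ! i)" if "i < n" for i
  proof -
    have "0 \<le> scalar_prod (ws ! i) (ws ! i)" by (auto simp: scalar_prod_def intro!: sum_nonneg)
    then show ?thesis using orth[OF that that] by linarith
  qed
  define c where "c i = 1 / sqrt (scalar_prod (ws ! i) (ws ! i))" for i
  define W where "W = mat_of_cols n (map (\<lambda>i. c i \<cdot>\<^sub>v ws ! i) [0..<n])"
  have W: "W \<in> carrier_mat n n" unfolding W_def using mat_of_cols_carrier(1)[of n "map (\<lambda>i. c i \<cdot>\<^sub>v ws ! i) [0..<n]"] by simp
  have col: "col W i = c i \<cdot>\<^sub>v ws ! i" if "i < n" for i
    unfolding W_def using that w[OF that] by (subst col_mat_of_cols) auto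
  have "transpose_mat W * W = 1\<^sub>m n"
  proof (rule eq_matI)
    fix i j assume ij: "i < dim_row (1\<^sub>m n :: real mat)" "j < dim_col (1\<^sub>m n :: real mat)"
    then have ij': "i < n" "j < n" by auto
    have "(transpose_mat W * W) $$ (i, j) = scalar_prod (col W i) (col W j)"
      using W ij' by simp
    also have "\<dots> = c i * (c j * scalar_prod (ws ! i) (ws ! j))"
      unfolding col[OF ij'(1)] col[OF ij'(2)] using w[OF ij'(1)] w[OF ij'(2)]
      by (subst smult_scalar_prod_distrib[of _ n], simp_all)
    also have "\<dots> = (if i = j then 1 else 0)"
    proof (cases "i = j")
      case True
      have "c i * (c i * scalar_prod (ws ! i) (ws ! i)) = 1"
        using pos[OF ij'(1)] by (simp add: c_def)
      then show ?thesis using True by simp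
    next
      case False
      then show ?thesis using orth[OF ij'] by simp
    qed
    finally show "(transpose_mat W * W) $$ (i, j) = 1\<^sub>m n $$ (i, j)" using ij' by simp
  qed (use W in auto)
  moreover have "col W 0 = c 0 \<cdot>\<^sub>v v"
    using col[OF n] hdws hd_conv_nth[of ws] ws(3) n by fastforce
  ultimately show ?thesis using W by blast
qed

lemma char_poly_1x1: "char_poly (mat 1 1 (\<lambda>_. e)) = [:- e, 1:]"
  by (simp add: char_poly_defs det_def sign_def)

text \<open>One eigenvector is split off at a time: an orthonormal basis that starts with it turns
  the first column into a multiple of the unit vector, and symmetry does the same to the first row.
  The list \<open>es\<close> is prescribed so that the basis inherits the order of the eigenvalues,
  repetitions included.\<close>

lemma real_symmetric_diagonalization:
  fixes A :: "real mat"
  assumes "A \<in> carrier_mat n n" "transpose_mat A = A" "char_poly A = (\<Prod>e\<leftarrow>es. [:- e, 1:])"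
  shows "length es = n \<and> (\<exists>U \<in> carrier_mat n n. transpose_mat U * U = 1\<^sub>m n \<and>
    A * U = U * mat n n (\<lambda>(i, j). if i = j then es ! i else 0))"
  using assms
proof (induction es arbitrary: n A)
  case Nil
  then have "n = 0" using degree_monic_char_poly[of A n] by simp
  then show ?case using Nil by (auto intro!: bexI[of _ A] eq_matI)
next
  case (Cons e es)
  note A = Cons.prems(1)
  have cp: "char_poly A = [:- e, 1:] * (\<Prod>e\<leftarrow>es. [:- e, 1:])" using Cons.prems(3) by simp
  have n: "n \<noteq> 0"
  proof
    assume "n = 0"
    then have "degree (char_poly A) = 0" using degree_monic_char_poly[OF A] by simp
    moreover have "degree (char_poly A) = Suc (degree (\<Prod>e\<leftarrow>es. [:- e, 1:]))"
    proof -
      have "monic (\<Prod>e\<leftarrow>es. [:- e, 1:])" by (rule monic_prod_list) auto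
      then have "(\<Prod>e\<leftarrow>es. [:- e, 1:]) \<noteq> 0" by auto
      then show ?thesis unfolding cp by (subst degree_mult_eq) auto
    qed
    ultimately show False by simp
  qed
  define n1 where "n1 = n - 1"
  have nn: "n = 1 + n1" using n by (simp add: n1_def)
  have "eigenvalue A e" unfolding eigenvalue_root_char_poly[OF A] cp by simp
  then obtain v where "eigenvector A v e" unfolding eigenvalue_def by blast
  then have v: "v \<in> carrier_vec n" "v \<noteq> 0\<^sub>v n" "A *\<^sub>v v = e \<cdot>\<^sub>v v"
    using A by (auto simp: eigenvector_def)
  obtain W c where W: "W \<in> carrier_mat n n" and WtW: "transpose_mat W * W = 1\<^sub>m n" and W0: "col W 0 = c \<cdot>\<^sub>v v"
    using orthonormal_extension[OF v(1,2)] n by blast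
  let ?Wt = "transpose_mat W"
  have Wt: "?Wt \<in> carrier_mat n n" using W by simp
  have WWt: "W * ?Wt = 1\<^sub>m n" using mat_mult_left_right_inverse[OF Wt W WtW] .
  define A' where "A' = ?Wt * A * W"
  have A': "A' \<in> carrier_mat n n" unfolding A'_def using W Wt A by auto
  have At: "transpose_mat A' = A'"
    unfolding A'_def using W Wt A Cons.prems(2)
    by (simp add: transpose_mult[of _ n n _ n] assoc_mult_mat[of _ n n _ n _ n])
  have AW: "A * W = W * A'"
  proof -
    have "W * A' = (W * ?Wt) * (A * W)"
      unfolding A'_def using W Wt A by (simp add: assoc_mult_mat[of _ n n _ n _ n])
    then show ?thesis using WWt A W by simp
  qed
  have Av: "A *\<^sub>v col W 0 = e \<cdot>\<^sub>v col W 0"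
  proof -
    have "A *\<^sub>v (c \<cdot>\<^sub>v v) = c \<cdot>\<^sub>v (A *\<^sub>v v)" using A v by (intro mult_mat_vec) auto
    then show ?thesis using v by (simp add: W0 smult_smult_assoc mult.commute)
  qed
  have A'col: "A' $$ (i, 0) = (if i = 0 then e else 0)" if i: "i < n" for i
  proof -
    have "A' $$ (i, 0) = (?Wt * (A * W)) $$ (i, 0)"
      unfolding A'_def using W Wt A by (simp add: assoc_mult_mat[of _ n n _ n _ n])
    also have "\<dots> = scalar_prod (row ?Wt i) (col (A * W) 0)"
      using W A i n by (subst index_mult_mat) auto
    also have "col (A * W) 0 = A *\<^sub>v col W 0" using A W n by (intro col_mult2) auto
    also have "row ?Wt i = col W i" using W i by simp
    also have "scalar_prod (col W i) (A *\<^sub>v col W 0) = e * scalar_prod (col W i) (col W 0)"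
      unfolding Av using W by simp
    also have "scalar_prod (col W i) (col W 0) = (?Wt * W) $$ (i, 0)"
      using W i n by simp
    also have "\<dots> = (if i = 0 then 1 else 0)" unfolding WtW using i n by simp
    finally show ?thesis by simp
  qed
  have A'row: "A' $$ (0, j) = (if j = 0 then e else 0)" if "j < n" for j
  proof -
    have "A' $$ (0, j) = transpose_mat A' $$ (j, 0)" using A' that n by simp
    then show ?thesis unfolding At using A'col[OF that] by simp
  qed
  define A3 where "A3 = mat n1 n1 (\<lambda>(i, j). A' $$ (Suc i, Suc j))"
  have A3: "A3 \<in> carrier_mat n1 n1" by (simp add: A3_def)
  let ?E = "mat 1 1 (\<lambda>_. e)"
  have block: "A' = four_block_mat ?E (0\<^sub>m 1 n1) (0\<^sub>m n1 1) A3"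
    by (rule eq_matI) (use A' nn A'col A'row in \<open>auto simp: A3_def\<close>)
  have A3t: "transpose_mat A3 = A3"
  proof (rule eq_matI)
    fix i j assume "i < dim_row A3" "j < dim_col A3"
    then have ij: "i < n1" "j < n1" using A3 by auto
    have "A' $$ (Suc j, Suc i) = transpose_mat A' $$ (Suc i, Suc j)" using A' ij nn by simp
    then show "transpose_mat A3 $$ (i, j) = A3 $$ (i, j)" using ij At by (simp add: A3_def)
  qed (use A3 in auto)
  have "similar_mat A' A"
  proof -
    have "similar_mat_wit A' A ?Wt W"
      using W Wt A A' WtW WWt by (intro similar_mat_witI[of _ _ n]) (auto simp: A'_def)
    then show ?thesis unfolding similar_mat_def by blast
  qed
  then have "[:- e, 1:] * char_poly A3 = [:- e, 1:] * (\<Prod>e\<leftarrow>es. [:- e, 1:])"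
  proof -
    assume sim: "similar_mat A' A"
    have "char_poly A = char_poly A'" using char_poly_similar[OF sim] by (rule sym)
    also have "\<dots> = char_poly ?E * char_poly A3"
      unfolding block by (rule char_poly_four_block_zeros_col) (use A3 in auto)
    finally show ?thesis using cp unfolding char_poly_1x1 by (rule trans[OF sym])
  qed
  then have cp3: "char_poly A3 = (\<Prod>e\<leftarrow>es. [:- e, 1:])"
    by (metis mult_cancel_left pCons_eq_0_iff zero_neq_one)
  obtain U3 where U3: "length es = n1" "U3 \<in> carrier_mat n1 n1" "transpose_mat U3 * U3 = 1\<^sub>m n1"
      "A3 * U3 = U3 * mat n1 n1 (\<lambda>(i, j). if i = j then es ! i else 0)"
    using Cons.IH[OF A3 A3t cp3] by blast
  let ?D3 = "mat n1 n1 (\<lambda>(i, j). if i = j then es ! i else 0)"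
  let ?D = "mat n n (\<lambda>(i, j). if i = j then (e # es) ! i else 0)"
  define V where "V = four_block_mat (1\<^sub>m 1) (0\<^sub>m 1 n1) (0\<^sub>m n1 1) U3"
  have V: "V \<in> carrier_mat n n" unfolding V_def nn using U3(2) by auto
  have D: "?D = four_block_mat ?E (0\<^sub>m 1 n1) (0\<^sub>m n1 1) ?D3"
    by (rule eq_matI) (auto simp: nn nth_Cons')
  have Dc: "?D \<in> carrier_mat n n" by simp
  have VtV: "transpose_mat V * V = 1\<^sub>m n"
  proof -
    have "transpose_mat V = four_block_mat (1\<^sub>m 1) (0\<^sub>m 1 n1) (0\<^sub>m n1 1) (transpose_mat U3)"
      unfolding V_def using U3(2) by (subst transpose_four_block_mat[of _ 1 1 _ n1 _ n1]) auto
    then have "transpose_mat V * V = four_block_mat (1\<^sub>m 1) (0\<^sub>m 1 n1) (0\<^sub>m n1 1) (1\<^sub>m n1)"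
      unfolding V_def using U3 by (simp add: mult_four_block_mat[of _ 1 1 _ n1 _ n1 _ _ 1 _ n1])
    then show ?thesis by (simp add: nn)
  qed
  have A'V: "A' * V = V * ?D"
    unfolding block V_def D using U3 A3
    by (simp add: mult_four_block_mat[of _ 1 1 _ n1 _ n1 _ _ 1 _ n1])
  define U where "U = W * V"
  have U: "U \<in> carrier_mat n n" unfolding U_def using W V by auto
  have "transpose_mat U * U = transpose_mat V * ((?Wt * W) * V)"
    unfolding U_def using W V Wt
    by (simp add: transpose_mult[of _ n n _ n] assoc_mult_mat[of _ n n _ n _ n])
  also have "\<dots> = 1\<^sub>m n" unfolding WtW using V VtV by simp
  finally have "transpose_mat U * U = 1\<^sub>m n" .
  moreover have "A * U = U * ?D"
  proof -
    have "A * U = (A * W) * V" unfolding U_def using A W V by (intro assoc_mult_mat[symmetric]) auto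
    also have "\<dots> = W * (A' * V)" unfolding AW using W V A' by (intro assoc_mult_mat) auto
    also have "\<dots> = U * ?D" unfolding A'V U_def using W V Dc by (intro assoc_mult_mat[symmetric]) auto
    finally show ?thesis .
  qed
  ultimately show ?case using U U3(1) nn by auto
qed

lemma sym_pos_def_eigenbasis:
  assumes A: "sym_pos_def d A" and lam: "eigenvalues_decreasing d A lam"
  obtains U where "U \<in> carrier_mat d d" "transpose_mat U * U = 1\<^sub>m d" "U * transpose_mat U = 1\<^sub>m d"
    "\<And>i. i < d \<Longrightarrow> A *\<^sub>v col U i = lam (Suc i) \<cdot>\<^sub>v col U i" "\<And>i. i < d \<Longrightarrow> 0 < lam (Suc i)"
proof -
  have Ac: "A \<in> carrier_mat d d" and At: "transpose_mat A = A" using A by (auto simp: sym_pos_def_def)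
  define es where "es = map (\<lambda>i. lam (Suc i)) [0..<d]"
  have "char_poly A = (\<Prod>e\<leftarrow>es. [:- e, 1:])"
  proof -
    have "char_poly A = (\<Prod>i = 1..d. [:- lam i, 1:])" using lam by (simp add: eigenvalues_decreasing_def)
    also have "\<dots> = (\<Prod>i = 0..<d. [:- lam (Suc i), 1:])"
      by (rule prod.reindex_bij_witness[of _ Suc "\<lambda>i. i - 1"]) auto
    also have "\<dots> = (\<Prod>e\<leftarrow>es. [:- e, 1:])"
      by (simp add: es_def prod.distinct_set_conv_list[symmetric] comp_def)
    finally show ?thesis .
  qed
  from real_symmetric_diagonalization[OF Ac At this] obtain U where U: "U \<in> carrier_mat d d"
    "transpose_mat U * U = 1\<^sub>m d" and AU: "A * U = U * mat d d (\<lambda>(i, j). if i = j then es ! i else 0)" by blast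
  have UUt: "U * transpose_mat U = 1\<^sub>m d" using mat_mult_left_right_inverse[of "transpose_mat U" d U] U by simp
  have ev: "A *\<^sub>v col U i = lam (Suc i) \<cdot>\<^sub>v col U i" if i: "i < d" for i
  proof -
    have "A *\<^sub>v col U i = col (A * U) i" using Ac U i by (intro col_mult2[symmetric]) auto
    also have "\<dots> = lam (Suc i) \<cdot>\<^sub>v col U i"
    proof (rule eq_vecI)
      fix k assume "k < dim_vec (lam (Suc i) \<cdot>\<^sub>v col U i)"
      then have k: "k < d" using U by simp
      have "vec_index (col (A * U) i) k = (\<Sum>j = 0..<d. U $$ (k, j) * (if j = i then es ! j else 0))"
        unfolding AU using U k i by (auto simp: scalar_prod_def intro!: sum.cong)
      also have "\<dots> = (\<Sum>j = 0..<d. if j = i then U $$ (k, j) * es ! j else 0)"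
        by (rule sum.cong) auto
      also have "\<dots> = U $$ (k, i) * es ! i" using i by simp
      finally show "vec_index (col (A * U) i) k = vec_index (lam (Suc i) \<cdot>\<^sub>v col U i) k"
        using U k i by (simp add: es_def)
    qed (use Ac U in auto)
    finally show ?thesis .
  qed
  have pos: "0 < lam (Suc i)" if i: "i < d" for i
  proof -
    have c: "col U i \<in> carrier_vec d" using U by (auto simp: carrier_dim_vec)
    have n1: "scalar_prod (col U i) (col U i) = 1"
    proof -
      have "scalar_prod (col U i) (col U i) = (transpose_mat U * U) $$ (i, i)" using U(1) i by simp
      also have "\<dots> = 1" unfolding U(2) using i by simp
      finally show ?thesis .
    qed
    then have "col U i \<noteq> 0\<^sub>v d" by auto
    then have "0 < scalar_prod (col U i) (A *\<^sub>v col U i)" using A c by (auto simp: sym_pos_def_def)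
    then show ?thesis using ev[OF i] n1 c by simp
  qed
  show thesis using that[OF U UUt ev pos] .
qed

section \<open>From matrices and spans to coordinates\<close>

lemma kgen_shift_mem:
  "kgen (\<lambda>i. x i + \<mu>) B (j, a) \<in> comb (kgen x B) ({j} \<times> {..a})"
proof (induction a)
  case 0
  have "kgen (\<lambda>i. x i + \<mu>) B (j, 0) = kgen x B (j, 0)" by (auto simp: kgen_def)
  then show ?case using comb_gen[of "{j} \<times> {..0}" "(j, 0)" "kgen x B"] by simp
next
  case (Suc a)
  have 1: "(\<lambda>i. x i * kgen (\<lambda>i. x i + \<mu>) B (j, a) i) \<in> comb (kgen x B) ({j} \<times> {..Suc a})"
    using Suc by (rule comb_kgen_shift[rotated]) auto
  have "comb (kgen x B) ({j} \<times> {..a}) \<subseteq> comb (kgen x B) ({j} \<times> {..Suc a})"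
    by (rule comb_mono) auto
  then have 2: "kgen (\<lambda>i. x i + \<mu>) B (j, a) \<in> comb (kgen x B) ({j} \<times> {..Suc a})" using Suc by blast
  have "kgen (\<lambda>i. x i + \<mu>) B (j, Suc a)
     = (\<lambda>i. 1 * (x i * kgen (\<lambda>i. x i + \<mu>) B (j, a) i) + \<mu> * kgen (\<lambda>i. x i + \<mu>) B (j, a) i)"
    by (auto simp: kgen_def algebra_simps)
  then show ?case using comb_lin[OF 1 2, of 1 \<mu>] by simp
qed

lemma comb_kgen_shift_subset:
  "comb (kgen (\<lambda>i. x i + \<mu>) B) (J \<times> {..<t}) \<subseteq> comb (kgen x B) (J \<times> {..<t})" if "finite J"
proof (rule comb_subset)
  fix k assume k: "k \<in> J \<times> {..<t}"
  have "comb (kgen x B) ({fst k} \<times> {..snd k}) \<subseteq> comb (kgen x B) (J \<times> {..<t})"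
    using k that by (intro comb_mono) auto
  then show "kgen (\<lambda>i. x i + \<mu>) B k \<in> comb (kgen x B) (J \<times> {..<t})"
    using kgen_shift_mem[of x \<mu> B "fst k" "snd k"] by auto
qed (use that in simp)

text \<open>Shift invariance of Krylov spaces; the reverse inclusion is the first one with shift
  \<open>- \<mu>\<close>. Because of it one fixed space serves all \<mu>.\<close>

lemma comb_kgen_shift_eq:
  assumes "finite J"
  shows "comb (kgen (\<lambda>i. x i + \<mu>) B) (J \<times> {..<t}) = comb (kgen x B) (J \<times> {..<t})"
  using comb_kgen_shift_subset[OF assms, of x \<mu> B t]
    comb_kgen_shift_subset[OF assms, of "\<lambda>i. x i + \<mu>" "- \<mu>" B t] by auto

definition eco :: "real mat \<Rightarrow> real vec \<Rightarrow> nat \<Rightarrow> real" where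
  "eco U x i = scalar_prod (col U i) x"

text \<open>Eigenvalues are numbered from 0: in the final instance \<open>lm i\<close> is
  \<open>lam (Suc i)\<close>, so \<lambda>_(r+1) appears as \<open>lm r\<close>.\<close>

locale eigenbasis =
  fixes d :: nat and A U :: "real mat" and lm :: "nat \<Rightarrow> real"
  assumes A: "A \<in> carrier_mat d d" and A_sym: "transpose_mat A = A"
    and U: "U \<in> carrier_mat d d" and UtU: "transpose_mat U * U = 1\<^sub>m d" and UUt: "U * transpose_mat U = 1\<^sub>m d"
    and ev: "\<And>i. i < d \<Longrightarrow> A *\<^sub>v col U i = lm i \<cdot>\<^sub>v col U i" and pos: "\<And>i. i < d \<Longrightarrow> 0 < lm i"
begin

lemma col_carrier [simp]: "col U i \<in> carrier_vec d"
  using U by (auto simp: carrier_dim_vec)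

lemma eco_mult: "x \<in> carrier_vec d \<Longrightarrow> i < d \<Longrightarrow> eco U x i = vec_index (transpose_mat U *\<^sub>v x) i"
  using U by (simp add: eco_def)

lemma scalar_prod_eco:
  assumes "x \<in> carrier_vec d" "y \<in> carrier_vec d"
  shows "scalar_prod x y = (\<Sum>i<d. eco U x i * eco U y i)"
proof -
  let ?Ut = "transpose_mat U"
  have Ut: "?Ut \<in> carrier_mat d d" using U by simp
  have "scalar_prod x y = scalar_prod x (U *\<^sub>v (?Ut *\<^sub>v y))"
    using assms U Ut UUt by (simp add: assoc_mult_mat_vec[symmetric, of _ d d _ d])
  also have "\<dots> = scalar_prod (?Ut *\<^sub>v x) (?Ut *\<^sub>v y)"
    using assms U Ut transpose_vec_mult_scalar[of U d d "?Ut *\<^sub>v y" x] by simp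
  also have "\<dots> = (\<Sum>i<d. eco U x i * eco U y i)"
    using assms Ut by (simp add: scalar_prod_def[of "?Ut *\<^sub>v x"] eco_mult atLeast0LessThan)
  finally show ?thesis .
qed

lemma eco_inj:
  assumes "x \<in> carrier_vec d" "y \<in> carrier_vec d" "\<And>i. i < d \<Longrightarrow> eco U x i = eco U y i"
  shows "x = y"
proof -
  let ?Ut = "transpose_mat U"
  have Ut: "?Ut \<in> carrier_mat d d" using U by simp
  have "?Ut *\<^sub>v x = ?Ut *\<^sub>v y"
  proof (rule eq_vecI)
    fix i assume "i < dim_vec (?Ut *\<^sub>v y)"
    then have "i < d" using Ut by simp
    then show "vec_index (?Ut *\<^sub>v x) i = vec_index (?Ut *\<^sub>v y) i"
      using assms eco_mult[of x i] eco_mult[of y i] by metis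
  qed simp
  then have "U *\<^sub>v (?Ut *\<^sub>v x) = U *\<^sub>v (?Ut *\<^sub>v y)" by simp
  then show ?thesis using assms U Ut UUt by (simp add: assoc_mult_mat_vec[symmetric, of _ d d _ d])
qed

lemma eco_surj: "\<exists>x\<in>carrier_vec d. \<forall>i<d. eco U x i = f i"
proof -
  let ?Ut = "transpose_mat U"
  have Ut: "?Ut \<in> carrier_mat d d" using U by simp
  define x where "x = U *\<^sub>v vec d f"
  have x: "x \<in> carrier_vec d" using U by (simp add: x_def)
  have "?Ut *\<^sub>v x = vec d f"
    unfolding x_def using U Ut UtU by (simp add: assoc_mult_mat_vec[symmetric, of _ d d _ d])
  then have "\<forall>i<d. eco U x i = f i" using x by (simp add: eco_mult)
  then show ?thesis using x by blast
qed

lemma eco_add: "x \<in> carrier_vec d \<Longrightarrow> y \<in> carrier_vec d \<Longrightarrow> eco U (x + y) i = eco U x i + eco U y i"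
  unfolding eco_def by (rule scalar_prod_add_distrib) auto

lemma eco_diff: "x \<in> carrier_vec d \<Longrightarrow> y \<in> carrier_vec d \<Longrightarrow> eco U (x - y) i = eco U x i - eco U y i"
  unfolding eco_def by (rule scalar_prod_minus_distrib) auto

lemma eco_smult: "x \<in> carrier_vec d \<Longrightarrow> eco U (c \<cdot>\<^sub>v x) i = c * eco U x i"
  unfolding eco_def by (rule scalar_prod_smult_distrib) auto

lemma shifted_carrier [simp]: "shifted A \<mu> \<in> carrier_mat d d"
  using A by (simp add: shifted_def)

lemma dim_row_A: "dim_row A = d" using A by simp

lemma shifted_mult:
  assumes x: "x \<in> carrier_vec d"
  shows "shifted A \<mu> *\<^sub>v x = A *\<^sub>v x + \<mu> \<cdot>\<^sub>v x"
proof -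
  have "shifted A \<mu> *\<^sub>v x = A *\<^sub>v x + (\<mu> \<cdot>\<^sub>m 1\<^sub>m d) *\<^sub>v x"
    unfolding shifted_def dim_row_A using A x by (intro add_mult_distrib_mat_vec) auto
  also have "(\<mu> \<cdot>\<^sub>m 1\<^sub>m d) *\<^sub>v x = \<mu> \<cdot>\<^sub>v x"
    using x by (intro eq_vecI) auto
  finally show ?thesis .
qed

lemma eco_shifted:
  assumes x: "x \<in> carrier_vec d" and i: "i < d"
  shows "eco U (shifted A \<mu> *\<^sub>v x) i = (lm i + \<mu>) * eco U x i"
proof -
  have "scalar_prod (col U i) (A *\<^sub>v x) = scalar_prod (A *\<^sub>v col U i) x"
    using transpose_vec_mult_scalar[OF A x col_carrier[of i]] A_sym by simp
  then have "eco U (A *\<^sub>v x) i = lm i * eco U x i"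
    using smult_scalar_prod_distrib[OF col_carrier[of i] x, of "lm i"] by (simp add: eco_def ev[OF i])
  then show ?thesis
    unfolding shifted_mult[OF x] using A x
    by (subst eco_add) (auto simp: eco_smult algebra_simps)
qed

lemma eco_pow:
  assumes x: "x \<in> carrier_vec d" and i: "i < d"
  shows "eco U ((shifted A \<mu> ^\<^sub>m a) *\<^sub>v x) i = (lm i + \<mu>) ^ a * eco U x i"
  using x
proof (induction a arbitrary: x)
  case 0
  then show ?case using A by (simp add: shifted_def)
next
  case (Suc a)
  have c: "shifted A \<mu> *\<^sub>v x \<in> carrier_vec d" using Suc.prems by (intro mult_mat_vec_carrier) auto
  have "(shifted A \<mu> ^\<^sub>m Suc a) *\<^sub>v x = (shifted A \<mu> ^\<^sub>m a) *\<^sub>v (shifted A \<mu> *\<^sub>v x)"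
    using Suc.prems by (simp add: assoc_mult_mat_vec[of _ d d _ d])
  then show ?case using Suc.IH[OF c] eco_shifted[OF Suc.prems i] by simp
qed

lemma norm_wrt_eco:
  assumes x: "x \<in> carrier_vec d"
  shows "norm_wrt (shifted A \<mu>) x = sqrt (\<Sum>i<d. (lm i + \<mu>) * (eco U x i)\<^sup>2)"
proof -
  have c: "shifted A \<mu> *\<^sub>v x \<in> carrier_vec d" using x by (intro mult_mat_vec_carrier) auto
  have "scalar_prod x (shifted A \<mu> *\<^sub>v x) = (\<Sum>i<d. eco U x i * eco U (shifted A \<mu> *\<^sub>v x) i)"
    by (rule scalar_prod_eco[OF x c])
  also have "\<dots> = (\<Sum>i<d. (lm i + \<mu>) * (eco U x i)\<^sup>2)"
    by (rule sum.cong) (auto simp: eco_shifted[OF x] power2_eq_square)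
  finally show ?thesis by (simp add: norm_wrt_def)
qed

lemma inv_shifted:
  assumes \<mu>: "0 \<le> \<mu>" and b: "b \<in> carrier_vec d"
  shows "inv_mat (shifted A \<mu>) *\<^sub>v b \<in> carrier_vec d"
    and "i < d \<Longrightarrow> eco U (inv_mat (shifted A \<mu>) *\<^sub>v b) i = eco U b i / (lm i + \<mu>)"
proof -
  have p: "0 < lm i + \<mu>" if "i < d" for i using pos[OF that] \<mu> by simp
  \<comment> \<open>\<open>inv_mat\<close> has a meaning only if \<open>mat_inverse\<close> returns
    a matrix, so invertibility comes first: a kernel vector would have only zero
    eigencoordinates.\<close>
  have "det (shifted A \<mu>) \<noteq> 0"
  proof
    assume "det (shifted A \<mu>) = 0"
    then obtain v where v: "v \<in> carrier_vec d" "v \<noteq> 0\<^sub>v d" "shifted A \<mu> *\<^sub>v v = 0\<^sub>v d"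
      using det_0_iff_vec_prod_zero[of "shifted A \<mu>" d] by auto
    have "v = 0\<^sub>v d"
    proof (rule eco_inj)
      fix i assume i: "i < d"
      have "(lm i + \<mu>) * eco U v i = 0"
        using eco_shifted[OF v(1) i, of \<mu>] v(3) by (simp add: eco_def)
      then show "eco U v i = eco U (0\<^sub>v d) i" using p[OF i] by (simp add: eco_def)
    qed (use v in auto)
    then show False using v by simp
  qed
  then have "shifted A \<mu> \<in> Units (ring_mat TYPE(real) d ())"
    by (intro det_non_zero_imp_unit) auto
  then obtain B where B: "mat_inverse (shifted A \<mu>) = Some B"
    using mat_inverse(1)[of "shifted A \<mu>" d "()"] by (cases "mat_inverse (shifted A \<mu>)") auto
  then have B': "shifted A \<mu> * B = 1\<^sub>m d" "B \<in> carrier_mat d d"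
    using mat_inverse(2)[of "shifted A \<mu>" d B] by auto
  have inv: "inv_mat (shifted A \<mu>) = B" by (simp add: inv_mat_def B)
  show c: "inv_mat (shifted A \<mu>) *\<^sub>v b \<in> carrier_vec d" unfolding inv using B'(2) b by simp
  have "shifted A \<mu> *\<^sub>v (B *\<^sub>v b) = b"
    using B' b by (simp add: assoc_mult_mat_vec[symmetric, of _ d d _ d])
  then show "eco U (inv_mat (shifted A \<mu>) *\<^sub>v b) i = eco U b i / (lm i + \<mu>)" if "i < d"
    using eco_shifted[OF c that, of \<mu>] p[OF that] unfolding inv by (simp add: field_simps)
qed

definition ecomb :: "(nat \<times> nat \<Rightarrow> nat \<Rightarrow> real) \<Rightarrow> (nat \<times> nat) set \<Rightarrow> real vec set" where
  "ecomb F I = {x \<in> carrier_vec d. \<exists>f\<in>comb F I. \<forall>i<d. eco U x i = f i}"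

text \<open>Trades the module span for explicit coefficients. The coordinate set is a submodule
  containing the generators; conversely a combination is rebuilt inside the span term by term and
  recognized by its coordinates.\<close>

lemma krylov_eq:
  assumes v: "v \<in> carrier_vec d" and Bj: "\<And>i. i < d \<Longrightarrow> B j i = eco U v i"
  shows "krylov t (shifted A \<mu>) v = ecomb (kgen (\<lambda>i. lm i + \<mu>) B) ({j} \<times> {..<t})"
proof -
  interpret vec_space "TYPE(real)" d .
  let ?M = "shifted A \<mu>" and ?F = "kgen (\<lambda>i. lm i + \<mu>) B" and ?I = "{j} \<times> {..<t}"
  let ?S = "{(?M ^\<^sub>m i) *\<^sub>v v | i. i < t}"
  have dM: "dim_row ?M = d" using carrier_matD(1)[OF shifted_carrier] .
  have pc: "(?M ^\<^sub>m a) *\<^sub>v v \<in> carrier_vec d" for a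
    by (rule mult_mat_vec_carrier[OF _ v]) (rule pow_carrier_mat, simp)
  have S: "?S \<subseteq> carrier_vec d" using pc by auto
  have k: "krylov t ?M v = span ?S" unfolding krylov_def dM ..
  have gen: "(?M ^\<^sub>m a) *\<^sub>v v \<in> ecomb ?F ?I" if "a < t" for a
    unfolding ecomb_def using pc that
    by (auto simp: eco_pow[OF v] kgen_def Bj intro!: bexI[OF _ comb_gen[of ?I "(j, a)" ?F]])
  have sub: "submodule class_ring (ecomb ?F ?I) V"
  proof (rule submodule.intro)
    show "module class_ring V" by (rule module_axioms)
    show "ecomb ?F ?I \<subseteq> carrier V" by (auto simp: ecomb_def)
    show "\<zero>\<^bsub>V\<^esub> \<in> ecomb ?F ?I"
      by (auto simp: ecomb_def eco_def intro!: bexI[OF _ comb_zero])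
    show "x \<oplus>\<^bsub>V\<^esub> y \<in> ecomb ?F ?I" if xy: "x \<in> ecomb ?F ?I" "y \<in> ecomb ?F ?I" for x y
    proof -
      obtain f g where "x \<in> carrier_vec d" "y \<in> carrier_vec d" "f \<in> comb ?F ?I" "g \<in> comb ?F ?I"
        "\<forall>i<d. eco U x i = f i" "\<forall>i<d. eco U y i = g i" using xy by (auto simp: ecomb_def)
      then show ?thesis by (auto simp: ecomb_def eco_add intro!: bexI[OF _ comb_add])
    qed
    show "c \<odot>\<^bsub>V\<^esub> x \<in> ecomb ?F ?I" if xI: "x \<in> ecomb ?F ?I" for c x
    proof -
      obtain f where "x \<in> carrier_vec d" "f \<in> comb ?F ?I" "\<forall>i<d. eco U x i = f i"
        using xI by (auto simp: ecomb_def)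
      then show ?thesis by (auto simp: ecomb_def eco_smult intro!: bexI[OF _ comb_scale])
    qed
  qed
  have "span ?S \<subseteq> ecomb ?F ?I" using gen by (intro span_is_subset[OF _ sub]) auto
  moreover have "ecomb ?F ?I \<subseteq> span ?S"
  proof
    fix x assume "x \<in> ecomb ?F ?I"
    then obtain c where x: "x \<in> carrier_vec d" and c: "\<And>i. i < d \<Longrightarrow> eco U x i = (\<Sum>k\<in>?I. c k * ?F k i)"
      by (auto simp: ecomb_def comb_def)
    have "\<exists>y\<in>span ?S. \<forall>i<d. eco U y i = (\<Sum>k\<in>K. c k * ?F k i)" if "finite K" "K \<subseteq> ?I" for K
      using that
    proof (induction K rule: finite_induct)
      case empty
      have "0\<^sub>v d \<in> span ?S" using span_zero[of ?S] by simp
      then show ?case by (auto simp: eco_def intro!: bexI[of _ "0\<^sub>v d"])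
    next
      case (insert k K)
      then obtain y where y: "y \<in> span ?S" "\<forall>i<d. eco U y i = (\<Sum>k\<in>K. c k * ?F k i)" by auto
      obtain a where ka: "k = (j, a)" "a < t" using insert.prems by auto
      let ?g = "(?M ^\<^sub>m a) *\<^sub>v v"
      have g: "?g \<in> span ?S" using in_own_span[of ?S] S ka(2) by auto
      have cg: "c k \<cdot>\<^sub>v ?g \<in> span ?S" using smult_in_span[OF S g] .
      have yc: "y \<in> carrier_vec d" and cgc: "c k \<cdot>\<^sub>v ?g \<in> carrier_vec d"
        using span_closed[of ?S y] S y(1) pc by auto
      have "c k \<cdot>\<^sub>v ?g + y \<in> span ?S" using span_add1[of ?S "c k \<cdot>\<^sub>v ?g" y] S cg y(1) by simp
      moreover have "eco U (c k \<cdot>\<^sub>v ?g + y) i = (\<Sum>k\<in>insert k K. c k * ?F k i)" if "i < d" for i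
      proof -
        have "eco U (c k \<cdot>\<^sub>v ?g + y) i = c k * eco U ?g i + eco U y i"
          by (simp only: eco_add[OF cgc yc] eco_smult[OF pc])
        moreover have "eco U ?g i = ?F k i" using that by (simp add: eco_pow[OF v that] ka(1) kgen_def Bj)
        ultimately show ?thesis using insert.hyps y(2) that by simp
      qed
      ultimately show ?case by blast
    qed
    from this[of ?I] obtain y where y: "y \<in> span ?S" "\<forall>i<d. eco U y i = (\<Sum>k\<in>?I. c k * ?F k i)" by auto
    have "y \<in> carrier_vec d" using span_closed[of ?S y] S y(1) by auto
    then have "x = y" using x c y(2) by (intro eco_inj) auto
    then show "x \<in> span ?S" using y(1) by simp
  qed
  ultimately show ?thesis unfolding k by blast
qed

lemma eco_finsum:
  assumes "finite J" "\<And>j. j \<in> J \<Longrightarrow> w j \<in> carrier_vec d"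
  shows "finsum_vec TYPE(real) d w J \<in> carrier_vec d"
    and "eco U (finsum_vec TYPE(real) d w J) i = (\<Sum>j\<in>J. eco U (w j) i)"
proof -
  show c: "finsum_vec TYPE(real) d w J \<in> carrier_vec d" using assms(2) by (intro finsum_vec_closed) auto
  have dw: "dim_vec (w j) = d" if "j \<in> J" for j using assms(2)[OF that] by simp
  have "eco U (finsum_vec TYPE(real) d w J) i
      = (\<Sum>k<d. vec_index (col U i) k * (\<Sum>j\<in>J. vec_index (w j) k))"
    unfolding eco_def scalar_prod_def using c assms
    by (auto simp: atLeast0LessThan index_finsum_vec intro!: sum.cong)
  also have "\<dots> = (\<Sum>j\<in>J. \<Sum>k<d. vec_index (col U i) k * vec_index (w j) k)"
    unfolding sum_distrib_left by (rule sum.swap)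
  also have "\<dots> = (\<Sum>j\<in>J. eco U (w j) i)"
    using dw by (auto simp: eco_def scalar_prod_def atLeast0LessThan intro!: sum.cong)
  finally show "eco U (finsum_vec TYPE(real) d w J) i = (\<Sum>j\<in>J. eco U (w j) i)" .
qed

text \<open>The sum of the column spaces becomes one combination over pairs of column and power, and
  shift invariance removes \<mu> from the generators.\<close>

lemma block_krylov_eq:
  assumes V: "V \<in> carrier_mat d m" and B: "\<And>i j. i < d \<Longrightarrow> j < m \<Longrightarrow> B j i = eco U (col V j) i"
  shows "block_krylov t (shifted A \<mu>) V = ecomb (kgen lm B) ({..<m} \<times> {..<t})"
proof -
  let ?F = "kgen (\<lambda>i. lm i + \<mu>) B"
  have dM: "dim_row (shifted A \<mu>) = d" using carrier_matD(1)[OF shifted_carrier] .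
  have dV: "dim_col V = m" using V by simp
  have kr: "krylov t (shifted A \<mu>) (col V j) = ecomb ?F ({j} \<times> {..<t})" if "j < m" for j
    using V that B by (intro krylov_eq) (auto simp: carrier_dim_vec)
  have eq: "comb ?F ({..<m} \<times> {..<t}) = comb (kgen lm B) ({..<m} \<times> {..<t})"
    by (rule comb_kgen_shift_eq) simp
  have "block_krylov t (shifted A \<mu>) V = ecomb ?F ({..<m} \<times> {..<t})"
  proof (rule subset_antisym; rule subsetI)
    fix x assume "x \<in> block_krylov t (shifted A \<mu>) V"
    then obtain w where x: "x = finsum_vec TYPE(real) d w {..<m}"
      and w: "\<And>j. j < m \<Longrightarrow> w j \<in> ecomb ?F ({j} \<times> {..<t})"
      unfolding block_krylov_def dM dV using kr by auto
    have wc: "\<And>j. j \<in> {..<m} \<Longrightarrow> w j \<in> carrier_vec d" using w by (auto simp: ecomb_def)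
    have "\<forall>j\<in>{..<m}. \<exists>f. f \<in> comb ?F ({j} \<times> {..<t}) \<and> (\<forall>i<d. eco U (w j) i = f i)"
      using w by (auto simp: ecomb_def)
    then obtain f where f: "\<And>j. j < m \<Longrightarrow> f j \<in> comb ?F ({j} \<times> {..<t})"
      "\<And>i j. j < m \<Longrightarrow> i < d \<Longrightarrow> eco U (w j) i = f j i"
      unfolding bchoice_iff by (metis lessThan_iff)
    have "(\<lambda>i. \<Sum>j\<in>{..<m}. 1 * f j i) \<in> comb ?F ({..<m} \<times> {..<t})"
    proof (rule comb_sum)
      fix j assume j: "j \<in> {..<m}"
      then have "comb ?F ({j} \<times> {..<t}) \<subseteq> comb ?F ({..<m} \<times> {..<t})" by (intro comb_mono) auto
      then show "f j \<in> comb ?F ({..<m} \<times> {..<t})" using f(1) j by auto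
    qed simp
    then show "x \<in> ecomb ?F ({..<m} \<times> {..<t})"
      unfolding x ecomb_def
    proof (intro CollectI conjI bexI allI impI)
      show "finsum_vec TYPE(real) d w {..<m} \<in> carrier_vec d" by (rule eco_finsum(1)[OF finite_lessThan wc])
      fix i assume "i < d"
      then show "eco U (finsum_vec TYPE(real) d w {..<m}) i = (\<Sum>j\<in>{..<m}. 1 * f j i)"
        using eco_finsum(2)[of "{..<m}" w i, OF finite_lessThan wc] f(2) by simp
    qed
  next
    fix x assume "x \<in> ecomb ?F ({..<m} \<times> {..<t})"
    then obtain c where xc: "x \<in> carrier_vec d"
      and c: "\<And>i. i < d \<Longrightarrow> eco U x i = (\<Sum>k\<in>{..<m} \<times> {..<t}. c k * ?F k i)"
      by (auto simp: ecomb_def comb_def)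
    define f where "f j = (\<lambda>i. \<Sum>k\<in>{j} \<times> {..<t}. c k * ?F k i)" for j
    have "\<forall>j. \<exists>x. x \<in> carrier_vec d \<and> (\<forall>i<d. eco U x i = f j i)" using eco_surj by blast
    then obtain w where w: "\<And>j. w j \<in> carrier_vec d" "\<And>i j. i < d \<Longrightarrow> eco U (w j) i = f j i"
      by metis
    have wk: "w j \<in> krylov t (shifted A \<mu>) (col V j)" if "j < m" for j
      unfolding kr[OF that] ecomb_def using w combI[where F = ?F and I = "{j} \<times> {..<t}" and c = c]
      by (auto simp: f_def)
    have "x = finsum_vec TYPE(real) d w {..<m}"
    proof (rule eco_inj[OF xc])
      show "finsum_vec TYPE(real) d w {..<m} \<in> carrier_vec d" using w by (intro eco_finsum) auto
      fix i assume i: "i < d"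
      have "eco U (finsum_vec TYPE(real) d w {..<m}) i = (\<Sum>j<m. f j i)"
        using eco_finsum(2)[of "{..<m}" w i] w i by simp
      also have "\<dots> = (\<Sum>j<m. \<Sum>a<t. c (j, a) * ?F (j, a) i)"
        unfolding f_def
        by (intro sum.cong refl sum.reindex_bij_witness[of _ "\<lambda>a. (_, a)" snd]) auto
      also have "\<dots> = eco U x i"
        unfolding c[OF i] by (simp add: sum.cartesian_product case_prod_unfold)
      finally show "eco U x i = eco U (finsum_vec TYPE(real) d w {..<m}) i" by simp
    qed
    then show "x \<in> block_krylov t (shifted A \<mu>) V"
      unfolding block_krylov_def dM dV using wk by auto
  qed
  then show ?thesis unfolding ecomb_def eq .
qed

text \<open>The squared energy error of the coordinates \<open>f\<close>; together with
  \<open>sol2\<close>, the squared energy norm of the solution, it represents the square of the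
  quotient in the theorem.\<close>

definition err2 :: "(nat \<Rightarrow> real) \<Rightarrow> real \<Rightarrow> (nat \<Rightarrow> real) \<Rightarrow> real" where
  "err2 \<beta> \<mu> f = (\<Sum>i<d. (lm i + \<mu>) * (f i - \<beta> i / (lm i + \<mu>))\<^sup>2)"

definition sol2 :: "(nat \<Rightarrow> real) \<Rightarrow> real \<Rightarrow> real" where
  "sol2 \<beta> \<mu> = (\<Sum>i<d. (\<beta> i)\<^sup>2 / (lm i + \<mu>))"

lemma err2_minimizer:
  assumes \<mu>: "0 \<le> \<mu>" and I: "finite I"
  shows "\<exists>f0\<in>comb F I. \<forall>f\<in>comb F I. err2 \<beta> \<mu> f0 \<le> err2 \<beta> \<mu> f"
proof -
  have w: "0 < lm i + \<mu>" if "i < d" for i using pos[OF that] \<mu> by simp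
  have err2_wip: "err2 \<beta> \<mu> f = wip d (\<lambda>i. lm i + \<mu>) (\<lambda>i. \<beta> i / (lm i + \<mu>) - f i) (\<lambda>i. \<beta> i / (lm i + \<mu>) - f i)" for f
    unfolding err2_def wip_def
    by (intro sum.cong refl) (simp only: power2_commute[of "f _"], simp add: power2_eq_square mult.assoc)
  from projection_exists[OF I, of d "\<lambda>i. lm i + \<mu>" F "\<lambda>i. \<beta> i / (lm i + \<mu>)", OF w]
  obtain f0 where f0: "f0 \<in> comb F I" "\<forall>u\<in>comb F I. wip d (\<lambda>i. lm i + \<mu>) (\<lambda>i. \<beta> i / (lm i + \<mu>) - f0 i) u = 0"
    by blast
  have "err2 \<beta> \<mu> f0 \<le> err2 \<beta> \<mu> f" if f: "f \<in> comb F I" for f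
    unfolding err2_wip
  proof (rule projection_minimal[of d "\<lambda>i. lm i + \<mu>"])
    show "wip d (\<lambda>i. lm i + \<mu>) (\<lambda>i. \<beta> i / (lm i + \<mu>) - f0 i) u = 0" if "u \<in> comb F I" for u
      using f0(2) that by simp
  qed (use f f0 w in auto)
  then show ?thesis using f0(1) by blast
qed

text \<open>The iterate is a chosen minimizer. A minimizer exists, so the bound holds for the
  iterate exactly if some element of the block space satisfies it; this eliminates the choice, and
  with it the obstacle to measurability.\<close>

lemma bcg_error_le_iff:
  assumes \<mu>: "0 \<le> \<mu>" and b: "b \<in> carrier_vec d" "b \<noteq> 0\<^sub>v d" and R: "0 \<le> R"
    and g: "\<And>i j. i < d \<Longrightarrow> j < l \<Longrightarrow> g (i, j) = eco U (col (Matrix.mat d l \<omega>) j) i"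
  shows "norm_wrt (shifted A \<mu>) (inv_mat (shifted A \<mu>) *\<^sub>v b
            - bcg A (starting_block b (Matrix.mat d l \<omega>)) 0 t \<mu>)
          / norm_wrt (shifted A \<mu>) (inv_mat (shifted A \<mu>) *\<^sub>v b) \<le> R \<longleftrightarrow>
    (\<exists>f\<in>comb (kgen lm (block_cols (eco U b) g)) ({..l} \<times> {..<t}).
       err2 (eco U b) \<mu> f \<le> R\<^sup>2 * sol2 (eco U b) \<mu>)"
proof -
  define V where "V = starting_block b (Matrix.mat d l \<omega>)"
  define B where "B = block_cols (eco U b) g"
  define \<beta> where "\<beta> = eco U b"
  define K where "K = comb (kgen lm B) ({..l} \<times> {..<t})"
  let ?M = "shifted A \<mu>" and ?s = "inv_mat (shifted A \<mu>) *\<^sub>v b"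
  have w: "0 < lm i + \<mu>" if "i < d" for i using pos[OF that] \<mu> by simp
  have V: "V \<in> carrier_mat d (Suc l)"
    using b(1) mat_of_cols_carrier(1)[of "dim_vec b" "b # cols (Matrix.mat d l \<omega>)"]
    by (simp add: V_def starting_block_def)
  have colV0: "col V 0 = b"
    unfolding V_def starting_block_def by (subst col_mat_of_cols) auto
  have colVS: "col V (Suc j) = col (Matrix.mat d l \<omega>) j" if "j < l" for j
  proof -
    have nth: "(b # cols (Matrix.mat d l \<omega>)) ! Suc j = col (Matrix.mat d l \<omega>) j" using that by simp
    have "dim_vec b = d" using b(1) by simp
    moreover have "col (Matrix.mat d l \<omega>) j \<in> carrier_vec d" using col_dim[of "Matrix.mat d l \<omega>" j] by simp
    ultimately have "col V (Suc j) = (b # cols (Matrix.mat d l \<omega>)) ! Suc j"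
      unfolding V_def starting_block_def using that by (intro col_mat_of_cols) (simp_all add: nth)
    then show ?thesis unfolding nth .
  qed
  have BV: "B j i = eco U (col V j) i" if "i < d" "j < Suc l" for i j
    using that g colV0 colVS by (cases j) (auto simp: B_def)
  have atm: "{..<Suc l} = {..l}" by auto
  have bk: "block_krylov t ?M V = {x \<in> carrier_vec d. \<exists>f\<in>K. \<forall>i<d. eco U x i = f i}"
    using block_krylov_eq[OF V, of B t \<mu>] BV unfolding ecomb_def K_def atm by simp
  have sc: "?s \<in> carrier_vec d" using inv_shifted(1)[OF \<mu> b(1)] .
  have err: "norm_wrt ?M (?s - x) = sqrt (err2 \<beta> \<mu> f)"
    if "x \<in> carrier_vec d" "\<And>i. i < d \<Longrightarrow> eco U x i = f i" for x f
  proof -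
    have "?s - x \<in> carrier_vec d" using sc that by simp
    then have "norm_wrt ?M (?s - x) = sqrt (\<Sum>i<d. (lm i + \<mu>) * (eco U (?s - x) i)\<^sup>2)"
      by (rule norm_wrt_eco)
    also have "(\<Sum>i<d. (lm i + \<mu>) * (eco U (?s - x) i)\<^sup>2) = err2 \<beta> \<mu> f"
      unfolding err2_def
    proof (rule sum.cong[OF refl])
      fix i assume "i \<in> {..<d}"
      then have "eco U (?s - x) i = \<beta> i / (lm i + \<mu>) - f i"
        using inv_shifted(2)[OF \<mu> b(1), of i] that by (simp add: eco_diff[OF sc that(1)] \<beta>_def)
      then show "(lm i + \<mu>) * (eco U (?s - x) i)\<^sup>2 = (lm i + \<mu>) * (f i - \<beta> i / (lm i + \<mu>))\<^sup>2"
        by (simp add: power2_commute[of "f i"])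
    qed
    finally show ?thesis .
  qed
  have sol: "norm_wrt ?M ?s = sqrt (sol2 \<beta> \<mu>)"
    unfolding norm_wrt_eco[OF sc] sol2_def using inv_shifted(2)[OF \<mu> b(1)] w
    by (auto simp: \<beta>_def power2_eq_square intro!: sum.cong)
  have sol_pos: "0 < sol2 \<beta> \<mu>"
  proof -
    have nn: "0 \<le> (\<beta> i)\<^sup>2 / (lm i + \<mu>)" if "i < d" for i using w[OF that] by simp
    have "\<exists>i<d. \<beta> i \<noteq> 0"
    proof (rule ccontr)
      assume "\<not> ?thesis"
      then have "b = 0\<^sub>v d" using b(1) by (intro eco_inj) (auto simp: \<beta>_def eco_def)
      then show False using b(2) by simp
    qed
    then obtain i where i: "i < d" "\<beta> i \<noteq> 0" by blast
    have "0 < (\<beta> i)\<^sup>2 / (lm i + \<mu>)" using w[OF i(1)] i(2) by simp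
    then show ?thesis unfolding sol2_def using i(1) nn by (intro sum_pos2[of _ i]) auto
  qed
  obtain f0 where f0: "f0 \<in> K" "\<And>f. f \<in> K \<Longrightarrow> err2 \<beta> \<mu> f0 \<le> err2 \<beta> \<mu> f"
    using err2_minimizer[OF \<mu>, of "{..l} \<times> {..<t}" "kgen lm B" \<beta>] unfolding K_def by auto
  define P where "P x \<longleftrightarrow> x \<in> block_krylov t ?M V" for x
  define F where "F x = norm_wrt ?M (?s - x)" for x
  have min: "\<exists>x. P x \<and> (\<forall>y. P y \<longrightarrow> F x \<le> F y)"
  proof -
    obtain x0 where x0: "x0 \<in> carrier_vec d" "\<forall>i<d. eco U x0 i = f0 i" using eco_surj by blast
    have "F x0 \<le> F y" if "P y" for y
    proof -
      obtain f where "y \<in> carrier_vec d" "f \<in> K" "\<forall>i<d. eco U y i = f i"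
        using \<open>P y\<close> by (auto simp: P_def bk)
      then show ?thesis using err[of x0 f0] err[of y f] x0 f0(2)[of f] by (simp add: F_def)
    qed
    moreover have "P x0" using x0 f0(1) by (auto simp: P_def bk)
    ultimately show ?thesis by blast
  qed
  define xb where "xb = bcg A V 0 t \<mu>"
  have xb_eq: "xb = (SOME x. is_arg_min F P x)"
    by (simp add: xb_def bcg_def arg_min_def colV0 P_def[abs_def] F_def[abs_def])
  have "is_arg_min F P xb"
    unfolding xb_eq by (rule someI_ex) (use min in \<open>auto simp: is_arg_min_def not_less\<close>)
  then have xb: "P xb" "\<And>y. P y \<Longrightarrow> F xb \<le> F y" by (auto simp: is_arg_min_def not_less)
  have "F xb / norm_wrt ?M ?s \<le> R \<longleftrightarrow> (\<exists>f\<in>K. err2 \<beta> \<mu> f \<le> R\<^sup>2 * sol2 \<beta> \<mu>)"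
  proof -
    have "F xb / norm_wrt ?M ?s \<le> R \<longleftrightarrow> F xb \<le> R * sqrt (sol2 \<beta> \<mu>)"
      unfolding sol using sol_pos by (simp add: pos_divide_le_eq)
    also have "R * sqrt (sol2 \<beta> \<mu>) = sqrt (R\<^sup>2 * sol2 \<beta> \<mu>)" using R by (simp add: real_sqrt_mult)
    also have "F xb \<le> sqrt (R\<^sup>2 * sol2 \<beta> \<mu>) \<longleftrightarrow> (\<exists>f\<in>K. err2 \<beta> \<mu> f \<le> R\<^sup>2 * sol2 \<beta> \<mu>)"
    proof
      assume le: "F xb \<le> sqrt (R\<^sup>2 * sol2 \<beta> \<mu>)"
      obtain f where "xb \<in> carrier_vec d" "f \<in> K" "\<forall>i<d. eco U xb i = f i"
        using xb(1) by (auto simp: P_def bk)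
      then show "\<exists>f\<in>K. err2 \<beta> \<mu> f \<le> R\<^sup>2 * sol2 \<beta> \<mu>" using le err[of xb f] by (auto simp: F_def)
    next
      assume "\<exists>f\<in>K. err2 \<beta> \<mu> f \<le> R\<^sup>2 * sol2 \<beta> \<mu>"
      then obtain f where f: "f \<in> K" "err2 \<beta> \<mu> f \<le> R\<^sup>2 * sol2 \<beta> \<mu>" by blast
      obtain y where y: "y \<in> carrier_vec d" "\<forall>i<d. eco U y i = f i" using eco_surj by blast
      then have "P y" using f(1) by (auto simp: P_def bk)
      then have "F xb \<le> F y" by (rule xb(2))
      also have "\<dots> = sqrt (err2 \<beta> \<mu> f)" using err[of y f] y by (simp add: F_def)
      also have "\<dots> \<le> sqrt (R\<^sup>2 * sol2 \<beta> \<mu>)" using f(2) by simp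
      finally show "F xb \<le> sqrt (R\<^sup>2 * sol2 \<beta> \<mu>)" .
    qed
    finally show ?thesis .
  qed
  then show ?thesis unfolding F_def xb_def V_def K_def B_def \<beta>_def .
qed

end

section \<open>Measurability of the event and rotation of the random block\<close>

context eigenbasis begin

definition attains :: "(nat \<Rightarrow> real) \<Rightarrow> nat \<Rightarrow> nat \<Rightarrow> real \<Rightarrow> real \<Rightarrow> (nat \<times> nat \<Rightarrow> real) \<Rightarrow> bool" where
  "attains \<beta> l t \<mu> c g \<longleftrightarrow> (\<exists>f\<in>comb (kgen lm (block_cols \<beta> g)) ({..l} \<times> {..<t}). err2 \<beta> \<mu> f \<le> c)"

lemma attains_iff_rational:
  assumes \<mu>: "0 \<le> \<mu>"
  shows "attains \<beta> l t \<mu> c g \<longleftrightarrow> (\<forall>n::nat. \<exists>q\<in>({..l} \<times> {..<t}) \<rightarrow>\<^sub>E \<rat>.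
     err2 \<beta> \<mu> (\<lambda>i. \<Sum>k\<in>{..l} \<times> {..<t}. q k * kgen lm (block_cols \<beta> g) k i) < c + 1 / real (Suc n))"
    (is "_ \<longleftrightarrow> (\<forall>n. ?R n)")
proof
  let ?I = "{..l} \<times> {..<t}" and ?F = "kgen lm (block_cols \<beta> g)"
  assume "attains \<beta> l t \<mu> c g"
  then obtain y where y: "err2 \<beta> \<mu> (\<lambda>i. \<Sum>k\<in>?I. y k * ?F k i) \<le> c" by (auto simp: attains_def comb_def)
  obtain Y where Y: "\<And>m::nat. Y m \<in> ?I \<rightarrow>\<^sub>E \<rat>" "\<And>k. k \<in> ?I \<Longrightarrow> (\<lambda>m. Y m k) \<longlonglongrightarrow> y k"
    using rational_approx[of ?I y] by blast
  have lim: "(\<lambda>m. err2 \<beta> \<mu> (\<lambda>i. \<Sum>k\<in>?I. Y m k * ?F k i)) \<longlonglongrightarrow> err2 \<beta> \<mu> (\<lambda>i. \<Sum>k\<in>?I. y k * ?F k i)"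
    unfolding err2_def by (intro tendsto_intros Y(2))
  show "\<forall>n. ?R n"
  proof
    fix n :: nat
    have "0 < 1 / real (Suc n)" by simp
    then have "err2 \<beta> \<mu> (\<lambda>i. \<Sum>k\<in>?I. y k * ?F k i) < c + 1 / real (Suc n)" using y by linarith
    then have "\<forall>\<^sub>F m in sequentially. err2 \<beta> \<mu> (\<lambda>i. \<Sum>k\<in>?I. Y m k * ?F k i) < c + 1 / real (Suc n)"
      by (rule order_tendstoD(2)[OF lim])
    then obtain m where "err2 \<beta> \<mu> (\<lambda>i. \<Sum>k\<in>?I. Y m k * ?F k i) < c + 1 / real (Suc n)"
      by (auto simp: eventually_sequentially)
    then show "?R n" using Y(1) by blast
  qed
next
  let ?I = "{..l} \<times> {..<t}" and ?F = "kgen lm (block_cols \<beta> g)"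
  assume R: "\<forall>n. ?R n"
  obtain f0 where f0: "f0 \<in> comb ?F ?I" "\<forall>f\<in>comb ?F ?I. err2 \<beta> \<mu> f0 \<le> err2 \<beta> \<mu> f"
    using err2_minimizer[OF \<mu>, of ?I ?F \<beta>] by auto
  have "err2 \<beta> \<mu> f0 \<le> c + 1 / real (Suc n)" for n
  proof -
    obtain q where "err2 \<beta> \<mu> (\<lambda>i. \<Sum>k\<in>?I. q k * ?F k i) < c + 1 / real (Suc n)" using R by blast
    moreover have "err2 \<beta> \<mu> f0 \<le> err2 \<beta> \<mu> (\<lambda>i. \<Sum>k\<in>?I. q k * ?F k i)" using f0(2) combI by blast
    ultimately show ?thesis by linarith
  qed
  moreover have "(\<lambda>n. c + 1 / real (Suc n)) \<longlonglongrightarrow> c"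
    using tendsto_add[OF tendsto_const[of c] LIMSEQ_inverse_real_of_nat] by (simp add: inverse_eq_divide)
  ultimately have "err2 \<beta> \<mu> f0 \<le> c" by (intro LIMSEQ_le_const) auto
  then show "attains \<beta> l t \<mu> c g" using f0(1) by (auto simp: attains_def)
qed

lemma attains_measurable:
  assumes \<mu>: "0 \<le> \<mu>"
  shows "{g \<in> space (gprod ({..<d} \<times> {..<l})). attains \<beta> l t \<mu> c g}
    \<in> sets (gprod ({..<d} \<times> {..<l}))"
proof -
  let ?I = "{..l} \<times> {..<t}" and ?P = "gprod ({..<d} \<times> {..<l})"
  have cnt: "countable (?I \<rightarrow>\<^sub>E (\<rat>::real set))"
    by (intro Finite_Cartesian_Product.countable_PiE countable_rat) auto
  have m: "(\<lambda>g. g (i, j)) \<in> borel_measurable ?P" if "i < d" "j < l" for i j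
    using that by (intro measurable_PiM_component_rev) auto
  have kg: "(\<lambda>g. kgen lm (block_cols \<beta> g) k i) \<in> borel_measurable ?P" if "k \<in> ?I" "i < d" for k i
    unfolding kgen_def block_cols_def using that m by (cases "fst k") auto
  have e: "(\<lambda>g. err2 \<beta> \<mu> (\<lambda>i. \<Sum>k\<in>?I. q k * kgen lm (block_cols \<beta> g) k i)) \<in> borel_measurable ?P" for q
    unfolding err2_def
    by (intro borel_measurable_sum borel_measurable_times borel_measurable_const borel_measurable_power
        borel_measurable_diff kg) auto
  have "{g \<in> space ?P. attains \<beta> l t \<mu> c g} = {g \<in> space ?P. \<forall>n::nat. \<exists>q\<in>?I \<rightarrow>\<^sub>E \<rat>.
     err2 \<beta> \<mu> (\<lambda>i. \<Sum>k\<in>?I. q k * kgen lm (block_cols \<beta> g) k i) < c + 1 / real (Suc n)}"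
    using attains_iff_rational[OF \<mu>] by simp
  also have "\<dots> \<in> sets ?P"
    by (intro sets.sets_Collect_countable_All sets.sets_Collect_countable_Ex'[OF _ cnt] borel_measurable_less e
        borel_measurable_const)
  finally show ?thesis .
qed

text \<open>For a fixed vector, the squared error minus the squared norm of the solution is increasing in \<open>\<mu>\<close>; hence
  it suffices to control rational shifts.\<close>

lemma attains_all_iff_rational:
  assumes cont: "\<And>\<mu>. 0 \<le> \<mu> \<Longrightarrow> isCont R \<mu>"
  shows "(\<forall>\<mu>\<ge>0. attains \<beta> l t \<mu> (R \<mu> * sol2 \<beta> \<mu>) g) \<longleftrightarrow>
    (\<forall>\<mu>\<in>\<rat> \<inter> {0..}. attains \<beta> l t \<mu> (R \<mu> * sol2 \<beta> \<mu>) g)"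
proof (intro iffI allI impI)
  fix \<mu> :: real
  assume rat: "\<forall>\<mu>\<in>\<rat> \<inter> {0..}. attains \<beta> l t \<mu> (R \<mu> * sol2 \<beta> \<mu>) g" and \<mu>: "0 \<le> \<mu>"
  let ?I = "{..l} \<times> {..<t}" and ?F = "kgen lm (block_cols \<beta> g)"
  have w: "0 < lm i + \<mu>" if "i < d" "0 \<le> \<mu>" for i \<mu> using pos[OF that(1)] that(2) by simp
  obtain f0 where f0: "f0 \<in> comb ?F ?I" "\<forall>f\<in>comb ?F ?I. err2 \<beta> \<mu> f0 \<le> err2 \<beta> \<mu> f"
    using err2_minimizer[OF \<mu>, of ?I ?F \<beta>] by auto
  have expand: "err2 \<beta> \<mu> f = sol2 \<beta> \<mu> + (\<Sum>i<d. (lm i + \<mu>) * (f i)\<^sup>2 - 2 * \<beta> i * f i)" if "0 \<le> \<mu>" for \<mu> f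
    unfolding err2_def sol2_def sum.distrib[symmetric]
  proof (rule sum.cong[OF refl])
    fix i assume "i \<in> {..<d}"
    then have "lm i + \<mu> \<noteq> 0" using w[of i \<mu>] that by auto
    moreover have "v * (f i - b / v)\<^sup>2 = b\<^sup>2 / v + (v * (f i)\<^sup>2 - 2 * b * f i)" if "v \<noteq> 0" for v b :: real
      using that by (simp add: power2_eq_square field_simps)
    ultimately show "(lm i + \<mu>) * (f i - \<beta> i / (lm i + \<mu>))\<^sup>2
        = (\<beta> i)\<^sup>2 / (lm i + \<mu>) + ((lm i + \<mu>) * (f i)\<^sup>2 - 2 * \<beta> i * f i)" by blast
  qed
  \<comment> \<open>Monotonicity works in one direction only: a vector good at a larger shift
    controls the minimum at \<mu>. Hence the rational shifts have to approach \<mu> from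
    above.\<close>
  have le: "err2 \<beta> \<mu> f0 \<le> sol2 \<beta> \<mu> - sol2 \<beta> \<mu>' + R \<mu>' * sol2 \<beta> \<mu>'" if "\<mu>' \<in> \<rat>" "\<mu> \<le> \<mu>'" for \<mu>'
  proof -
    have "attains \<beta> l t \<mu>' (R \<mu>' * sol2 \<beta> \<mu>') g" using rat that \<mu> by auto
    then obtain f where f: "f \<in> comb ?F ?I" "err2 \<beta> \<mu>' f \<le> R \<mu>' * sol2 \<beta> \<mu>'" by (auto simp: attains_def)
    have "err2 \<beta> \<mu> f0 \<le> err2 \<beta> \<mu> f" using f0(2) f(1) by blast
    also have "\<dots> = sol2 \<beta> \<mu> + (\<Sum>i<d. (lm i + \<mu>) * (f i)\<^sup>2 - 2 * \<beta> i * f i)" by (rule expand[OF \<mu>])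
    also have "(\<Sum>i<d. (lm i + \<mu>) * (f i)\<^sup>2 - 2 * \<beta> i * f i) \<le> (\<Sum>i<d. (lm i + \<mu>') * (f i)\<^sup>2 - 2 * \<beta> i * f i)"
      using that(2) by (intro sum_mono diff_right_mono mult_right_mono) auto
    also have "\<dots> = err2 \<beta> \<mu>' f - sol2 \<beta> \<mu>'" using expand[of \<mu>' f] \<mu> that(2) by simp
    finally show ?thesis using f(2) by linarith
  qed
  obtain q where q: "\<And>m. q m \<in> \<rat>" "\<And>m. \<mu> < q m" and q_lim: "q \<longlonglongrightarrow> \<mu>"
    using rational_seq_above[of \<mu>] by blast
  have R_lim: "(\<lambda>m. R (q m)) \<longlonglongrightarrow> R \<mu>" using cont[OF \<mu>] q_lim by (rule isCont_tendsto_compose)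
  have s_lim: "(\<lambda>m. sol2 \<beta> (q m)) \<longlonglongrightarrow> sol2 \<beta> \<mu>"
    unfolding sol2_def by (intro tendsto_intros q_lim) (use w[OF _ \<mu>] in force)
  have "(\<lambda>m. sol2 \<beta> \<mu> - sol2 \<beta> (q m) + R (q m) * sol2 \<beta> (q m)) \<longlonglongrightarrow> sol2 \<beta> \<mu> - sol2 \<beta> \<mu> + R \<mu> * sol2 \<beta> \<mu>"
    by (intro tendsto_intros R_lim s_lim)
  moreover have "err2 \<beta> \<mu> f0 \<le> sol2 \<beta> \<mu> - sol2 \<beta> (q m) + R (q m) * sol2 \<beta> (q m)" for m
    using le q(1) q(2)[of m] by simp
  ultimately have "err2 \<beta> \<mu> f0 \<le> sol2 \<beta> \<mu> - sol2 \<beta> \<mu> + R \<mu> * sol2 \<beta> \<mu>"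
    by (intro LIMSEQ_le_const) auto
  then show "attains \<beta> l t \<mu> (R \<mu> * sol2 \<beta> \<mu>) g" using f0(1) by (auto simp: attains_def)
qed auto

lemma attains_all_measurable:
  assumes cont: "\<And>\<mu>. 0 \<le> \<mu> \<Longrightarrow> isCont R \<mu>"
  shows "{g \<in> space (gprod ({..<d} \<times> {..<l})). \<forall>\<mu>\<ge>0. attains \<beta> l t \<mu> (R \<mu> * sol2 \<beta> \<mu>) g}
    \<in> sets (gprod ({..<d} \<times> {..<l}))"
proof -
  have "countable (\<rat> \<inter> {0::real..})" using countable_rat by (rule countable_subset[rotated]) auto
  moreover have eq: "(\<forall>\<mu>\<ge>0. attains \<beta> l t \<mu> (R \<mu> * sol2 \<beta> \<mu>) g) \<longleftrightarrow>
      (\<forall>\<mu>\<in>\<rat> \<inter> {0..}. attains \<beta> l t \<mu> (R \<mu> * sol2 \<beta> \<mu>) g)" for g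
    using cont by (rule attains_all_iff_rational)
  ultimately show ?thesis
    unfolding eq by (intro sets.sets_Collect_countable_All' attains_measurable) auto
qed

text \<open>The random block in eigencoordinates: \<open>transpose_mat U\<close> applied to every
  column, restricted so that it is again a point of the product measure.\<close>

definition rot :: "nat \<Rightarrow> (nat \<times> nat \<Rightarrow> real) \<Rightarrow> nat \<times> nat \<Rightarrow> real" where
  "rot l \<omega> = (\<lambda>e\<in>{..<d} \<times> {..<l}. \<Sum>k<d. U $$ (k, fst e) * \<omega> (k, snd e))"

lemma rot_eco: "i < d \<Longrightarrow> j < l \<Longrightarrow> rot l \<omega> (i, j) = eco U (col (Matrix.mat d l \<omega>) j) i"
  using U by (auto simp: rot_def eco_def scalar_prod_def atLeast0LessThan intro!: sum.cong)

lemma U_orth: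
  assumes "i < d" "i' < d"
  shows "(\<Sum>k<d. U $$ (i, k) * U $$ (i', k)) = (if i = i' then 1 else 0)"
proof -
  have "(\<Sum>k<d. U $$ (i, k) * U $$ (i', k)) = (U * transpose_mat U) $$ (i, i')"
    using U assms by (auto simp: scalar_prod_def atLeast0LessThan intro!: sum.cong)
  then show ?thesis unfolding UUt using assms by simp
qed

lemma U_orth':
  assumes "i < d" "i' < d"
  shows "(\<Sum>k<d. U $$ (k, i) * U $$ (k, i')) = (if i = i' then 1 else 0)"
proof -
  have "(\<Sum>k<d. U $$ (k, i) * U $$ (k, i')) = (transpose_mat U * U) $$ (i, i')"
    using U assms by (auto simp: scalar_prod_def atLeast0LessThan intro!: sum.cong)
  then show ?thesis unfolding UtU using assms by simp
qed

lemma distr_rot: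
  "distr (gprod ({..<d} \<times> {..<l})) (gprod ({..<d} \<times> {..<l})) (rot l)
    = gprod ({..<d} \<times> {..<l})"
  and rot_measurable: "rot l \<in> measurable (lprod ({..<d} \<times> {..<l})) (lprod ({..<d} \<times> {..<l}))"
proof -
  let ?I = "{..<d} \<times> {..<l}"
  show m: "rot l \<in> measurable (lprod ?I) (lprod ?I)"
    unfolding rot_def
  proof (rule measurable_restrict)
    fix e assume e: "e \<in> ?I"
    have "(\<lambda>\<omega>. \<omega> (k, snd e)) \<in> borel_measurable (lprod ?I)" if "k < d" for k
      using e that by (intro measurable_PiM_component_rev) auto
    then show "(\<lambda>\<omega>. \<Sum>k<d. U $$ (k, fst e) * \<omega> (k, snd e)) \<in> measurable (lprod ?I) lborel" by simp
  qed
  have swap: "(\<Sum>k<d. a k * (\<Sum>k'<d. b k k' * c k')) = (\<Sum>k'<d. (\<Sum>k<d. a k * b k k') * c k')" for a c :: "nat \<Rightarrow> real" and b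
    unfolding sum_distrib_left sum_distrib_right by (subst sum.swap) (simp add: mult.assoc)
  have delta: "(\<Sum>k<d. (if i = k then 1 else 0) * c k) = c i" if "i < d" for i and c :: "nat \<Rightarrow> real"
  proof -
    have "(\<Sum>k<d. (if i = k then 1 else 0) * c k) = (\<Sum>k<d. if i = k then c k else 0)" by (rule sum.cong) auto
    then show ?thesis using that by simp
  qed
  show "distr (gprod ?I) (gprod ?I) (rot l) = gprod ?I"
  proof (rule std_normal_isometry[OF _ m])
    show "rot l (fadd ?I x y) = fadd ?I (rot l x) (rot l y)" for x y
      by (auto simp: rot_def fadd_def sum.distrib distrib_left intro!: ext sum.cong)
    show "\<exists>x\<in>space (lprod ?I). rot l x = y" if y: "y \<in> space (lprod ?I)" for y
    proof (intro bexI)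
      define x where "x = (\<lambda>e\<in>?I. \<Sum>k<d. U $$ (fst e, k) * y (k, snd e))"
      show "x \<in> space (lprod ?I)" by (simp add: x_def space_PiM)
      show "rot l x = y"
      proof
        fix e show "rot l x e = y e"
        proof (cases "e \<in> ?I")
          case True
          then have e: "fst e < d" "snd e < l" by auto
          have "rot l x e = (\<Sum>k<d. U $$ (k, fst e) * (\<Sum>k'<d. U $$ (k, k') * y (k', snd e)))"
            using True by (auto simp: rot_def x_def intro!: sum.cong)
          also have "\<dots> = (\<Sum>k'<d. (\<Sum>k<d. U $$ (k, fst e) * U $$ (k, k')) * y (k', snd e))" by (rule swap)
          also have "\<dots> = (\<Sum>k'<d. (if fst e = k' then 1 else 0) * y (k', snd e))"
            using U_orth'[OF e(1)] by (intro sum.cong) auto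
          also have "\<dots> = y e" using delta[OF e(1), of "\<lambda>k. y (k, snd e)"] by simp
          finally show ?thesis .
        next
          case False
          then have "y e = undefined" using y by (intro PiE_arb) (auto simp: space_PiM)
          then show ?thesis using False by (auto simp: rot_def restrict_def)
        qed
      qed
    qed
    show "(\<Sum>e\<in>?I. (rot l x e)\<^sup>2) = (\<Sum>e\<in>?I. (x e)\<^sup>2)" for x
    proof -
      have "(\<Sum>e\<in>?I. (rot l x e)\<^sup>2) = (\<Sum>j<l. \<Sum>i<d. (\<Sum>k<d. U $$ (k, i) * x (k, j))\<^sup>2)"
        unfolding sum.cartesian_product[symmetric]
        by (subst sum.swap) (auto simp: rot_def sum.cartesian_product case_prod_unfold intro!: sum.cong)
      also have "\<dots> = (\<Sum>j<l. \<Sum>k<d. (x (k, j))\<^sup>2)"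
      proof (rule sum.cong[OF refl])
        fix j
        have "(\<Sum>i<d. (\<Sum>k<d. U $$ (k, i) * x (k, j))\<^sup>2)
           = (\<Sum>i<d. \<Sum>k<d. x (k, j) * (U $$ (k, i) * (\<Sum>k'<d. U $$ (k', i) * x (k', j))))"
          unfolding power2_eq_square sum_distrib_right by (intro sum.cong refl) (simp add: mult_ac)
        also have "\<dots> = (\<Sum>k<d. x (k, j) * (\<Sum>i<d. U $$ (k, i) * (\<Sum>k'<d. U $$ (k', i) * x (k', j))))"
          by (subst sum.swap) (simp add: sum_distrib_left)
        also have "\<dots> = (\<Sum>k<d. x (k, j) * x (k, j))"
        proof (rule sum.cong[OF refl])
          fix k assume k: "k \<in> {..<d}"
          have "(\<Sum>i<d. U $$ (k, i) * (\<Sum>k'<d. U $$ (k', i) * x (k', j)))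
              = (\<Sum>k'<d. (\<Sum>i<d. U $$ (k, i) * U $$ (k', i)) * x (k', j))" by (rule swap)
          also have "\<dots> = (\<Sum>k'<d. (if k = k' then 1 else 0) * x (k', j))"
            using k U_orth[of k] by (intro sum.cong) auto
          also have "\<dots> = x (k, j)" using k delta[of k "\<lambda>k. x (k, j)"] by simp
          finally show "x (k, j) * (\<Sum>i<d. U $$ (k, i) * (\<Sum>k'<d. U $$ (k', i) * x (k', j))) = x (k, j) * x (k, j)" by simp
        qed
        finally show "(\<Sum>i<d. (\<Sum>k<d. U $$ (k, i) * x (k, j))\<^sup>2) = (\<Sum>k<d. (x (k, j))\<^sup>2)"
          by (simp add: power2_eq_square)
      qed
      also have "\<dots> = (\<Sum>e\<in>?I. (x e)\<^sup>2)"
        by (subst sum.swap) (simp add: sum.cartesian_product case_prod_unfold)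
      finally show ?thesis .
    qed
  qed simp
qed

end

section \<open>The good event\<close>

lemma krylov_top_small:
  fixes lm z :: "nat \<Rightarrow> real" and g :: "nat \<times> nat \<Rightarrow> real"
  assumes pos: "\<And>i. i < d \<Longrightarrow> 0 < lm i" and dec: "\<And>i j. i \<le> j \<Longrightarrow> j < d \<Longrightarrow> lm j \<le> lm i"
    and r: "r < d" "r \<le> n * l" and N: "n * l \<le> d" and \<tau>: "0 \<le> \<tau>"
    and inv: "\<And>i. i < n * l \<Longrightarrow> invbd n l (\<lambda>i. lm i / lm 0) {..<n * l} i g \<le> ennreal \<tau>"
    and \<Gamma>: "(\<Sum>i<d. gsize l g i) \<le> \<Gamma>"
    and m: "3 * real d * \<tau> ^ 4 * real n * \<Gamma> \<le> 2 ^ m"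
    and orth: "\<And>j a. j < l \<Longrightarrow> a < m + n \<Longrightarrow> (\<Sum>i<d. z i * (lm i ^ a * g (i, j))) = 0"
  shows "(\<Sum>i\<in>{i. i < d \<and> 2 * lm r < lm i}. (z i)\<^sup>2) \<le> 1 / 8 * (\<Sum>i\<in>{i. i < d \<and> lm i \<le> 2 * lm r}. (z i)\<^sup>2)"
proof -
  let ?T = "{i. i < d \<and> 2 * lm r < lm i}" and ?S = "{i. i < d \<and> lm i \<le> 2 * lm r}"
  define N where "N = n * l"
  define x where "x i = lm i / lm 0" for i
  define \<rho> where "\<rho> = x r"
  \<comment> \<open>With \<open>x i ^ m\<close> moved into the weights, orthogonality to the powers
    \<open>m, ..., m + n - 1\<close> becomes a square block Vandermonde system on the first
    \<open>N\<close> rows, with the remaining rows on the right-hand side.\<close>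
  define y where "y i = z i * x i ^ m" for i
  define Z where "Z = sqrt (\<Sum>i\<in>?S. (z i)\<^sup>2)"
  have Nd: "N \<le> d" "r \<le> N" using assms(4,5) by (auto simp: N_def)
  have l0: "0 < lm 0" using pos[of 0] r(1) by simp
  have x: "0 < x i" "x i \<le> 1" if "i < d" for i
    using that pos[OF that] l0 dec[of 0 i] by (auto simp: x_def)
  have \<rho>: "0 < \<rho>" using x(1)[OF r(1)] by (simp add: \<rho>_def)
  have ZS: "Z\<^sup>2 = (\<Sum>i\<in>?S. (z i)\<^sup>2)" and Z0: "0 \<le> Z" by (auto simp: Z_def sum_nonneg)
  have zZ: "\<bar>z i\<bar> \<le> Z" if "i \<in> ?S" for i
  proof -
    have "(z i)\<^sup>2 \<le> (\<Sum>i\<in>?S. (z i)\<^sup>2)" using that by (intro member_le_sum) auto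
    then have "sqrt ((z i)\<^sup>2) \<le> Z" unfolding Z_def by (rule real_sqrt_le_mono)
    then show ?thesis by simp
  qed
  \<comment> \<open>As \<open>r \<le> N\<close>, all rows outside the Vandermonde block satisfy
    \<open>x i \<le> \<rho>\<close>; rows from \<open>r\<close> to \<open>N - 1\<close> stay inside
    the block.\<close>
  have tail: "i \<in> ?S \<and> x i \<le> \<rho>" if "N \<le> i" "i < d" for i
    using dec[of r i] that Nd pos[OF r(1)] l0 by (auto simp: \<rho>_def x_def divide_right_mono)
  have row: "\<bar>rowcomb x g {..<N} y e\<bar> \<le> (\<Sum>i=N..<d. Z * \<rho> ^ m * \<bar>g (i, snd e)\<bar>)" if e: "e \<in> bidx n l" for e
  proof -
    let ?t = "\<lambda>i. z i * (x i ^ (m + fst e) * g (i, snd e))"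
    have "(\<Sum>i<d. z i * (lm i ^ (m + fst e) * g (i, snd e))) = 0" using e by (intro orth) (auto simp: bidx_def)
    moreover have "(\<Sum>i<d. ?t i) = (\<Sum>i<d. z i * (lm i ^ (m + fst e) * g (i, snd e))) / lm 0 ^ (m + fst e)"
      by (simp add: x_def power_divide sum_divide_distrib)
    ultimately have "(\<Sum>i<d. ?t i) = 0" by simp
    moreover have "(\<Sum>i<d. ?t i) = (\<Sum>i<N. ?t i) + (\<Sum>i=N..<d. ?t i)"
      using sum.atLeastLessThan_concat[of 0 N d ?t] Nd(1) by (simp add: lessThan_atLeast0)
    moreover have "(\<Sum>i<N. ?t i) = rowcomb x g {..<N} y e"
      by (simp add: rowcomb_def y_def power_add mult_ac)
    ultimately have "\<bar>rowcomb x g {..<N} y e\<bar> = \<bar>\<Sum>i=N..<d. ?t i\<bar>" by linarith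
    also have "\<dots> \<le> (\<Sum>i=N..<d. \<bar>?t i\<bar>)" by (rule sum_abs)
    also have "\<dots> \<le> (\<Sum>i=N..<d. Z * \<rho> ^ m * \<bar>g (i, snd e)\<bar>)"
    proof (rule sum_mono)
      fix i assume i: "i \<in> {N..<d}"
      then have xi: "0 \<le> x i" "x i \<le> 1" using x[of i] by auto
      have "x i ^ (m + fst e) \<le> x i ^ m" using xi by (intro power_decreasing) auto
      also have "\<dots> \<le> \<rho> ^ m" using tail[of i] i xi by (intro power_mono) auto
      finally have "\<bar>z i\<bar> * x i ^ (m + fst e) \<le> Z * \<rho> ^ m"
        using zZ[of i] tail[of i] i xi Z0 by (intro mult_mono) auto
      then have "\<bar>z i\<bar> * x i ^ (m + fst e) * \<bar>g (i, snd e)\<bar> \<le> Z * \<rho> ^ m * \<bar>g (i, snd e)\<bar>"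
        by (rule mult_right_mono) simp
      then show "\<bar>?t i\<bar> \<le> Z * \<rho> ^ m * \<bar>g (i, snd e)\<bar>" using xi by (simp add: abs_mult mult.assoc)
    qed
    finally show ?thesis .
  qed
  have rn: "rownorm n l x g {..<N} y \<le> real n * (Z * \<rho> ^ m * \<Gamma>)"
  proof -
    have "rownorm n l x g {..<N} y \<le> (\<Sum>e\<in>bidx n l. \<Sum>i=N..<d. Z * \<rho> ^ m * \<bar>g (i, snd e)\<bar>)"
      unfolding rownorm_def using row by (rule sum_mono)
    also have "\<dots> = (\<Sum>a<n. \<Sum>j<l. \<Sum>i=N..<d. Z * \<rho> ^ m * \<bar>g (i, j)\<bar>)"
      unfolding bidx_def sum.cartesian_product[where B = "{..<l}"] by (rule sum.cong) auto
    also have "\<dots> = real n * (\<Sum>j<l. \<Sum>i=N..<d. Z * \<rho> ^ m * \<bar>g (i, j)\<bar>)" by simp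
    also have "(\<Sum>j<l. \<Sum>i=N..<d. Z * \<rho> ^ m * \<bar>g (i, j)\<bar>) = Z * \<rho> ^ m * (\<Sum>i=N..<d. \<Sum>j<l. \<bar>g (i, j)\<bar>)"
      by (subst sum.swap) (simp add: sum_distrib_left)
    also have "(\<Sum>i=N..<d. \<Sum>j<l. \<bar>g (i, j)\<bar>) \<le> (\<Sum>i=N..<d. gsize l g i)"
      by (intro sum_mono) (simp add: gsize_def)
    also have "\<dots> \<le> (\<Sum>i<d. gsize l g i)" by (intro sum_mono2) auto
    also have "\<dots> \<le> \<Gamma>" by (rule \<Gamma>)
    finally show ?thesis using Z0 \<rho> by (simp add: mult_left_mono)
  qed
  \<comment> \<open>The right-hand side is of order \<open>\<rho> ^ m\<close>, and the weight of a
    top row is at least \<open>(2 * \<rho>) ^ m\<close> times \<open>\<bar>z i\<bar>\<close>. The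
    powers of \<rho> cancel, and \<open>2 ^ m\<close> outweighs the constants.\<close>
  have top: "\<bar>z i\<bar> \<le> Z / (3 * real d)" if i: "i \<in> ?T" for i
  proof -
    have ir: "i < r"
    proof (rule ccontr)
      assume "\<not> i < r"
      then have "lm i \<le> lm r" using dec[of r i] i by simp
      then show False using i pos[OF r(1)] by simp
    qed
    then have iN: "i < N" using Nd by simp
    have "\<bar>y i\<bar> * 1 \<le> \<bar>y i\<bar> * gsize l g i" by (intro mult_left_mono gsize_ge_1) auto
    also have "\<dots> \<le> \<tau> ^ 4 * rownorm n l x g {..<N} y"
      using inv[of i] iN \<tau> unfolding N_def x_def by (intro invbd_bound) auto
    also have "\<dots> \<le> \<tau> ^ 4 * (real n * (Z * \<rho> ^ m * \<Gamma>))" using rn \<tau> by (intro mult_left_mono) auto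
    finally have yi: "\<bar>y i\<bar> \<le> \<tau> ^ 4 * (real n * (Z * \<rho> ^ m * \<Gamma>))" by simp
    have "2 * \<rho> \<le> x i" using i l0 by (auto simp: x_def \<rho>_def field_simps)
    then have "(2 * \<rho>) ^ m \<le> x i ^ m" using \<rho> by (intro power_mono) auto
    then have "\<bar>z i\<bar> * (2 * \<rho>) ^ m \<le> \<bar>y i\<bar>"
      using x(1)[of i] i by (auto simp: y_def abs_mult intro: mult_left_mono)
    with yi have "\<bar>z i\<bar> * 2 ^ m * \<rho> ^ m \<le> \<tau> ^ 4 * (real n * (Z * \<Gamma>)) * \<rho> ^ m"
      by (simp add: power_mult_distrib mult_ac)
    then have 1: "\<bar>z i\<bar> * 2 ^ m \<le> \<tau> ^ 4 * (real n * (Z * \<Gamma>))" using \<rho> by simp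
    have "3 * real d * (\<tau> ^ 4 * (real n * (Z * \<Gamma>))) = Z * (3 * real d * \<tau> ^ 4 * real n * \<Gamma>)"
      by (simp add: mult_ac)
    also have "\<dots> \<le> Z * 2 ^ m" using m Z0 by (rule mult_left_mono)
    finally have "3 * real d * (\<bar>z i\<bar> * 2 ^ m) \<le> Z * 2 ^ m"
      using mult_left_mono[OF 1, of "3 * real d"] by linarith
    then have "(3 * real d * \<bar>z i\<bar>) * 2 ^ m \<le> Z * 2 ^ m" by (simp add: mult_ac)
    then have "3 * real d * \<bar>z i\<bar> \<le> Z" by simp
    then show ?thesis using r(1) by (simp add: field_simps)
  qed
  \<comment> \<open>At most \<open>d\<close> coordinates of size \<open>Z / (3 * real d)\<close>
    contribute no more than \<open>Z\<^sup>2 / 9\<close>, which is below the tolerated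
    eighth.\<close>
  have "(\<Sum>i\<in>?T. (z i)\<^sup>2) \<le> (\<Sum>i\<in>?T. (Z / (3 * real d))\<^sup>2)"
  proof (rule sum_mono)
    fix i assume "i \<in> ?T"
    then have "\<bar>z i\<bar>\<^sup>2 \<le> (Z / (3 * real d))\<^sup>2" using top[of i] by (intro power_mono) auto
    then show "(z i)\<^sup>2 \<le> (Z / (3 * real d))\<^sup>2" by simp
  qed
  also have "\<dots> \<le> real d * (Z / (3 * real d))\<^sup>2"
  proof -
    have "card ?T \<le> card {..<d}" by (intro card_mono) auto
    then show ?thesis by (simp add: mult_right_mono)
  qed
  also have "\<dots> = Z\<^sup>2 / 9 / real d" using r(1) by (simp add: power2_eq_square)
  also have "\<dots> \<le> Z\<^sup>2 / 9 / 1" using r(1) by (intro divide_left_mono) auto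
  also have "\<dots> \<le> 1 / 8 * Z\<^sup>2" by simp
  finally show ?thesis unfolding ZS .
qed

lemma good_event:
  assumes l: "0 < l" and n: "0 < n" and N: "n * l \<le> d" and D: "0 < D" "D \<le> 1" and \<delta>: "0 < \<delta>"
    and x: "\<And>k. k < n * l \<Longrightarrow> 0 \<le> x k \<and> x k \<le> 1"
    and gap: "\<And>k k'. k < n * l \<Longrightarrow> k' < n * l \<Longrightarrow> k \<noteq> k' \<Longrightarrow> D \<le> \<bar>x k - x k'\<bar>"
    and \<tau>: "\<tau> = 2 * real (n * l) * (7 * real (n * l) * (14 * real (n * l) * (2 / D) powr (1 / 4) * real (n * l)) ^ (n - 1)) / \<delta>"
    and \<Gamma>: "\<Gamma> = 2 * real d * (1 + real l) / \<delta>"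
  shows "1 - \<delta> \<le> measure (gprod ({..<d} \<times> {..<l}))
    {g \<in> space (gprod ({..<d} \<times> {..<l})).
      (\<forall>i<n * l. invbd n l x {..<n * l} i g \<le> ennreal \<tau>) \<and> (\<Sum>i<d. gsize l g i) \<le> \<Gamma>}"
    (is "_ \<le> measure ?P ?G")
proof -
  let ?N = "n * l"
  define E where "E = 7 * real ?N * (14 * real ?N * (2 / D) powr (1 / 4) * real ?N) ^ (n - 1)"
  have "0 < n * l" using l n by simp
  then have d: "0 < d" using N by linarith
  have N0: "0 < real ?N" using l n by simp
  have E0: "0 < E" unfolding E_def using N0 D by (intro mult_pos_pos zero_less_power) auto
  have \<tau>E: "\<tau> = 2 * real ?N * E / \<delta>" by (simp add: \<tau> E_def)
  have \<tau>0: "0 < \<tau>" unfolding \<tau>E using N0 E0 \<delta> by (intro divide_pos_pos mult_pos_pos) auto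
  have \<Gamma>0: "0 < \<Gamma>" unfolding \<Gamma> using d \<delta> by (intro divide_pos_pos mult_pos_pos) auto
  have pP: "prob_space ?P" by (intro prob_space_PiM prob_space_std_normal)
  have fP: "finite_measure ?P" using pP by (rule prob_space.finite_measure)
  have mU: "invbd n l x {..<?N} i \<in> borel_measurable ?P" if "i < ?N" for i
    using N that by (intro invbd_measurable) auto
  have mG: "(\<lambda>g. gsize l g i) \<in> borel_measurable ?P" if "i < d" for i
  proof -
    have "(\<lambda>g. g (i, j)) \<in> borel_measurable ?P" if "j < l" for j
      using \<open>i < d\<close> that by (intro measurable_PiM_component_rev) auto
    then show ?thesis unfolding gsize_def by (intro borel_measurable_add borel_measurable_const borel_measurable_sum borel_measurable_abs) auto
  qed
  \<comment> \<open>\<open>H\<close> reaches 1 as soon as one of the quantities exceeds its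
    threshold. The thresholds \<tau> and \<Gamma> are such that each of the two sums has mean at
    most \<delta> / 2.\<close>
  define H where "H g = (\<Sum>i<?N. ennreal (1 / \<tau>) * invbd n l x {..<?N} i g) + (\<Sum>i<d. ennreal (1 / \<Gamma>) * ennreal (gsize l g i))" for g
  have m1: "(\<lambda>g. ennreal (1 / \<tau>) * invbd n l x {..<?N} i g) \<in> borel_measurable ?P" if "i < ?N" for i
    using mU[OF that] by (intro borel_measurable_times_ennreal) auto
  have m2: "(\<lambda>g. ennreal (1 / \<Gamma>) * ennreal (gsize l g i)) \<in> borel_measurable ?P" if "i < d" for i
    using mG[OF that] by (intro borel_measurable_times_ennreal) auto
  have mH: "H \<in> borel_measurable ?P"
    unfolding H_def using m1 m2 by (intro borel_measurable_add borel_measurable_sum) auto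
  have "(\<integral>\<^sup>+g. H g \<partial>?P) = (\<Sum>i<?N. ennreal (1 / \<tau>) * (\<integral>\<^sup>+g. invbd n l x {..<?N} i g \<partial>?P))
      + (\<Sum>i<d. ennreal (1 / \<Gamma>) * (\<integral>\<^sup>+g. ennreal (gsize l g i) \<partial>?P))"
  proof -
    have "(\<integral>\<^sup>+g. H g \<partial>?P) = (\<integral>\<^sup>+g. (\<Sum>i<?N. ennreal (1 / \<tau>) * invbd n l x {..<?N} i g) \<partial>?P)
       + (\<integral>\<^sup>+g. (\<Sum>i<d. ennreal (1 / \<Gamma>) * ennreal (gsize l g i)) \<partial>?P)"
      unfolding H_def using m1 m2 by (intro nn_integral_add borel_measurable_sum) auto
    also have "(\<integral>\<^sup>+g. (\<Sum>i<?N. ennreal (1 / \<tau>) * invbd n l x {..<?N} i g) \<partial>?P)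
       = (\<Sum>i<?N. ennreal (1 / \<tau>) * (\<integral>\<^sup>+g. invbd n l x {..<?N} i g \<partial>?P))"
      using m1 mU by (subst nn_integral_sum) (auto intro!: sum.cong nn_integral_cmult)
    also have "(\<integral>\<^sup>+g. (\<Sum>i<d. ennreal (1 / \<Gamma>) * ennreal (gsize l g i)) \<partial>?P)
       = (\<Sum>i<d. ennreal (1 / \<Gamma>) * (\<integral>\<^sup>+g. ennreal (gsize l g i) \<partial>?P))"
    proof -
      have "(\<integral>\<^sup>+g. (\<Sum>i<d. ennreal (1 / \<Gamma>) * ennreal (gsize l g i)) \<partial>?P)
         = (\<Sum>i<d. \<integral>\<^sup>+g. ennreal (1 / \<Gamma>) * ennreal (gsize l g i) \<partial>?P)"
        using m2 by (intro nn_integral_sum) auto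
      also have "\<dots> = (\<Sum>i<d. ennreal (1 / \<Gamma>) * (\<integral>\<^sup>+g. ennreal (gsize l g i) \<partial>?P))"
        by (intro sum.cong refl nn_integral_cmult measurable_compose[OF mG measurable_ennreal]) auto
      finally show ?thesis .
    qed
    finally show ?thesis .
  qed
  also have "\<dots> \<le> (\<Sum>i<?N. ennreal (1 / \<tau>) * ennreal E) + (\<Sum>i<d. ennreal (1 / \<Gamma>) * ennreal (1 + real l))"
  proof (intro add_mono sum_mono mult_left_mono)
    fix i assume "i \<in> {..<?N}"
    then have "(\<integral>\<^sup>+g. invbd (Suc (n - 1)) l x {..<?N} i g \<partial>?P)
      \<le> ennreal (7 * real ?N * (14 * real ?N * (2 / D) powr (1 / 4) * real ?N) ^ (n - 1))"
      using l D n N x gap by (intro nn_integral_invbd) auto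
    then show "(\<integral>\<^sup>+g. invbd n l x {..<?N} i g \<partial>?P) \<le> ennreal E" using n by (simp add: E_def)
  next
    fix i assume "i \<in> {..<d}"
    then show "(\<integral>\<^sup>+g. ennreal (gsize l g i) \<partial>?P) \<le> ennreal (1 + real l)"
      by (intro nn_integral_gsize) auto
  qed auto
  also have "\<dots> = ennreal (real ?N * (1 / \<tau> * E) + real d * (1 / \<Gamma> * (1 + real l)))"
    using \<tau>0 \<Gamma>0 E0
    by (simp add: ennreal_mult[symmetric] ennreal_of_nat_eq_real_of_nat ennreal_plus[symmetric] del: ennreal_plus)
  also have "real ?N * (1 / \<tau> * E) + real d * (1 / \<Gamma> * (1 + real l)) = \<delta>"
  proof -
    have half: "a * (1 / (2 * a * e / \<delta>) * e) = \<delta> / 2" if "0 < a" "0 < e" for a e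
      using that \<delta> by (simp add: field_simps)
    have 1: "real ?N * (1 / \<tau> * E) = \<delta> / 2" unfolding \<tau>E using N0 E0 by (rule half)
    have 2: "real d * (1 / \<Gamma> * (1 + real l)) = \<delta> / 2" unfolding \<Gamma> using d by (intro half) auto
    show ?thesis unfolding 1 2 by simp
  qed
  finally have HI: "(\<integral>\<^sup>+g. H g \<partial>?P) \<le> ennreal \<delta>" .
  define Bad where "Bad = {g \<in> space ?P. 1 \<le> H g}"
  have Bad: "Bad \<in> sets ?P" unfolding Bad_def using mH by measurable
  have "emeasure ?P Bad \<le> (\<integral>\<^sup>+g. H g \<partial>?P)"
  proof -
    have "emeasure ?P Bad = (\<integral>\<^sup>+g. indicator Bad g \<partial>?P)" using Bad by simp
    also have "\<dots> \<le> (\<integral>\<^sup>+g. H g \<partial>?P)" by (intro nn_integral_mono) (auto simp: Bad_def indicator_def)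
    finally show ?thesis .
  qed
  then have "emeasure ?P Bad \<le> ennreal \<delta>" using HI by (rule order_trans)
  then have mB: "measure ?P Bad \<le> \<delta>"
    using \<delta> by (simp add: finite_measure.emeasure_eq_measure[OF fP])
  have GS: "?G \<in> sets ?P"
  proof -
    have "{g \<in> space ?P. \<forall>i\<in>{..<?N}. invbd n l x {..<?N} i g \<le> ennreal \<tau>} \<in> sets ?P"
      using mU by (intro sets.sets_Collect_countable_All' borel_measurable_le) auto
    moreover have "{g \<in> space ?P. (\<Sum>i<d. gsize l g i) \<le> \<Gamma>} \<in> sets ?P"
      using mG by (intro borel_measurable_le borel_measurable_sum) auto
    ultimately have "{g \<in> space ?P. \<forall>i\<in>{..<?N}. invbd n l x {..<?N} i g \<le> ennreal \<tau>}
        \<inter> {g \<in> space ?P. (\<Sum>i<d. gsize l g i) \<le> \<Gamma>} \<in> sets ?P" by (rule sets.Int)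
    also have "{g \<in> space ?P. \<forall>i\<in>{..<?N}. invbd n l x {..<?N} i g \<le> ennreal \<tau>}
        \<inter> {g \<in> space ?P. (\<Sum>i<d. gsize l g i) \<le> \<Gamma>} = ?G" by auto
    finally show ?thesis .
  qed
  have sub: "space ?P - Bad \<subseteq> ?G"
  proof
    fix g assume g: "g \<in> space ?P - Bad"
    then have H: "H g < 1" by (auto simp: Bad_def not_le)
    have "invbd n l x {..<?N} i g \<le> ennreal \<tau>" if i: "i < ?N" for i
    proof -
      have "ennreal (1 / \<tau>) * invbd n l x {..<?N} i g \<le> (\<Sum>i<?N. ennreal (1 / \<tau>) * invbd n l x {..<?N} i g)"
        using i by (intro member_le_sum) auto
      also have "\<dots> \<le> H g" unfolding H_def by simp
      finally have "ennreal (1 / \<tau>) * invbd n l x {..<?N} i g \<le> 1" using H by simp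
      then have "ennreal \<tau> * (ennreal (1 / \<tau>) * invbd n l x {..<?N} i g) \<le> ennreal \<tau> * 1"
        by (rule mult_left_mono) simp
      then show ?thesis using \<tau>0 by (simp add: mult.assoc[symmetric] ennreal_mult[symmetric])
    qed
    moreover have "(\<Sum>i<d. gsize l g i) \<le> \<Gamma>"
    proof -
      have "(\<Sum>i<d. ennreal (1 / \<Gamma>) * ennreal (gsize l g i)) = ennreal (1 / \<Gamma> * (\<Sum>i<d. gsize l g i))"
        using \<Gamma>0 by (simp add: sum_distrib_left ennreal_mult[symmetric] less_imp_le sum_ennreal)
      moreover have "(\<Sum>i<d. ennreal (1 / \<Gamma>) * ennreal (gsize l g i)) \<le> H g" unfolding H_def by simp
      ultimately have "ennreal (1 / \<Gamma> * (\<Sum>i<d. gsize l g i)) \<le> H g" by (simp only:)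
      then have "ennreal (1 / \<Gamma> * (\<Sum>i<d. gsize l g i)) \<le> 1" using H by (meson less_imp_le order_trans)
      then have "1 / \<Gamma> * (\<Sum>i<d. gsize l g i) \<le> 1" by (simp only: ennreal_le_1)
      then show ?thesis using \<Gamma>0 by (simp add: field_simps)
    qed
    ultimately show "g \<in> ?G" using g by auto
  qed
  have "1 - \<delta> \<le> 1 - measure ?P Bad" using mB by simp
  also have "\<dots> = measure ?P (space ?P - Bad)" using prob_space.prob_compl[OF pP Bad] by simp
  also have "\<dots> \<le> measure ?P ?G" using sub GS by (rule finite_measure.finite_measure_mono[OF fP])
  finally show ?thesis .
qed

text \<open>A factor \<open>N = n l \<ge> 3\<close> per step of the recursion is harmless since \<open>N \<le> (N - 1)\<^sup>2 \<le> 1 / D\<^sup>2\<close>; for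
  \<open>N \<le> 2\<close> there is at most one step, which the term \<open>ln (d / \<delta>)\<close> pays for.\<close>

lemma log_budget:
  fixes \<delta> D :: real and n l r d :: nat
  assumes r: "0 < r" "r < d" and l: "0 < l" and n: "n = nat \<lceil>real r / real l\<rceil>" and N: "n * l \<le> d"
    and \<delta>: "0 < \<delta>" "\<delta> < 1" and D: "0 < D" "D \<le> 1"
    and DN: "real (n * l - 1) * D \<le> 1" and D1: "n * l = 1 \<Longrightarrow> D = 1"
    and \<tau>: "\<tau> = 2 * real (n * l) * (7 * real (n * l) * (14 * real (n * l) * (2 / D) powr (1 / 4) * real (n * l)) ^ (n - 1)) / \<delta>"
    and \<Gamma>: "\<Gamma> = 2 * real d * (1 + real l) / \<delta>"
  shows "\<exists>m. 3 * real d * \<tau> ^ 4 * real n * \<Gamma> \<le> 2 ^ m \<and>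
    real (m + n) \<le> 100 * (real r / real l * ln (1 / D) + ln (real d / \<delta>))"
proof -
  define N' where "N' = real (n * l)"
  define L where "L = ln (real d / \<delta>)"
  define G where "G = real r / real l * ln (1 / D)"
  have n0: "0 < n" using r l by (simp add: n)
  \<comment> \<open>The recursion factor occurs \<open>n - 1\<close> times, and rounding up gives
    \<open>n - 1 \<le> r / l\<close>. This is what the gap term can pay for; \<open>n\<close> itself
    may exceed \<open>r / l\<close>.\<close>
  have n1r: "real (n - 1) \<le> real r / real l"
  proof -
    have "real n = of_int \<lceil>real r / real l\<rceil>" using n0 n by simp
    then have "real n < real r / real l + 1" by linarith
    then show ?thesis using n0 by (simp add: of_nat_diff)
  qed
  have N1: "1 \<le> N'" and Nd: "N' \<le> real d"
  proof -
    have "1 \<le> n * l" using n0 l by simp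
    then show "1 \<le> N'" unfolding N'_def by linarith
    show "N' \<le> real d" unfolding N'_def using N by (rule of_nat_mono)
  qed
  have nl: "real n \<le> N'" "real l \<le> N'" unfolding N'_def using n0 l by auto
  have nd: "real n \<le> real d" "real l \<le> real d" using nl Nd by auto
  have d2: "2 \<le> real d" using r by simp
  have ln2: "2 / 3 \<le> ln (2::real)" by (rule ln2_ge_two_thirds)
  have lnD: "0 \<le> ln (1 / D)" using D by simp
  have Ld: "ln (real d) \<le> L" and L\<delta>: "ln (1 / \<delta>) \<le> L" and L2: "ln 2 \<le> L"
  proof -
    have L: "L = ln (real d) + ln (1 / \<delta>)" using d2 \<delta> by (simp add: L_def ln_div)
    have "0 \<le> ln (1 / \<delta>)" using \<delta> by simp
    moreover have "ln 2 \<le> ln (real d)" using d2 by simp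
    moreover have "0 < ln (2::real)" by simp
    ultimately show "ln (real d) \<le> L" "ln (1 / \<delta>) \<le> L" "ln 2 \<le> L" unfolding L by linarith+
  qed
  have L0: "2 / 3 \<le> L" using ln2 L2 by linarith
  have G0: "0 \<le> G" unfolding G_def using lnD by (intro mult_nonneg_nonneg) auto
  \<comment> \<open>\<open>Y\<close> is the fourth power of the factor gained per level, and
    \<open>X\<close> is the quantity to be dominated by \<open>2 ^ m\<close>, with the sizes outside
    the power of \<open>Y\<close> replaced by \<open>d\<close>.\<close>
  define Y where "Y = 14 ^ 4 * N' ^ 8 * (2 / D)"
  define X where "X = 12 * 14 ^ 4 * real d ^ 12 * (1 / \<delta>) ^ 5 * Y ^ (n - 1)"
  have Y0: "0 < Y" using N1 D by (simp add: Y_def)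
  have X0: "0 < X" using d2 \<delta> Y0 by (simp add: X_def)
  have XB: "3 * real d * \<tau> ^ 4 * real n * \<Gamma> \<le> X"
  proof -
    have q4: "((2 / D) powr (1 / 4)) ^ 4 = 2 / D" using D by (intro powr_quarter_power) auto
    have "\<tau> ^ 4 = 14 ^ 4 * N' ^ 8 * (1 / \<delta>) ^ 4 * ((14 * N' * (2 / D) powr (1 / 4) * N') ^ (n - 1)) ^ 4"
      unfolding \<tau> N'_def[symmetric] by (simp add: power_mult_distrib power_divide mult_ac power_add[symmetric])
    also have "((14 * N' * (2 / D) powr (1 / 4) * N') ^ (n - 1)) ^ 4 = ((14 * N' * (2 / D) powr (1 / 4) * N') ^ 4) ^ (n - 1)"
      by (simp add: power_mult[symmetric] mult.commute)
    also have "(14 * N' * (2 / D) powr (1 / 4) * N') ^ 4 = Y"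
      unfolding power_mult_distrib q4 by (simp add: Y_def power_add[symmetric])
    finally have \<tau>4: "\<tau> ^ 4 = 14 ^ 4 * N' ^ 8 * (1 / \<delta>) ^ 4 * Y ^ (n - 1)" .
    have "3 * real d * \<tau> ^ 4 * real n * \<Gamma>
       = (N' ^ 8 * (real n * (1 + real l))) * (6 * real d * real d * 14 ^ 4 * (1 / \<delta>) ^ 5 * Y ^ (n - 1))"
      unfolding \<tau>4 \<Gamma> by (simp add: field_simps eval_nat_numeral)
    also have "\<dots> \<le> (real d ^ 8 * (real d * (2 * real d))) * (6 * real d * real d * 14 ^ 4 * (1 / \<delta>) ^ 5 * Y ^ (n - 1))"
      using N1 Nd nd d2 Y0 \<delta> by (intro mult_right_mono mult_mono power_mono) auto
    also have "\<dots> = X" by (simp add: X_def eval_nat_numeral mult_ac)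
    finally show ?thesis .
  qed
  have lnX: "ln X = ln (12 * 14 ^ 4) + 12 * ln (real d) + 5 * ln (1 / \<delta>) + real (n - 1) * ln Y"
    unfolding X_def using d2 \<delta> Y0 by (simp add: ln_mult ln_realpow)
  have lnY: "ln Y = ln (2 * 14 ^ 4) + 8 * ln N' + ln (1 / D)"
  proof -
    have "ln (c * N' ^ 8 * (1 / D)) = ln c + 8 * ln N' + ln (1 / D)" if "0 < c" for c
      using that N1 D by (simp add: ln_mult ln_div ln_realpow)
    from this[of "2 * 14 ^ 4"] show ?thesis by (simp add: Y_def)
  qed
  have c1: "ln (12 * 14 ^ 4 :: real) \<le> 19 * L"
  proof -
    have "ln (12 * 14 ^ 4 :: real) \<le> ln (2 ^ 19)" by (subst ln_le_cancel_iff) auto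
    also have "\<dots> = 19 * ln 2" by (subst ln_realpow) auto
    finally show ?thesis using L2 by simp
  qed
  have c2: "ln (2 * 14 ^ 4 :: real) \<le> 17 * ln 2"
  proof -
    have "ln (2 * 14 ^ 4 :: real) \<le> ln (2 ^ 17)" by (subst ln_le_cancel_iff) auto
    also have "\<dots> = 17 * ln 2" by (subst ln_realpow) auto
    finally show ?thesis .
  qed
  have GY: "real (n - 1) * (ln Y + 1) \<le> 36 * G + 27 * L"
  proof -
    consider "n = 1" | "2 \<le> n" "n * l = 2" | "3 \<le> n * l" using n0 l
      by (metis One_nat_def Suc_leI less_2_cases_iff less_one linorder_not_less mult_is_0 nat_mult_eq_1_iff numeral_2_eq_2 numeral_3_eq_3 not_less_eq_eq order_antisym_conv)
    then show ?thesis
    proof cases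
      case 1
      then show ?thesis using G0 L0 by simp
    next
      case 2
      then have "n = 2"
        by (metis dvd_triv_left le_antisym nat_dvd_not_less not_less zero_less_numeral)
      moreover have "ln N' = ln 2" using 2 by (simp add: N'_def)
      moreover have "ln (1 / D) \<le> G"
      proof -
        have "1 * ln (1 / D) \<le> real r / real l * ln (1 / D)"
          using n1r \<open>n = 2\<close> lnD by (intro mult_right_mono) auto
        then show ?thesis by (simp add: G_def)
      qed
      ultimately show ?thesis unfolding lnY using c2 L2 L0 G0 by simp
    next
      case 3
      have "1 \<le> n * l" using 3 by linarith
      then have NN: "N' - 1 = real (n * l - 1)" by (simp only: N'_def of_nat_diff of_nat_1)
      have N3: "3 \<le> N'" using 3 unfolding N'_def by linarith
      have "N' - 1 \<le> 1 / D" using DN D unfolding NN by (simp add: field_simps)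
      then have a: "ln (N' - 1) \<le> ln (1 / D)" using N3 D by (subst ln_le_cancel_iff) auto
      have "ln 2 \<le> ln (N' - 1)" using N3 by simp
      with a have b: "ln 2 \<le> ln (1 / D)" by linarith
      have "N' \<le> (N' - 1)\<^sup>2"
      proof -
        have "0 \<le> N' * (N' - 3)" using N3 by simp
        then show ?thesis by (simp add: power2_eq_square algebra_simps)
      qed
      then have "ln N' \<le> ln ((N' - 1)\<^sup>2)" using N3 by (subst ln_le_cancel_iff) auto
      also have "\<dots> = 2 * ln (N' - 1)" using N3 by (subst ln_realpow) auto
      finally have c: "ln N' \<le> 2 * ln (1 / D)" using a by linarith
      have "ln Y + 1 \<le> 36 * ln (1 / D)" unfolding lnY using b c c2 ln2 by linarith
      then have "real (n - 1) * (ln Y + 1) \<le> real (n - 1) * (36 * ln (1 / D))" by (rule mult_left_mono) simp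
      also have "\<dots> \<le> real r / real l * (36 * ln (1 / D))" using n1r lnD by (intro mult_right_mono) auto
      also have "\<dots> = 36 * G" by (simp add: G_def)
      finally show ?thesis using L0 by simp
    qed
  qed
  define m where "m = nat \<lceil>ln X / ln 2\<rceil>"
  have "X \<le> 2 ^ m"
  proof -
    have "ln X / ln 2 \<le> real m" unfolding m_def by (rule real_nat_ceiling_ge)
    then have "ln X \<le> real m * ln 2" by (simp add: field_simps)
    also have "\<dots> = ln (2 ^ m)" by (simp add: ln_realpow)
    finally show ?thesis using X0 by (subst (asm) ln_le_cancel_iff) auto
  qed
  moreover have "real (m + n) \<le> 100 * (G + L)"
  proof -
    have "real m \<le> max 0 (ln X / ln 2) + 1"
    proof (cases "0 \<le> ln X / ln 2")
      case True
      then have "real m = of_int \<lceil>ln X / ln 2\<rceil>" unfolding m_def by (intro of_nat_nat) linarith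
      then show ?thesis using True by linarith
    next
      case False
      then have "m = 0" unfolding m_def by (simp add: ceiling_le_iff)
      then show ?thesis by simp
    qed
    moreover have "max 0 (ln X / ln 2) \<le> max 0 (ln X) * (3 / 2)"
    proof (cases "0 \<le> ln X")
      case True
      have "ln X / ln 2 \<le> ln X / (2 / 3)" using True ln2 by (intro divide_left_mono) auto
      then show ?thesis using True by simp
    next
      case False
      then have "ln X / ln 2 \<le> 0" by (simp add: divide_nonpos_pos)
      then show ?thesis by simp
    qed
    moreover have S: "ln X + real (n - 1) \<le> 36 * G + 63 * L"
      unfolding lnX using GY c1 Ld L\<delta> by (simp add: distrib_left)
    moreover have "real n = real (n - 1) + 1" using n0 by (simp add: of_nat_diff)
    moreover have "max 0 (ln X) + real (n - 1) \<le> 36 * G + 63 * L"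
    proof (cases "0 \<le> ln X")
      case True
      then show ?thesis using S by simp
    next
      case False
      have "0 \<le> ln Y \<or> n = 1"
      proof -
        have "0 \<le> ln (2 * 14 ^ 4 :: real)" "0 \<le> ln N'" using N1 by auto
        then show ?thesis unfolding lnY using lnD by linarith
      qed
      then have "real (n - 1) * 1 \<le> real (n - 1) * (ln Y + 1)"
        using mult_left_mono[of 1 "ln Y + 1" "real (n - 1)"] by auto
      then show ?thesis using False GY L0 G0 by simp
    qed
    \<comment> \<open>Origin of 100: since \<open>1 / ln 2 \<le> 3 / 2\<close>, the coefficients are
      54 for \<open>G\<close> and 94.5 for \<open>L\<close>, and the additive 2 from rounding is at
      most \<open>3 * L\<close>.\<close>
    moreover have "a + b \<le> 100 * (G + L)"
      if "a \<le> u + 1" "u \<le> v * (3 / 2)" "v + c \<le> 36 * G + 63 * L" "b = c + 1" "0 \<le> c" for a b c u v :: real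
    proof -
      have "a + b \<le> 3 / 2 * (v + c) + 2" using that by argo
      also have "\<dots> \<le> 3 / 2 * (36 * G + 63 * L) + 2" using that by argo
      also have "\<dots> \<le> 100 * (G + L)" using L0 G0 by argo
      finally show ?thesis .
    qed
    ultimately have "real m + real n \<le> 100 * (G + L)" using of_nat_0_le_iff[of "n - 1", where 'a = real] by blast
    then show ?thesis by simp
  qed
  ultimately show ?thesis using XB unfolding G_def L_def by (intro exI[of _ m]) auto
qed

section \<open>From the good event to the probability bound\<close>

context eigenbasis begin

definition rate :: "nat \<Rightarrow> int \<Rightarrow> nat \<Rightarrow> real \<Rightarrow> real" where
  "rate r s t \<mu> = 2 * exp (- ((real t - of_int s) / (3 * sqrt ((lm r + \<mu>) / (lm (d - 1) + \<mu>)))))"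

lemma rate_pos: "0 < rate r s t \<mu>"
  by (simp add: rate_def)

lemma isCont_rate:
  assumes "r < d" "0 \<le> \<mu>" shows "isCont (\<lambda>\<mu>. (rate r s t \<mu>)\<^sup>2) \<mu>"
proof -
  have p: "0 < lm r + \<mu>" "0 < lm (d - 1) + \<mu>" using pos[of r] pos[of "d - 1"] assms by auto
  then have "3 * sqrt ((lm r + \<mu>) / (lm (d - 1) + \<mu>)) \<noteq> 0" by simp
  then show ?thesis unfolding rate_def using p by (intro continuous_intros) auto
qed

text \<open>The zero vector has relative error 1. This settles \<open>t < s\<close>, where the
  exponent is positive and the bound exceeds 1.\<close>

lemma attains_trivial:
  assumes \<mu>: "0 \<le> \<mu>" and c: "1 \<le> c"
  shows "attains \<beta> l t \<mu> (c * sol2 \<beta> \<mu>) g"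
proof -
  have w: "0 < lm i + \<mu>" if "i < d" for i using pos[OF that] \<mu> by simp
  have "err2 \<beta> \<mu> (\<lambda>i. 0) = sol2 \<beta> \<mu>"
    unfolding err2_def sol2_def
  proof (rule sum.cong[OF refl])
    fix i assume "i \<in> {..<d}"
    then have "lm i + \<mu> \<noteq> 0" using w[of i] by auto
    then show "(lm i + \<mu>) * (0 - \<beta> i / (lm i + \<mu>))\<^sup>2 = (\<beta> i)\<^sup>2 / (lm i + \<mu>)"
      by (simp add: power2_eq_square)
  qed
  moreover have "0 \<le> sol2 \<beta> \<mu>"
    unfolding sol2_def by (intro sum_nonneg divide_nonneg_nonneg) (use w less_imp_le in auto)
  then have "1 * sol2 \<beta> \<mu> \<le> c * sol2 \<beta> \<mu>" using c by (intro mult_right_mono)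
  ultimately show ?thesis unfolding attains_def by (intro bexI[OF _ comb_zero]) simp
qed

lemma rate_ge_1:
  assumes "r < d" "0 \<le> \<mu>" "real t \<le> of_int s"
  shows "1 \<le> (rate r s t \<mu>)\<^sup>2"
proof -
  have p: "0 < lm r + \<mu>" "0 < lm (d - 1) + \<mu>" using pos[of r] pos[of "d - 1"] assms by auto
  have "0 \<le> - ((real t - of_int s) / (3 * sqrt ((lm r + \<mu>) / (lm (d - 1) + \<mu>))))"
    using assms(3) p by (simp add: divide_nonpos_nonneg)
  then have "1 \<le> rate r s t \<mu>"
    unfolding rate_def using one_le_exp_iff[of "- ((real t - of_int s) / (3 * sqrt ((lm r + \<mu>) / (lm (d - 1) + \<mu>))))"]
    by linarith
  then show ?thesis by simp
qed

lemma attains_of_top_small: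
  assumes dec: "\<And>i j. i \<le> j \<Longrightarrow> j < d \<Longrightarrow> lm j \<le> lm i" and r: "r < d" and \<mu>: "0 \<le> \<mu>"
    and top: "\<And>z. (\<And>j a. j < l \<Longrightarrow> a < s \<Longrightarrow> (\<Sum>i<d. z i * (lm i ^ a * g (i, j))) = 0) \<Longrightarrow>
      (\<Sum>i\<in>{i. i < d \<and> 2 * lm r < lm i}. (z i)\<^sup>2) \<le> 1 / 8 * (\<Sum>i\<in>{i. i < d \<and> lm i \<le> 2 * lm r}. (z i)\<^sup>2)"
  shows "attains \<beta> l t \<mu> ((rate r (int s) t \<mu>)\<^sup>2 * sol2 \<beta> \<mu>) g"
proof (cases "s \<le> t")
  case True
  have "\<exists>x \<in> comb (kgen lm (block_cols \<beta> g)) ({..l} \<times> {..<t}).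
     (\<Sum>i<d. (lm i + \<mu>) * (x i - \<beta> i / (lm i + \<mu>))\<^sup>2)
     \<le> (2 * exp (- (real (t - s) / (3 * sqrt ((lm r + \<mu>) / (lm (d - 1) + \<mu>))))))\<^sup>2
        * (\<Sum>i<d. (\<beta> i)\<^sup>2 / (lm i + \<mu>))"
  proof (rule deflated_krylov_error[OF pos dec r \<mu> True])
    fix z :: "nat \<Rightarrow> real"
    assume "\<And>j a. j < l \<Longrightarrow> a < s \<Longrightarrow> (\<Sum>i<d. z i * (lm i ^ a * g (i, j))) = 0"
    then show "(\<Sum>i<d. (z i)\<^sup>2) \<le> 9 / 4 * (lm r + \<mu>) * (\<Sum>i<d. (z i)\<^sup>2 / (lm i + \<mu>))"
      by (intro smooth_of_top_small[OF pos r \<mu>] top)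
  qed auto
  moreover have "real (t - s) = real t - of_int (int s)" using True by (simp add: of_nat_diff)
  ultimately show ?thesis unfolding attains_def err2_def sol2_def rate_def by simp
next
  case False
  then show ?thesis by (intro attains_trivial[OF \<mu>] rate_ge_1[OF r \<mu>]) auto
qed

lemma attains_exact:
  assumes r: "r < d" and \<mu>: "0 \<le> \<mu>"
  shows "attains \<beta> l t \<mu> ((rate r (int d) t \<mu>)\<^sup>2 * sol2 \<beta> \<mu>) g"
proof (cases "d \<le> t")
  case True
  obtain x where x: "x \<in> comb (kgen lm (block_cols \<beta> g)) ({..l} \<times> {..<t})" "\<forall>i<d. x i = \<beta> i / (lm i + \<mu>)"
    using krylov_exact[of d lm \<mu> t \<beta> g l] pos \<mu> True by blast
  have "err2 \<beta> \<mu> x = 0" unfolding err2_def using x(2) by (intro sum.neutral) auto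
  moreover have "0 \<le> sol2 \<beta> \<mu>"
    unfolding sol2_def
  proof (intro sum_nonneg divide_nonneg_nonneg)
    fix i assume "i \<in> {..<d}"
    then show "0 \<le> lm i + \<mu>" using pos[of i] \<mu> by simp
  qed simp
  ultimately show ?thesis unfolding attains_def using x(1) by (intro bexI[of _ x]) auto
next
  case False
  then show ?thesis by (intro attains_trivial[OF \<mu>] rate_ge_1[OF r \<mu>]) auto
qed

text \<open>The good event is about the rotated block, the theorem about the original one; rotation
  invariance equates the probabilities. The target set has to be shown measurable, since
  \<open>measure\<close> is 0 by default on other sets.\<close>

lemma bcg_probability:
  assumes b: "b \<in> carrier_vec d" "b \<noteq> 0\<^sub>v d" and r: "r < d"
    and G: "1 - \<delta> \<le> measure (gprod ({..<d} \<times> {..<l}))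
      {g \<in> space (gprod ({..<d} \<times> {..<l})). Good g}"
    and good: "\<And>g \<mu>. Good g \<Longrightarrow> 0 \<le> \<mu> \<Longrightarrow> attains (eco U b) l t \<mu> ((rate r s t \<mu>)\<^sup>2 * sol2 (eco U b) \<mu>) g"
  shows "1 - \<delta> \<le> \<P>(\<omega> in gaussian_entries d l.
    \<forall>\<mu>\<ge>0. norm_wrt (shifted A \<mu>) (inv_mat (shifted A \<mu>) *\<^sub>v b
            - bcg A (starting_block b (Matrix.mat d l \<omega>)) 0 t \<mu>)
          / norm_wrt (shifted A \<mu>) (inv_mat (shifted A \<mu>) *\<^sub>v b) \<le> rate r s t \<mu>)"
proof -
  let ?P = "gprod ({..<d} \<times> {..<l})"
  define Q where "Q g \<longleftrightarrow> (\<forall>\<mu>\<ge>0. attains (eco U b) l t \<mu> ((rate r s t \<mu>)\<^sup>2 * sol2 (eco U b) \<mu>) g)" for g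
  define QS where "QS = {g \<in> space ?P. Q g}"
  have QS: "QS \<in> sets ?P"
    unfolding QS_def Q_def using isCont_rate[OF r] by (rule attains_all_measurable)
  have sP: "sets ?P = sets (lprod ({..<d} \<times> {..<l}))" by (intro sets_PiM_cong) auto
  have rm: "rot l \<in> measurable ?P ?P"
    using rot_measurable[of l] unfolding measurable_cong_sets[OF sP sP] .
  have pP: "prob_space ?P" by (intro prob_space_PiM prob_space_std_normal)
  have "1 - \<delta> \<le> measure ?P {g \<in> space ?P. Good g}" by (rule G)
  also have "\<dots> \<le> measure ?P QS"
    using good QS by (intro finite_measure.finite_measure_mono[OF prob_space.finite_measure[OF pP]])
      (auto simp: QS_def Q_def)
  also have "\<dots> = measure (distr ?P ?P (rot l)) QS" unfolding distr_rot ..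
  also have "\<dots> = measure ?P (rot l -` QS \<inter> space ?P)" by (rule measure_distr[OF rm QS])
  also have "rot l -` QS \<inter> space ?P = {\<omega> \<in> space ?P. Q (rot l \<omega>)}"
    using measurable_space[OF rm] by (auto simp: QS_def)
  also have "\<dots> = {\<omega> \<in> space (gaussian_entries d l). \<forall>\<mu>\<ge>0. norm_wrt (shifted A \<mu>) (inv_mat (shifted A \<mu>) *\<^sub>v b
            - bcg A (starting_block b (Matrix.mat d l \<omega>)) 0 t \<mu>)
          / norm_wrt (shifted A \<mu>) (inv_mat (shifted A \<mu>) *\<^sub>v b) \<le> rate r s t \<mu>}"
    using bcg_error_le_iff[OF _ b less_imp_le[OF rate_pos] rot_eco]
    unfolding Q_def attains_def gaussian_entries_def by simp
  finally show ?thesis unfolding gaussian_entries_def .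
qed

end

text \<open>Neighbouring gaps add up. The minimum therefore separates all pairs, and since the
  normalized eigenvalues descend from 1 without leaving [0, 1], the \<open>rounded r l - 1\<close>
  gaps total at most 1. The last fact lets the gap term pay for factors of \<open>n * l\<close> in
  \<open>log_budget\<close>.\<close>

lemma min_gap_props:
  assumes pos: "\<And>i. i < d \<Longrightarrow> 0 < lam (Suc i)" and dec: "\<And>i j. i \<le> j \<Longrightarrow> j < d \<Longrightarrow> lam (Suc j) \<le> lam (Suc i)"
    and N: "rounded r l \<le> d" and ne: "gap_indices r l \<noteq> {}"
  shows "0 \<le> min_gap lam r l" "min_gap lam r l \<le> 1"
    and "\<And>k k'. k < rounded r l \<Longrightarrow> k' < rounded r l \<Longrightarrow> k \<noteq> k' \<Longrightarrow>
      min_gap lam r l \<le> \<bar>lam (Suc k) / lam 1 - lam (Suc k') / lam 1\<bar>"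
    and "real (rounded r l - 1) * min_gap lam r l \<le> 1"
proof -
  define N where "N = rounded r l"
  define x where "x k = lam (Suc k) / lam 1" for k
  have N2: "2 \<le> N" using ne by (auto simp: gap_indices_def N_def)
  have Nd: "N \<le> d" using N by (simp add: N_def)
  have l1: "0 < lam 1" using pos[of 0] N2 Nd by simp
  have fin: "finite (gap_indices r l)" by (simp add: gap_indices_def)
  have le: "min_gap lam r l \<le> x k - x (Suc k)" if "Suc k < N" for k
  proof -
    have "Suc k \<in> gap_indices r l" using that by (auto simp: gap_indices_def N_def)
    then have "min_gap lam r l \<le> (lam (Suc k) - lam (Suc k + 1)) / lam 1"
      unfolding min_gap_def using fin by (intro Min_le) auto
    then show ?thesis by (simp add: x_def diff_divide_distrib)
  qed
  have xdec: "x j \<le> x i" if "i \<le> j" "j < N" for i j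
    using dec[of i j] that Nd l1 by (simp add: x_def divide_right_mono)
  have x01: "0 \<le> x i" if "i < N" for i using pos[of i] that Nd l1 by (simp add: x_def)
  have x0: "x 0 = 1" using l1 by (simp add: x_def)
  show m0: "0 \<le> min_gap lam r l"
    unfolding min_gap_def
  proof (rule Min.boundedI)
    fix a assume "a \<in> (\<lambda>i. (lam i - lam (i + 1)) / lam 1) ` gap_indices r l"
    then obtain i where i: "1 \<le> i" "i \<le> N - 1" "a = (lam i - lam (i + 1)) / lam 1"
      by (auto simp: gap_indices_def N_def)
    then show "0 \<le> a" using dec[of "i - 1" i] Nd N2 l1 by simp
  qed (use fin ne in auto)
  have tele: "real k * min_gap lam r l \<le> x 0 - x k" if "k < N" for k
    using that
  proof (induction k)
    case (Suc k)
    then show ?case using le[of k] by (simp add: algebra_simps)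
  qed simp
  have "N - 1 < N" using N2 by simp
  from tele[OF this] x01[OF this] x0 show m1: "real (rounded r l - 1) * min_gap lam r l \<le> 1"
    by (simp add: N_def)
  have "1 * min_gap lam r l \<le> real (N - 1) * min_gap lam r l"
    using N2 m0 by (intro mult_right_mono) auto
  then show "min_gap lam r l \<le> 1" using m1 by (simp add: N_def)
  have lt: "min_gap lam r l \<le> x k - x k'" if "k < k'" "k' < N" for k k'
    using le[of k] xdec[of "Suc k" k'] that by simp
  show "min_gap lam r l \<le> \<bar>lam (Suc k) / lam 1 - lam (Suc k') / lam 1\<bar>"
    if "k < rounded r l" "k' < rounded r l" "k \<noteq> k'" for k k'
    using lt[of k k'] lt[of k' k] that unfolding x_def N_def by (cases "k < k'") auto
qed

theorem theorem4p3:
  shows "\<exists>C :: real. C > 0 \<and>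
    (\<forall>(d :: nat) (l :: nat) (r :: nat) (A :: real mat) (lam :: nat \<Rightarrow> real) (b :: real vec) (\<delta> :: real).
       sym_pos_def d A \<and> eigenvalues_decreasing d A lam \<and>
       b \<in> carrier_vec d \<and> b \<noteq> 0\<^sub>v d \<and>
       l \<ge> 1 \<and> r + 1 \<le> d \<and> rounded r l \<le> d \<and> 0 < \<delta> \<and> \<delta> < 1 \<longrightarrow>
       (\<exists>s :: int.
          ereal (of_int s) \<le> ereal C * (gap_term lam r l + ereal (ln (real d / \<delta>))) \<and>
          (\<forall>t :: nat.
             \<P>(\<omega> in gaussian_entries d l.
                \<forall>\<mu> \<ge> 0.
                  norm_wrt (shifted A \<mu>)
                      (inv_mat (shifted A \<mu>) *\<^sub>v b
                         - bcg A (starting_block b (Matrix.mat d l \<omega>)) 0 t \<mu>)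
                    / norm_wrt (shifted A \<mu>) (inv_mat (shifted A \<mu>) *\<^sub>v b)
                  \<le> 2 * exp (- ((real t - of_int s) / (3 * sqrt (\<kappa> d lam (r + 1) \<mu>)))))
             \<ge> 1 - \<delta>)))"
proof (rule exI[of _ "100::real"], intro conjI allI impI)
  show "(0::real) < 100" by simp
  fix d l r :: nat and A :: "real mat" and lam :: "nat \<Rightarrow> real" and b :: "real vec" and \<delta> :: real
  assume *: "sym_pos_def d A \<and> eigenvalues_decreasing d A lam \<and>
       b \<in> carrier_vec d \<and> b \<noteq> 0\<^sub>v d \<and>
       l \<ge> 1 \<and> r + 1 \<le> d \<and> rounded r l \<le> d \<and> 0 < \<delta> \<and> \<delta> < 1"
  then have spd: "sym_pos_def d A" and lam: "eigenvalues_decreasing d A lam"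
    and b: "b \<in> carrier_vec d" "b \<noteq> 0\<^sub>v d" and l: "0 < l" and r: "r < d" and Nd: "rounded r l \<le> d"
    and \<delta>: "0 < \<delta>" "\<delta> < 1" by auto
  obtain U where U: "U \<in> carrier_mat d d" "transpose_mat U * U = 1\<^sub>m d" "U * transpose_mat U = 1\<^sub>m d"
    and ev: "\<And>i. i < d \<Longrightarrow> A *\<^sub>v col U i = lam (Suc i) \<cdot>\<^sub>v col U i" and pos: "\<And>i. i < d \<Longrightarrow> 0 < lam (Suc i)"
    using sym_pos_def_eigenbasis[OF spd lam] by blast
  define lm where "lm i = lam (Suc i)" for i
  interpret eigenbasis d A U lm
    using spd U ev pos by unfold_locales (auto simp: sym_pos_def_def lm_def)
  have dec: "lm j \<le> lm i" if "i \<le> j" "j < d" for i j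
    using lam that by (auto simp: eigenvalues_decreasing_def lm_def)
  let ?P = "gprod ({..<d} \<times> {..<l})"
  let ?pr = "\<lambda>s t. \<P>(\<omega> in gaussian_entries d l. \<forall>\<mu> \<ge> 0.
         norm_wrt (shifted A \<mu>) (inv_mat (shifted A \<mu>) *\<^sub>v b - bcg A (starting_block b (Matrix.mat d l \<omega>)) 0 t \<mu>)
           / norm_wrt (shifted A \<mu>) (inv_mat (shifted A \<mu>) *\<^sub>v b)
         \<le> 2 * exp (- ((real t - of_int s) / (3 * sqrt (\<kappa> d lam (r + 1) \<mu>)))))"
  let ?bound = "ereal 100 * (gap_term lam r l + ereal (ln (real d / \<delta>)))"
  have rate: "rate r s t \<mu> = 2 * exp (- ((real t - of_int s) / (3 * sqrt (\<kappa> d lam (r + 1) \<mu>))))" for s t \<mu>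
    using r by (simp add: rate_def \<kappa>_def lm_def)
  have L0: "0 \<le> ln (real d / \<delta>)"
  proof -
    have "1 \<le> real d" using r by simp
    then have "1 \<le> real d / \<delta>" using \<delta> by (simp add: le_divide_eq)
    then show ?thesis by simp
  qed
  have suff: "\<exists>s :: int. ereal (of_int s) \<le> ?bound \<and> (\<forall>t :: nat. ?pr s t \<ge> 1 - \<delta>)"
    if "ereal (real s) \<le> ?bound"
      "1 - \<delta> \<le> measure ?P {g \<in> space ?P. Good g}"
      "\<And>g \<mu> t. Good g \<Longrightarrow> 0 \<le> \<mu> \<Longrightarrow> attains (eco U b) l t \<mu> ((rate r (int s) t \<mu>)\<^sup>2 * sol2 (eco U b) \<mu>) g"
    for s :: nat and Good
  proof (intro exI[of _ "int s"] conjI allI)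
    show "ereal (of_int (int s)) \<le> ?bound" using that(1) by simp
    show "1 - \<delta> \<le> ?pr (int s) t" for t
      unfolding rate[symmetric] using b r that(2,3) by (rule bcg_probability)
  qed
  have top1: "1 - \<delta> \<le> measure ?P {g \<in> space ?P. True}"
  proof -
    have "prob_space ?P" by (intro prob_space_PiM prob_space_std_normal)
    then show ?thesis using \<delta> by (simp add: prob_space.prob_space)
  qed
  \<comment> \<open>The Vandermonde argument needs at least one row and positive gaps. For
    \<open>r = 0\<close> there is nothing to deflate and \<open>s = 0\<close>; for a vanishing gap
    the bound is infinite and \<open>s = d\<close> is admissible.\<close>
  consider "r = 0" | "gap_indices r l \<noteq> {}" "min_gap lam r l = 0" | "0 < r" "gap_indices r l = {} \<or> min_gap lam r l \<noteq> 0"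
    by blast
  then show "\<exists>s :: int. ereal (of_int s) \<le> ?bound \<and> (\<forall>t :: nat. ?pr s t \<ge> 1 - \<delta>)"
  proof cases
    case 1
    show ?thesis
    proof (rule suff[of 0 "\<lambda>_. True"])
      have "gap_term lam r l = 0" using 1 by (simp add: gap_term_def gap_indices_def rounded_def)
      then show "ereal (real 0) \<le> ?bound" using L0 by simp
      show "attains (eco U b) l t \<mu> ((rate r (int 0) t \<mu>)\<^sup>2 * sol2 (eco U b) \<mu>) g" if "0 \<le> \<mu>" for g \<mu> t
      proof (rule attains_of_top_small[OF dec r that])
        fix z :: "nat \<Rightarrow> real"
        have "\<not> 2 * lm r < lm i" if "i < d" for i using dec[of 0 i] pos[OF r] that 1 by (simp add: lm_def)
        then have empty: "{i. i < d \<and> 2 * lm r < lm i} = {}" by blast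
        show "(\<Sum>i\<in>{i. i < d \<and> 2 * lm r < lm i}. (z i)\<^sup>2) \<le> 1 / 8 * (\<Sum>i\<in>{i. i < d \<and> lm i \<le> 2 * lm r}. (z i)\<^sup>2)"
          unfolding empty by (simp add: sum_nonneg)
      qed auto
    qed (rule top1)
  next
    case 2
    show ?thesis
    proof (rule suff[of d "\<lambda>_. True"])
      show "ereal (real d) \<le> ?bound"
        using 2 by (simp add: gap_term_def)
      show "attains (eco U b) l t \<mu> ((rate r (int d) t \<mu>)\<^sup>2 * sol2 (eco U b) \<mu>) g" if "0 \<le> \<mu>" for g \<mu> t
        using r that by (rule attains_exact)
    qed (rule top1)
  next
    case 3
    define n where "n = nat \<lceil>real r / real l\<rceil>"
    have Neq: "rounded r l = n * l" by (simp add: rounded_def n_def mult.commute)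
    have n0: "0 < n" using 3 l by (simp add: n_def)
    have rN: "r \<le> n * l"
    proof -
      have "real r / real l \<le> real n" unfolding n_def by (rule real_nat_ceiling_ge)
      then have "real r \<le> real (n * l)" using l by (simp add: field_simps)
      then show ?thesis by (simp only: of_nat_le_iff)
    qed
    \<comment> \<open>An empty minimum means \<open>n * l = 1\<close>, a single row without any gap;
      \<open>D = 1\<close> then makes \<open>ln (1 / D)\<close> zero, in agreement with
      \<open>gap_term\<close>.\<close>
    define D where "D = (if gap_indices r l = {} then 1 else min_gap lam r l)"
    have gi: "gap_indices r l = {} \<longleftrightarrow> n * l = 1"
    proof -
      define M where "M = n * l"
      have "1 \<le> M" using n0 l by (simp add: M_def)
      then show ?thesis unfolding gap_indices_def Neq M_def[symmetric] by auto
    qed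
    have posS: "\<And>i. i < d \<Longrightarrow> 0 < lam (Suc i)" and decS: "\<And>i j. i \<le> j \<Longrightarrow> j < d \<Longrightarrow> lam (Suc j) \<le> lam (Suc i)"
      using pos dec by (auto simp: lm_def)
    have D: "0 < D" "D \<le> 1" "real (n * l - 1) * D \<le> 1" "n * l = 1 \<Longrightarrow> D = 1"
      and gap: "\<And>k k'. k < n * l \<Longrightarrow> k' < n * l \<Longrightarrow> k \<noteq> k' \<Longrightarrow> D \<le> \<bar>lm k / lm 0 - lm k' / lm 0\<bar>"
    proof -
      have "0 < D \<and> D \<le> 1 \<and> real (n * l - 1) * D \<le> 1 \<and> (n * l = 1 \<longrightarrow> D = 1) \<and>
        (\<forall>k k'. k < n * l \<longrightarrow> k' < n * l \<longrightarrow> k \<noteq> k' \<longrightarrow> D \<le> \<bar>lm k / lm 0 - lm k' / lm 0\<bar>)"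
      proof (cases "gap_indices r l = {}")
        case True
        then show ?thesis using gi by (simp add: D_def)
      next
        case False
        note mg = min_gap_props[of d lam, OF posS decS Nd False]
        have Dm: "D = min_gap lam r l" using False by (simp add: D_def)
        have "0 < D" using mg(1) 3(2) False unfolding Dm by simp
        then show ?thesis
        proof (intro conjI allI impI)
          show "D \<le> 1" unfolding Dm by (rule mg(2))
          show "real (n * l - 1) * D \<le> 1" using mg(4) unfolding Dm Neq .
          show "D = 1" if "n * l = 1" using that gi False by simp
          show "D \<le> \<bar>lm k / lm 0 - lm k' / lm 0\<bar>" if "k < n * l" "k' < n * l" "k \<noteq> k'" for k k'
            using mg(3)[of k k'] that unfolding Dm Neq lm_def by simp
        qed
      qed
      then show "0 < D" "D \<le> 1" "real (n * l - 1) * D \<le> 1" "n * l = 1 \<Longrightarrow> D = 1"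
        "\<And>k k'. k < n * l \<Longrightarrow> k' < n * l \<Longrightarrow> k \<noteq> k' \<Longrightarrow> D \<le> \<bar>lm k / lm 0 - lm k' / lm 0\<bar>" by blast+
    qed
    define \<tau> where "\<tau> = 2 * real (n * l) * (7 * real (n * l) * (14 * real (n * l) * (2 / D) powr (1 / 4) * real (n * l)) ^ (n - 1)) / \<delta>"
    define \<Gamma> where "\<Gamma> = 2 * real d * (1 + real l) / \<delta>"
    have Nd': "n * l \<le> d" using Nd by (simp add: Neq)
    obtain m where m: "3 * real d * \<tau> ^ 4 * real n * \<Gamma> \<le> 2 ^ m"
      and mn: "real (m + n) \<le> 100 * (real r / real l * ln (1 / D) + ln (real d / \<delta>))"
      using log_budget[OF 3(1) r l n_def Nd' \<delta> D(1,2,3,4) \<tau>_def \<Gamma>_def] by blast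
    have \<tau>0: "0 \<le> \<tau>" unfolding \<tau>_def using \<delta> by (intro divide_nonneg_pos mult_nonneg_nonneg zero_le_power) auto
    define Good where "Good g \<longleftrightarrow> (\<forall>i<n * l. invbd n l (\<lambda>i. lm i / lm 0) {..<n * l} i g \<le> ennreal \<tau>)
      \<and> (\<Sum>i<d. gsize l g i) \<le> \<Gamma>" for g
    have x01: "0 \<le> lm k / lm 0 \<and> lm k / lm 0 \<le> 1" if "k < n * l" for k
    proof -
      have "0 < lm 0" "0 < lm k" "lm k \<le> lm 0" using posS[of 0] posS[of k] dec[of 0 k] that Nd' by (auto simp: lm_def)
      then show ?thesis by simp
    qed
    show ?thesis
    proof (rule suff[of "m + n" Good])
      have "gap_term lam r l = ereal (real r / real l * ln (1 / D))"
        using 3(2) by (auto simp: gap_term_def D_def zero_ereal_def)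
      then show "ereal (real (m + n)) \<le> ?bound"
        using mn by simp
      show "1 - \<delta> \<le> measure ?P {g \<in> space ?P. Good g}"
        unfolding Good_def using l n0 Nd' D(1,2) \<delta>(1) x01 gap \<tau>_def \<Gamma>_def by (rule good_event)
      show "attains (eco U b) l t \<mu> ((rate r (int (m + n)) t \<mu>)\<^sup>2 * sol2 (eco U b) \<mu>) g"
        if g: "Good g" and \<mu>: "0 \<le> \<mu>" for g \<mu> t
      proof (rule attains_of_top_small[OF dec r \<mu>])
        fix z :: "nat \<Rightarrow> real"
        assume "\<And>j a. j < l \<Longrightarrow> a < m + n \<Longrightarrow> (\<Sum>i<d. z i * (lm i ^ a * g (i, j))) = 0"
        then show "(\<Sum>i\<in>{i. i < d \<and> 2 * lm r < lm i}. (z i)\<^sup>2) \<le> 1 / 8 * (\<Sum>i\<in>{i. i < d \<and> lm i \<le> 2 * lm r}. (z i)\<^sup>2)"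
          using g unfolding Good_def
          by (intro krylov_top_small[OF posS[folded lm_def] dec r rN Nd' \<tau>0 _ _ m]) auto
      qed auto
    qed
  qed
qed

end
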